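(* Fix $\tau$ in the upper half plane, $N\ge1$, constants $(\nu')^\pm_\alpha\in\mathbb C$ ($\alpha=1,2,3$), and consider variables $S^i_0,S^i_1,S^i_2,S^i_3$ ($i=1,\dots,N$) and $S^\pm_0,S^\pm_1,S^\pm_2,S^\pm_3$ with Poisson brackets $$ \{S^\pm_\alpha,S^\pm_\beta\}=4i\sum_\gamma\varepsilon_{\alpha\beta\gamma}S^\pm_0S^\pm_\gamma,\qquad \{S^\pm_0,S^\pm_\alpha\}=2i\sum_{\beta,\gamma}\varepsilon_{\alpha\beta\gamma}\Bigl(S^\pm_\beta S^\pm_\gamma\bigl(E_2(\omega_\beta)-E_2(\omega_\gamma)\bigr)+2S^\pm_\beta(\nu')^\pm_\gamma\Bigr), $$ $$ \{S^i_\alpha,S^j_\beta\}=2i\,\delta^{ij}\sum_\gamma\varepsilon_{\alpha\beta\gamma}S^i_0S^i_\gamma,\qquad \{S^i_0,S^j_\alpha\}=i\,\delta^{ij}\sum_{\beta,\gamma}\varepsilon_{\alpha\beta\gamma}S^i_\beta S^i_\gamma\bigl(E_2(\omega_\beta)-E_2(\omega_\gamma)\bigr), $$ all brackets between variables belonging to different ones of the $N+2$ groups (and $\{S_0^i,S_0^j\}$) being zero. Let $$ L^i(z)=S^i_0\sigma_0+\sum_{\alpha}S^i_\alpha\varphi_\alpha(z)\sigma_\alpha,\qquad K^\pm(z)=S^\pm_0\sigma_0+\sum_{\alpha}\Bigl(S^\pm_\alpha\varphi_\alpha(z)+\frac{(\nu')^\pm_\alpha}{\varphi_\alpha(z)}\Bigr)\sigma_\alpha,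 $$ $$ h(z)=\mathrm{tr}\Bigl[K^+(z)L^N(z)\cdots L^1(z)K^-(z)\bigl(L^1(-z)\bigr)^{-1}\cdots\bigl(L^N(-z)\bigr)^{-1}\Bigr]. $$ Then the spin chain is integrable in the sense that $\{h(z),h(w)\}=0$ for all $z,w$. Assume moreover that the Casimir functions of the internal vertices are fixed so that $$\frac{(S_0^i)^2+\sum_{\alpha}(S_\alpha^i)^2E_2(\omega_\alpha)}{\sum_{\alpha}(S_\alpha^i)^2}=C$$ with one and the same constant $C$ for all $i=1,\dots,N$. Then on this level set the nearest-neighbour Hamiltonian $$ \begin{aligned} H={}&\ln\Bigl(S_0^-S_0^1+\sum_\alpha \bigl(S_\alpha^-S_\alpha^1(C-E_2(\omega_\alpha))+(\nu')^-_\alpha S_\alpha^1\bigr)\Bigr) +\ln\Bigl(S_0^NS_0^++\sum_\alpha\bigl(S_\alpha^NS_\alpha^+(C-E_2(\omega_\alpha))+(\nu')^+_\alpha S_\alpha^N\bigr)\Bigr)\\ &+\sum_{i=1}^{N-1}\ln\Bigl(S_0^iS_0^{i+1}+\sum_\alpha S_\alpha^iS_\alpha^{i+1}(C-E_2(\omega_\alpha))\Bigr) \end{aligned} $$ (local branches of $\ln$, where the arguments are nonzero) belongs to this commuting family: $\{H,h(w)\}=0$ for all $w$.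
   Context: $\omega_1=\frac12$, $\omega_2=\frac\tau2$, $\omega_3=\frac{1+\tau}2$; $\partial_\tau\omega_1=0$, $\partial_\tau\omega_2=\partial_\tau\omega_3=\frac12$. Greek indices range over $1,2,3$; $\varepsilon_{\alpha\beta\gamma}$ is the Levi-Civita symbol; $\sigma_0$ is the identity and $\sigma_\alpha$ are the Pauli matrices. $\vartheta(z)=\sum_{j\in\mathbb Z}\exp\bigl(\pi i(j+\frac12)^2\tau+2\pi i(j+\frac12)(z+\frac12)\bigr)$, $E_2(z)=-\partial_z^2\log\vartheta(z)$, $$\phi(u,z)=\frac{\vartheta(u+z)\vartheta'(0)}{\vartheta(u)\vartheta(z)},\qquad \varphi_\alpha(z)=\exp(2\pi i z\,\partial_\tau\omega_\alpha)\,\phi(z,\omega_\alpha).$$ The functions $\sum_\alpha(S^i_\alpha)^2$ and $(S^i_0)^2+\sum_\alpha E_2(\omega_\alpha)(S^i_\alpha)^2$ are Casimir functions of the bracket at vertex $i$. *)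

theory Defs
  imports "HOL-Analysis.Analysis"
begin

section \<open>Elliptic functions\<close>

definition theta :: "complex \<Rightarrow> complex \<Rightarrow> complex" where
  "theta \<tau> z = (\<Sum>\<^sub>\<infinity>j\<in>(UNIV :: int set).
     exp (pi * \<i> * (of_int j + 1/2)\<^sup>2 * \<tau> + 2 * pi * \<i> * (of_int j + 1/2) * (z + 1/2)))"

text \<open>The first derivative of \<open>log \<vartheta>\<close> is written as the logarithmic derivative
  \<open>\<vartheta>' / \<vartheta>\<close>, which does not depend on a branch of the logarithm.\<close>

definition E2 :: "complex \<Rightarrow> complex \<Rightarrow> complex" where
  "E2 \<tau> z = - deriv (\<lambda>u. deriv (theta \<tau>) u / theta \<tau> u) z"

definition Kronecker_phi :: "complex \<Rightarrow> complex \<Rightarrow> complex \<Rightarrow> complex" where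
  "Kronecker_phi \<tau> u z = theta \<tau> (u + z) * deriv (theta \<tau>) 0 / (theta \<tau> u * theta \<tau> z)"

text \<open>Greek indices are natural numbers in \<open>{1..3}\<close>; values at other indices are irrelevant.\<close>

definition half_period :: "complex \<Rightarrow> nat \<Rightarrow> complex" where
  "half_period \<tau> \<alpha> = (if \<alpha> = 1 then 1/2 else if \<alpha> = 2 then \<tau>/2 else (1 + \<tau>)/2)"

definition phi :: "complex \<Rightarrow> nat \<Rightarrow> complex \<Rightarrow> complex" where
  "phi \<tau> \<alpha> z =
     exp (2 * pi * \<i> * z * deriv (\<lambda>t. half_period t \<alpha>) \<tau>) * Kronecker_phi \<tau> z (half_period \<tau> \<alpha>)"

section \<open>Phase space and Poisson bracket\<close>

text \<open>The variables are \<open>S\<^sup>\<plusminus>\<^sub>a\<close> and \<open>S\<^sup>i\<^sub>a\<close> with \<open>a \<in> {0..3}\<close> and \<open>i \<in> {1..N}\<close>.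
  A point of phase space assigns a complex value to every coordinate; coordinates outside
  this range never enter.\<close>

datatype boundary = Minus | Plus
datatype vertex = Bdry boundary | Site nat

type_synonym point = "vertex \<times> nat \<Rightarrow> complex"

definition vertices :: "nat \<Rightarrow> vertex set" where
  "vertices N = range Bdry \<union> Site ` {1..N}"

definition levi_civita :: "nat \<Rightarrow> nat \<Rightarrow> nat \<Rightarrow> complex" where
  "levi_civita \<alpha> \<beta> \<gamma> =
     (if (\<alpha>, \<beta>, \<gamma>) \<in> {(1,2,3), (2,3,1), (3,1,2)} then 1
      else if (\<alpha>, \<beta>, \<gamma>) \<in> {(1,3,2), (3,2,1), (2,1,3)} then -1 else 0)"

text \<open>\<open>bracket_greek v \<alpha> \<beta>\<close> is \<open>{S\<^sup>v\<^sub>\<alpha>, S\<^sup>v\<^sub>\<beta>}\<close> and \<open>bracket_zero v \<alpha>\<close> is \<open>{S\<^sup>v\<^sub>0, S\<^sup>v\<^sub>\<alpha>}\<close>,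
  with \<open>\<alpha>, \<beta> \<in> {1..3}\<close>. The numbers \<open>\<nu> s \<alpha>\<close> are the boundary constants \<open>(\<nu>')\<^sup>s\<^sub>\<alpha>\<close>.\<close>

fun bracket_greek :: "vertex \<Rightarrow> nat \<Rightarrow> nat \<Rightarrow> point \<Rightarrow> complex" where
  "bracket_greek (Bdry s) \<alpha> \<beta> x =
     4 * \<i> * (\<Sum>\<gamma>=1..3. levi_civita \<alpha> \<beta> \<gamma> * x (Bdry s, 0) * x (Bdry s, \<gamma>))"
| "bracket_greek (Site n) \<alpha> \<beta> x =
     2 * \<i> * (\<Sum>\<gamma>=1..3. levi_civita \<alpha> \<beta> \<gamma> * x (Site n, 0) * x (Site n, \<gamma>))"

fun bracket_zero ::
  "complex \<Rightarrow> (boundary \<Rightarrow> nat \<Rightarrow> complex) \<Rightarrow> vertex \<Rightarrow> nat \<Rightarrow> point \<Rightarrow> complex" where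
  "bracket_zero \<tau> \<nu> (Bdry s) \<alpha> x =
     2 * \<i> * (\<Sum>\<beta>=1..3. \<Sum>\<gamma>=1..3. levi_civita \<alpha> \<beta> \<gamma> *
       (x (Bdry s, \<beta>) * x (Bdry s, \<gamma>) * (E2 \<tau> (half_period \<tau> \<beta>) - E2 \<tau> (half_period \<tau> \<gamma>))
        + 2 * x (Bdry s, \<beta>) * \<nu> s \<gamma>))"
| "bracket_zero \<tau> \<nu> (Site n) \<alpha> x =
     \<i> * (\<Sum>\<beta>=1..3. \<Sum>\<gamma>=1..3. levi_civita \<alpha> \<beta> \<gamma> *
       (x (Site n, \<beta>) * x (Site n, \<gamma>) * (E2 \<tau> (half_period \<tau> \<beta>) - E2 \<tau> (half_period \<tau> \<gamma>))))"

definition coord_bracket ::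
  "complex \<Rightarrow> (boundary \<Rightarrow> nat \<Rightarrow> complex) \<Rightarrow> vertex \<times> nat \<Rightarrow> vertex \<times> nat \<Rightarrow> point \<Rightarrow> complex"
where
  "coord_bracket \<tau> \<nu> p q x =
     (if fst p \<noteq> fst q then 0
      else if snd p = 0 \<and> snd q = 0 then 0
      else if snd p = 0 then bracket_zero \<tau> \<nu> (fst p) (snd q) x
      else if snd q = 0 then - bracket_zero \<tau> \<nu> (fst p) (snd p) x
      else bracket_greek (fst p) (snd p) (snd q) x)"

definition partial :: "vertex \<times> nat \<Rightarrow> (point \<Rightarrow> complex) \<Rightarrow> point \<Rightarrow> complex" where
  "partial p F x = deriv (\<lambda>t. F (x(p := t))) (x p)"

text \<open>Extension of the bracket from the coordinates to functions by the Leibniz rule, evaluated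
  at the point \<open>x\<close>. It is meaningful for functions that are holomorphic near \<open>x\<close>.\<close>

definition poisson ::
  "complex \<Rightarrow> (boundary \<Rightarrow> nat \<Rightarrow> complex) \<Rightarrow> nat \<Rightarrow>
   (point \<Rightarrow> complex) \<Rightarrow> (point \<Rightarrow> complex) \<Rightarrow> point \<Rightarrow> complex" where
  "poisson \<tau> \<nu> N F G x =
     (\<Sum>p\<in>vertices N \<times> {0..3}. \<Sum>q\<in>vertices N \<times> {0..3}.
        partial p F x * partial q G x * coord_bracket \<tau> \<nu> p q x)"

section \<open>Lax matrices and the transfer function\<close>

type_synonym cmat2 = "complex^2^2"

definition scale_mat :: "complex \<Rightarrow> cmat2 \<Rightarrow> cmat2" where
  "scale_mat c A = (\<chi> i j. c * A $ i $ j)"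

definition pauli :: "nat \<Rightarrow> cmat2" where
  "pauli \<alpha> =
     (if \<alpha> = 0 then mat 1
      else if \<alpha> = 1 then vector [vector [0, 1], vector [1, 0]]
      else if \<alpha> = 2 then vector [vector [0, - \<i>], vector [\<i>, 0]]
      else vector [vector [1, 0], vector [0, -1]])"

definition Lax :: "complex \<Rightarrow> nat \<Rightarrow> point \<Rightarrow> complex \<Rightarrow> cmat2" where
  "Lax \<tau> n x z = scale_mat (x (Site n, 0)) (pauli 0)
     + (\<Sum>\<alpha>=1..3. scale_mat (x (Site n, \<alpha>) * phi \<tau> \<alpha> z) (pauli \<alpha>))"

definition Kmat ::
  "complex \<Rightarrow> (boundary \<Rightarrow> nat \<Rightarrow> complex) \<Rightarrow> boundary \<Rightarrow> point \<Rightarrow> complex \<Rightarrow> cmat2" where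
  "Kmat \<tau> \<nu> s x z = scale_mat (x (Bdry s, 0)) (pauli 0)
     + (\<Sum>\<alpha>=1..3. scale_mat (x (Bdry s, \<alpha>) * phi \<tau> \<alpha> z + \<nu> s \<alpha> / phi \<tau> \<alpha> z) (pauli \<alpha>))"

text \<open>\<open>L\<^sup>N(z) \<cdots> L\<^sup>1(z)\<close> and \<open>(L\<^sup>1(-z))\<^sup>-\<^sup>1 \<cdots> (L\<^sup>N(-z))\<^sup>-\<^sup>1\<close>.\<close>

primrec Lax_prod :: "complex \<Rightarrow> nat \<Rightarrow> point \<Rightarrow> complex \<Rightarrow> cmat2" where
  "Lax_prod \<tau> 0 x z = mat 1"
| "Lax_prod \<tau> (Suc n) x z = Lax \<tau> (Suc n) x z ** Lax_prod \<tau> n x z"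

primrec Lax_inv_prod :: "complex \<Rightarrow> nat \<Rightarrow> point \<Rightarrow> complex \<Rightarrow> cmat2" where
  "Lax_inv_prod \<tau> 0 x z = mat 1"
| "Lax_inv_prod \<tau> (Suc n) x z = Lax_inv_prod \<tau> n x z ** matrix_inv (Lax \<tau> (Suc n) x (-z))"

definition transfer ::
  "complex \<Rightarrow> (boundary \<Rightarrow> nat \<Rightarrow> complex) \<Rightarrow> nat \<Rightarrow> complex \<Rightarrow> point \<Rightarrow> complex" where
  "transfer \<tau> \<nu> N z x =
     trace (Kmat \<tau> \<nu> Plus x z ** Lax_prod \<tau> N x z ** Kmat \<tau> \<nu> Minus x z ** Lax_inv_prod \<tau> N x z)"

text \<open>The expression for \<open>h(z)\<close> is defined at the point \<open>x\<close>: no denominator in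
  \<open>\<phi>\<^sub>\<alpha>(\<plusminus>z)\<close> or \<open>1/\<phi>\<^sub>\<alpha>(z)\<close> vanishes, and all \<open>L\<^sup>i(-z)\<close> are invertible.
  (\<open>\<vartheta>\<close> is odd and does not vanish at the half periods.)\<close>

definition transfer_defined :: "complex \<Rightarrow> nat \<Rightarrow> complex \<Rightarrow> point \<Rightarrow> bool" where
  "transfer_defined \<tau> N z x \<longleftrightarrow>
     theta \<tau> z \<noteq> 0 \<and> (\<forall>\<alpha>\<in>{1..3}. phi \<tau> \<alpha> z \<noteq> 0) \<and>
     (\<forall>n\<in>{1..N}. invertible (Lax \<tau> n x (-z)))"

section \<open>The nearest-neighbour Hamiltonian\<close>

definition on_level_set :: "complex \<Rightarrow> nat \<Rightarrow> complex \<Rightarrow> point \<Rightarrow> bool" where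
  "on_level_set \<tau> N C x \<longleftrightarrow> (\<forall>n\<in>{1..N}.
     (\<Sum>\<alpha>=1..3. (x (Site n, \<alpha>))\<^sup>2) \<noteq> 0 \<and>
     ((x (Site n, 0))\<^sup>2 + (\<Sum>\<alpha>=1..3. (x (Site n, \<alpha>))\<^sup>2 * E2 \<tau> (half_period \<tau> \<alpha>)))
       / (\<Sum>\<alpha>=1..3. (x (Site n, \<alpha>))\<^sup>2) = C)"

definition boundary_arg ::
  "complex \<Rightarrow> (boundary \<Rightarrow> nat \<Rightarrow> complex) \<Rightarrow> complex \<Rightarrow> boundary \<Rightarrow> nat \<Rightarrow> point \<Rightarrow> complex"
where
  "boundary_arg \<tau> \<nu> C s n x = x (Bdry s, 0) * x (Site n, 0)
     + (\<Sum>\<alpha>=1..3. x (Bdry s, \<alpha>) * x (Site n, \<alpha>) * (C - E2 \<tau> (half_period \<tau> \<alpha>))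
                  + \<nu> s \<alpha> * x (Site n, \<alpha>))"

definition bulk_arg :: "complex \<Rightarrow> complex \<Rightarrow> nat \<Rightarrow> point \<Rightarrow> complex" where
  "bulk_arg \<tau> C n x = x (Site n, 0) * x (Site (n + 1), 0)
     + (\<Sum>\<alpha>=1..3. x (Site n, \<alpha>) * x (Site (n + 1), \<alpha>) * (C - E2 \<tau> (half_period \<tau> \<alpha>)))"

definition ln_branch_at :: "complex \<Rightarrow> (complex \<Rightarrow> complex) \<Rightarrow> bool" where
  "ln_branch_at a l \<longleftrightarrow>
     (\<exists>U. open U \<and> a \<in> U \<and> l holomorphic_on U \<and> (\<forall>u\<in>U. exp (l u) = u))"

text \<open>\<open>lm\<close>, \<open>lp\<close> and \<open>lb n\<close> are the branches of the logarithm used in the individual terms.\<close>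

definition Hamiltonian ::
  "complex \<Rightarrow> (boundary \<Rightarrow> nat \<Rightarrow> complex) \<Rightarrow> nat \<Rightarrow> complex \<Rightarrow>
   (complex \<Rightarrow> complex) \<Rightarrow> (complex \<Rightarrow> complex) \<Rightarrow> (nat \<Rightarrow> complex \<Rightarrow> complex) \<Rightarrow> point \<Rightarrow> complex"
where
  "Hamiltonian \<tau> \<nu> N C lm lp lb x =
     lm (boundary_arg \<tau> \<nu> C Minus 1 x) + lp (boundary_arg \<tau> \<nu> C Plus N x)
     + (\<Sum>n\<in>{1..<N}. lb n (bulk_arg \<tau> C n x))"

end

theory Submission
  imports Defs "HOL-Complex_Analysis.Cauchy_Integral_Formula"
begin

text \<open>Since \<open>\<phi>\<^sub>\<alpha>\<close> is odd, \<open>L(-z)\<^sup>-\<^sup>1 = L(z) / det L(z)\<close>, and \<open>det L(z)\<close> is a Casimir function. Up to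
  Casimirs, \<open>h(z)\<close> is therefore \<open>tr (V\<^sub>n U\<^sub>n)\<close> for each \<open>n\<close>, where \<open>U\<^sub>n = L\<^sup>n \<cdots> L\<^sup>1 K\<^sup>- L\<^sup>1 \<cdots> L\<^sup>n\<close> and
  \<open>V\<^sub>n = L\<^sup>n\<^sup>+\<^sup>1 \<cdots> L\<^sup>N K\<^sup>+ L\<^sup>N \<cdots> L\<^sup>n\<^sup>+\<^sup>1\<close>. By the quadratic r-matrix relations, vertex \<open>n\<close> contributes
  \<open>R\<^sub>n - R\<^sub>n\<^sub>-\<^sub>1\<close> to \<open>{h(z), h(w)}\<close>, where \<open>R\<^sub>n\<close> is the right hand side of the reflection equation for
  \<open>U\<^sub>n\<close> contracted with \<open>V\<^sub>n\<close>; the boundaries contribute \<open>R\<^sub>0\<close> and \<open>-R\<^sub>N\<close>, and the sum telescopes.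
  The only facts about theta functions that enter are that \<open>\<phi>\<^sub>\<alpha>\<close> is odd and
  \<open>\<phi>\<^sub>\<alpha>(z)\<^sup>2 = E\<^sub>2(z) - E\<^sub>2(\<omega>\<^sub>\<alpha>)\<close>.

  On the level set every \<open>L\<^sup>i\<close> has rank one at the spectral parameter where \<open>E\<^sub>2 = C\<close>. There
  \<open>L A L = tr(A L) L\<close>, the trace factors into the arguments of the logarithms in \<open>H\<close>, and the
  contributions to \<open>{H, h(w)}\<close> telescope in the same way.\<close>

section \<open>Theta functions\<close>

text \<open>Clearing the denominators of the r-matrix multiplies every identity by \<open>D\<close>,
  the difference of the two values of E2. For {h(z), h(w)} the case D = 0 needs its own argument:
  the values phi_\<alpha>(z) and phi_\<alpha>(w) then agree up to signs, and h does not see these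
  signs. For {H, h(w)} the difference E2(w) - C is nonzero because the L^i(-w) are invertible. The
  parameter with E2 = C is never taken as a point of the elliptic curve. Its place is taken by
  numbers a_\<alpha> with a_\<alpha>^2 = C - E2(omega_\<alpha>). Where one of them is zero,
  nu_\<alpha> / a_\<alpha> has no meaning; hence components are multiplied by a_\<alpha>, which
  leaves squares only. At that parameter the trace is 2^(N+1) times the product of the arguments of
  the logarithms, but only on the level set, whereas the bracket is computed from derivatives in all
  coordinates. The discrepancy is a multiple of the gradient of det L, which the bracket
  annihilates.\<close>

lemma abs_summable_on_times:
  fixes f :: "'a \<Rightarrow> complex" and g :: "'b \<Rightarrow> complex"
  assumes "(\<lambda>x. norm (f x)) summable_on A" "(\<lambda>x. norm (g x)) summable_on B"
  shows "(\<lambda>(x, y). f x * g y) summable_on A \<times> B"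
    and "infsum (\<lambda>(x, y). f x * g y) (A \<times> B) = infsum f A * infsum g B"
proof -
  have "(\<lambda>p. norm ((\<lambda>(x, y). f x * g y) p)) summable_on A \<times> B"
    unfolding Infinite_Sum.abs_summable_on_Sigma_iff
    using assms
    by (auto simp: norm_mult infsum_cmult_right' abs_mult abs_of_nonneg[OF infsum_nonneg] intro!: summable_on_cmult_right summable_on_cmult_left infsum_nonneg)
  then show *: "(\<lambda>(x, y). f x * g y) summable_on A \<times> B"
    by (rule abs_summable_summable)
  show "infsum (\<lambda>(x, y). f x * g y) (A \<times> B) = infsum f A * infsum g B"
    using infsum_Sigma_banach[OF *] by (simp add: infsum_cmult_right' infsum_cmult_left')
qed

lemma summable_on_exp_minus_abs: "(\<lambda>j::int. exp (- \<bar>real_of_int j\<bar>)) summable_on UNIV"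
proof -
  have *: "(\<lambda>n::nat. exp (- real n)) summable_on UNIV"
  proof (rule summable_nonneg_imp_summable_on)
    have "summable (\<lambda>n::nat. exp (-1::real) ^ n)"
      by (rule summable_geometric) simp
    then show "summable (\<lambda>n::nat. exp (- real n))"
      by (simp add: exp_of_nat_mult[symmetric])
  qed simp
  have "(\<lambda>j::int. exp (- \<bar>real_of_int j\<bar>)) summable_on range int"
    by (subst summable_on_reindex) (use * in \<open>auto simp: o_def\<close>)
  moreover have "(\<lambda>j::int. exp (- \<bar>real_of_int j\<bar>)) summable_on range (\<lambda>n. - int n)"
    by (subst summable_on_reindex) (use * in \<open>auto simp: o_def inj_on_def\<close>)
  then have "(\<lambda>j::int. exp (- \<bar>real_of_int j\<bar>)) summable_on range (\<lambda>n. - int n) - range int"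
    by (rule summable_on_subset_banach) auto
  ultimately have "(\<lambda>j::int. exp (- \<bar>real_of_int j\<bar>)) summable_on range int \<union> (range (\<lambda>n. - int n) - range int)"
    by (rule summable_on_Un_disjoint) auto
  moreover have "range int \<union> (range (\<lambda>n. - int n) - range int) = UNIV"
    using int_cases2 by blast
  ultimately show ?thesis by simp
qed

text \<open>Terms of the theta function with characteristic [c, 0]. General c is needed because
  half-period shifts change it and because the product formula mixes c = 0 and c = 1/2 at
  \<open>2 * \<tau>\<close>.\<close>

definition theta_term :: "complex \<Rightarrow> real \<Rightarrow> complex \<Rightarrow> int \<Rightarrow> complex" where
  "theta_term \<tau> c z j = exp (pi * \<i> * (of_int j + c)\<^sup>2 * \<tau> + 2 * pi * \<i> * (of_int j + c) * z)"

definition theta_char :: "complex \<Rightarrow> real \<Rightarrow> complex \<Rightarrow> complex" where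
  "theta_char \<tau> c z = infsum (theta_term \<tau> c z) UNIV"

text \<open>Completing the square bounds the Gaussian exponent. The summand 1 in \<open>B\<close>
  leaves a surplus \<open>- t\<close>, which supplies the decay in \<open>j\<close>. The bound
  depends on \<open>z\<close> only through \<open>r\<close>, so convergence is uniform on horizontal
  strips.\<close>

lemma norm_theta_term_le:
  assumes \<tau>: "Im \<tau> > 0" and z: "\<bar>Im z\<bar> \<le> r"
  shows "norm (theta_term \<tau> c z j) \<le> exp ((2 * pi * r + 1)\<^sup>2 / (4 * pi * Im \<tau>) + \<bar>c\<bar>) * exp (- \<bar>real_of_int j\<bar>)"
proof -
  define t where "t = \<bar>of_int j + c\<bar>"
  have "Re (pi * \<i> * (of_int j + c)\<^sup>2 * \<tau> + 2 * pi * \<i> * (of_int j + c) * z) 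
     = - (pi * Im \<tau>) * t\<^sup>2 - 2 * pi * (of_int j + c) * Im z"
    by (simp add: power2_eq_square t_def algebra_simps)
  moreover have "- 2 * pi * (of_int j + c) * Im z \<le> 2 * pi * (t * r)"
  proof -
    have "- ((of_int j + c) * Im z) \<le> \<bar>(of_int j + c) * Im z\<bar>" by linarith
    also have "\<dots> \<le> t * r"
      unfolding abs_mult t_def by (intro mult_mono z) auto
    finally have "2 * pi * (- ((of_int j + c) * Im z)) \<le> 2 * pi * (t * r)"
      by (intro mult_left_mono) auto
    then show ?thesis by (simp add: mult_ac)
  qed
  moreover have "- (pi * Im \<tau>) * t\<^sup>2 + 2 * pi * (t * r) \<le> (2 * pi * r + 1)\<^sup>2 / (4 * pi * Im \<tau>) - t"
  proof -
    define A where "A = pi * Im \<tau>"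
    define B where "B = 2 * pi * r + 1"
    have A: "A > 0" using \<tau> by (simp add: A_def)
    have "0 \<le> (2 * A * t - B)\<^sup>2 / (4 * A)" using A by simp
    also have "\<dots> = A * t\<^sup>2 - B * t + B\<^sup>2 / (4 * A)"
      using A by (simp add: field_simps power2_eq_square)
    finally show ?thesis by (simp add: A_def B_def algebra_simps)
  qed
  moreover have "- t \<le> \<bar>c\<bar> - \<bar>real_of_int j\<bar>" by (simp add: t_def)
  ultimately have "Re (pi * \<i> * (of_int j + c)\<^sup>2 * \<tau> + 2 * pi * \<i> * (of_int j + c) * z)
      \<le> (2 * pi * r + 1)\<^sup>2 / (4 * pi * Im \<tau>) + \<bar>c\<bar> + - \<bar>real_of_int j\<bar>"
    by linarith
  then show ?thesis
    unfolding theta_term_def norm_exp_eq_Re exp_add[symmetric] by simp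
qed

lemma theta_bound_summable: "(\<lambda>j::int. K * exp (- \<bar>real_of_int j\<bar>)) summable_on UNIV"
  by (intro summable_on_cmult_right summable_on_exp_minus_abs)

lemma theta_term_abs_summable:
  assumes "Im \<tau> > 0"
  shows "(\<lambda>j. norm (theta_term \<tau> c z j)) summable_on UNIV"
  by (rule summable_on_comparison_test[OF theta_bound_summable])
    (use norm_theta_term_le[OF assms order_refl] in auto)

lemma theta_char_holomorphic:
  assumes "Im \<tau> > 0"
  shows "theta_char \<tau> c holomorphic_on UNIV"
proof -
  have "theta_char \<tau> c holomorphic_on ball z 1" for z
  proof (rule holomorphic_uniform_limit)
    have "uniform_limit (cball z 1) (\<lambda>X y. \<Sum>j\<in>X. theta_term \<tau> c y j)
        (\<lambda>y. \<Sum>\<^sub>\<infinity>j\<in>UNIV. theta_term \<tau> c y j) (finite_subsets_at_top UNIV)"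
    proof (rule Weierstrass_m_test_general[OF norm_theta_term_le[OF assms, where r = "\<bar>Im z\<bar> + 1"] theta_bound_summable])
      fix y assume "y \<in> cball z 1"
      then have "\<bar>Im (z - y)\<bar> \<le> 1"
        using abs_Im_le_cmod[of "z - y"] by (simp add: dist_norm)
      then show "\<bar>Im y\<bar> \<le> \<bar>Im z\<bar> + 1" by simp
    qed
    then show "uniform_limit (cball z 1) (\<lambda>X y. \<Sum>j\<in>X. theta_term \<tau> c y j)
        (theta_char \<tau> c) (finite_subsets_at_top UNIV)"
      by (simp add: theta_char_def[abs_def])
    show "\<forall>\<^sub>F X in finite_subsets_at_top UNIV.
       continuous_on (cball z 1) (\<lambda>y. \<Sum>j\<in>X. theta_term \<tau> c y j) \<and>
       (\<lambda>y. \<Sum>j\<in>X. theta_term \<tau> c y j) holomorphic_on ball z 1"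
      unfolding theta_term_def
      by (intro always_eventually allI conjI continuous_intros holomorphic_intros)
  qed auto
  then have "\<forall>z. theta_char \<tau> c field_differentiable at z"
    by (meson centre_in_ball holomorphic_on_imp_differentiable_at open_ball zero_less_one)
  then show ?thesis
    by (simp add: holomorphic_on_def field_differentiable_at_within)
qed

lemma theta_eq: "theta \<tau> z = theta_char \<tau> (1/2) (z + 1/2)"
  by (simp add: theta_def theta_char_def theta_term_def[abs_def])

lemma theta_holomorphic:
  assumes "Im \<tau> > 0"
  shows "theta \<tau> holomorphic_on UNIV"
proof -
  have "(theta_char \<tau> (1/2) \<circ> (\<lambda>z. z + 1/2)) holomorphic_on UNIV"
    by (rule holomorphic_on_compose_gen[OF _ theta_char_holomorphic[OF assms]]) (auto intro!: holomorphic_intros)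
  then show ?thesis by (simp add: theta_eq[abs_def] o_def)
qed

text \<open>The index change \<open>m = j + k + 1\<close>, \<open>n = j - k\<close> diagonalises the quadratic form; the two
  summands come from the two parities of \<open>j + k\<close>.\<close>
lemma theta_times_theta:
  assumes "Im \<tau> > 0"
  shows "theta \<tau> (x + y) * theta \<tau> (x - y) =
     theta_char (2 * \<tau>) 0 (2 * x) * theta_char (2 * \<tau>) (1/2) (2 * y)
   - theta_char (2 * \<tau>) (1/2) (2 * x) * theta_char (2 * \<tau>) 0 (2 * y)"
proof -
  define f where "f = theta_term \<tau> (1/2) (x + y + 1/2)"
  define g where "g = theta_term \<tau> (1/2) (x - y + 1/2)"
  define F where "F = (\<lambda>(j, k). f j * g k)"
  \<comment> \<open>\<open>h1\<close> runs through the pairs with \<open>j + k\<close> odd,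
    \<open>h2\<close> through those with \<open>j + k\<close> even. The quadratic form is (m^2 +
    n^2)/2 with m and n of opposite parity, so an even value 2p gives a term at
    \<open>2 * \<tau>\<close> with characteristic 0 and an odd value 2p + 1 one with characteristic
    1/2.\<close>
  define h1 where "h1 = (\<lambda>(p, q). (p + q, p - q - 1) :: int \<times> int)"
  define h2 where "h2 = (\<lambda>(p, q). (p + q, p - q) :: int \<times> int)"
  note abs = theta_term_abs_summable[OF assms]
  have abs2: "(\<lambda>j. norm (theta_term (2 * \<tau>) c z j)) summable_on UNIV" for c z
    by (rule theta_term_abs_summable) (use assms in simp)
  have sum: "F summable_on UNIV \<times> UNIV" "infsum F (UNIV \<times> UNIV) = infsum f UNIV * infsum g UNIV"
    unfolding F_def f_def g_def by (rule abs_summable_on_times abs)+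
  have sub: "F summable_on A" for A
    by (rule summable_on_subset_banach[OF sum(1)]) auto
  have part: "UNIV \<times> UNIV = range h1 \<union> range h2" "range h1 \<inter> range h2 = {}"
  proof -
    have "(j, k) \<in> range h1 \<union> range h2" for j k :: int
    proof (cases "even (j + k)")
      case True
      then have "(j, k) = h2 ((j + k) div 2, (j - k) div 2)" by (simp add: h2_def) presburger
      then show ?thesis by blast
    next
      case False
      then have "(j, k) = h1 ((j + k + 1) div 2, (j - k - 1) div 2)" by (simp add: h1_def) presburger
      then show ?thesis by blast
    qed
    then show "UNIV \<times> UNIV = range h1 \<union> range h2" by auto
    have False if "p + q = p' + q'" "p - q - 1 = p' - q'" for p q p' q' :: int
      using that by presburger
    then show "range h1 \<inter> range h2 = {}" by (auto simp: h1_def h2_def)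
  qed
  have inj: "inj h1" "inj h2"
    by (auto simp: h1_def h2_def inj_on_def)
  have 1: "F (h1 (p, q)) = theta_term (2 * \<tau>) 0 (2 * x) p * theta_term (2 * \<tau>) (1/2) (2 * y) q" for p q
  proof -
    have "F (h1 (p, q)) = theta_term (2 * \<tau>) 0 (2 * x) p * theta_term (2 * \<tau>) (1/2) (2 * y) q * exp (\<i> * (of_int (2 * p) * (of_real pi)))"
      unfolding F_def h1_def f_def g_def theta_term_def prod.case exp_add[symmetric]
      by (rule arg_cong[where f = exp]) (simp add: power2_eq_square field_simps)
    also have "exp (\<i> * (of_int (2 * p) * (of_real pi))) = 1"
      using exp_integer_2pi[of "of_int p"] by (simp add: mult_ac)
    finally show ?thesis by simp
  qed
  \<comment> \<open>The shift of the argument by 1/2 in \<open>theta\<close> contributes exp(pi i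
    m), and m = 2p + 1 is odd here; hence the minus sign.\<close>
  have 2: "F (h2 (p, q)) = - (theta_term (2 * \<tau>) (1/2) (2 * x) p * theta_term (2 * \<tau>) 0 (2 * y) q)" for p q
  proof -
    have "F (h2 (p, q)) = theta_term (2 * \<tau>) (1/2) (2 * x) p * theta_term (2 * \<tau>) 0 (2 * y) q * exp (\<i> * (of_int (2 * p) * (of_real pi)) + \<i> * of_real pi)"
      unfolding F_def h2_def f_def g_def theta_term_def prod.case exp_add[symmetric]
      by (rule arg_cong[where f = exp]) (simp add: power2_eq_square field_simps)
    also have "exp (\<i> * (of_int (2 * p) * (of_real pi)) + \<i> * of_real pi) = - 1"
      using exp_integer_2pi[of "of_int p"] by (simp add: mult_ac exp_add)
    finally show ?thesis by simp
  qed
  have "theta \<tau> (x + y) * theta \<tau> (x - y) = infsum F (UNIV \<times> UNIV)"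
    unfolding sum(2) by (simp add: theta_eq theta_char_def f_def g_def)
  also have "\<dots> = infsum F (range h1) + infsum F (range h2)"
    unfolding part(1) by (rule infsum_Un_disjoint[OF sub sub part(2)])
  also have "infsum F (range h1) = (\<Sum>\<^sub>\<infinity>(p, q)\<in>UNIV \<times> UNIV. theta_term (2 * \<tau>) 0 (2 * x) p * theta_term (2 * \<tau>) (1/2) (2 * y) q)"
    unfolding infsum_reindex[OF inj(1)] by (auto intro!: infsum_cong simp: 1)
  also have "infsum F (range h2) = (\<Sum>\<^sub>\<infinity>(p, q)\<in>UNIV \<times> UNIV. - (theta_term (2 * \<tau>) (1/2) (2 * x) p * theta_term (2 * \<tau>) 0 (2 * y) q))"
    unfolding infsum_reindex[OF inj(2)] by (auto intro!: infsum_cong simp: 2)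
  also have "\<dots> = - (\<Sum>\<^sub>\<infinity>(p, q)\<in>UNIV \<times> UNIV. theta_term (2 * \<tau>) (1/2) (2 * x) p * theta_term (2 * \<tau>) 0 (2 * y) q)"
    by (simp add: case_prod_unfold infsum_uminus)
  finally show ?thesis
    unfolding abs_summable_on_times(2)[OF abs2 abs2] theta_char_def by simp
qed


lemma theta_char_minus: "theta_char \<tau> c (- z) = theta_char \<tau> (- c) z"
  unfolding theta_char_def
  by (rule infsum_reindex_bij_witness[of _ uminus uminus])
    (auto simp: theta_term_def power2_eq_square algebra_simps)

lemma theta_char_shift: "theta_char \<tau> (c + of_int n) z = theta_char \<tau> c z"
  unfolding theta_char_def
  by (rule infsum_reindex_bij_witness[of _ "\<lambda>j. j - n" "\<lambda>j. j + n"])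
    (auto simp: theta_term_def algebra_simps)

lemma theta_char_plus_of_int:
  "theta_char \<tau> c (z + of_int n) = exp (2 * pi * \<i> * c * of_int n) * theta_char \<tau> c z"
proof -
  have "theta_term \<tau> c (z + of_int n) j = exp (2 * pi * \<i> * c * of_int n) * theta_term \<tau> c z j" for j
  proof -
    have "theta_term \<tau> c (z + of_int n) j = exp (2 * pi * \<i> * of_int (j * n)) * (exp (2 * pi * \<i> * c * of_int n) * theta_term \<tau> c z j)"
      by (simp add: theta_term_def exp_add[symmetric] algebra_simps)
    also have "exp (2 * pi * \<i> * of_int (j * n)) = 1"
      using exp_integer_2pi[of "of_int (j * n)"] by (simp add: mult_ac)
    finally show ?thesis by simp
  qed
  then show ?thesis by (simp add: theta_char_def infsum_cmult_right' cong: infsum_cong)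
qed

lemma theta_char_plus_period:
  "theta_char \<tau> c (z + of_real a * \<tau>) = exp (- (pi * \<i> * a\<^sup>2 * \<tau> + 2 * pi * \<i> * a * z)) * theta_char \<tau> (c + a) z"
proof -
  have "theta_term \<tau> c (z + of_real a * \<tau>) j = exp (- (pi * \<i> * a\<^sup>2 * \<tau> + 2 * pi * \<i> * a * z)) * theta_term \<tau> (c + a) z j" for j
    unfolding theta_term_def exp_add[symmetric]
    by (rule arg_cong[where f = exp]) (simp add: power2_eq_square algebra_simps)
  then show ?thesis by (simp add: theta_char_def infsum_cmult_right' cong: infsum_cong)
qed

lemma theta_minus: "theta \<tau> (- z) = - theta \<tau> z"
proof -
  have "theta \<tau> (- z) = theta_char \<tau> (1/2) (- (z - 1/2))"
    by (simp add: theta_eq algebra_simps)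
  also have "\<dots> = theta_char \<tau> (1/2) (z - 1/2)"
    unfolding theta_char_minus using theta_char_shift[of \<tau> "-1/2" 1] by simp
  also have "\<dots> = - theta \<tau> z"
    using theta_char_plus_of_int[of \<tau> "1/2" "z - 1/2" 1] by (simp add: theta_eq add.commute)
  finally show ?thesis .
qed

definition half_period_slope :: "nat \<Rightarrow> real" where
  "half_period_slope \<alpha> = (if \<alpha> = 1 then 0 else 1/2)"

lemma deriv_half_period: "deriv (\<lambda>t. half_period t \<alpha>) \<tau> = half_period_slope \<alpha>"
  by (rule DERIV_imp_deriv, cases "\<alpha> = 1"; cases "\<alpha> = 2")
    (auto simp: half_period_def half_period_slope_def intro!: derivative_eq_intros)

text \<open>The exponential turns \<open>theta\<close> around a half period into a constant times a
  theta function of characteristic 1/2 + c. This characteristic lies in Z/2, so reflection changes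
  it by an integer, and the remaining integer translation of the argument has trivial phase.\<close>

lemma theta_half_period_even:
  fixes \<alpha> :: nat
  defines "c \<equiv> half_period_slope \<alpha>"
  shows "exp (- (2 * pi * \<i> * z * c)) * theta \<tau> (half_period \<tau> \<alpha> - z) = exp (2 * pi * \<i> * z * c) * theta \<tau> (half_period \<tau> \<alpha> + z)"
proof -
  \<comment> \<open>Chosen so that
    \<open>half_period \<tau> \<alpha> = h + c * \<tau>\<close>.\<close>
  define h :: complex where "h = (if \<alpha> = 2 then 0 else 1/2)"
  have *: "exp (2 * pi * \<i> * z * c) * theta \<tau> (half_period \<tau> \<alpha> + z) =
      exp (- (pi * \<i> * c\<^sup>2 * \<tau> + 2 * pi * \<i> * c * (h + 1/2))) * theta_char \<tau> (1/2 + c) (z + (h + 1/2))" for z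
  proof -
    have "theta \<tau> (half_period \<tau> \<alpha> + z) = theta_char \<tau> (1/2) ((z + (h + 1/2)) + of_real c * \<tau>)"
      by (rule trans[OF theta_eq], rule arg_cong[where f = "theta_char \<tau> (1/2)"])
        (auto simp: half_period_def c_def half_period_slope_def h_def field_simps)
    moreover have "exp (2 * pi * \<i> * z * c) * exp (- (pi * \<i> * c\<^sup>2 * \<tau> + 2 * pi * \<i> * c * (z + (h + 1/2)))) =
        exp (- (pi * \<i> * c\<^sup>2 * \<tau> + 2 * pi * \<i> * c * (h + 1/2)))"
      unfolding exp_add[symmetric] by (rule arg_cong[where f = exp]) (simp add: algebra_simps)
    ultimately show ?thesis
      unfolding theta_char_plus_period by (simp add: add.commute)
  qed
  have "theta_char \<tau> (1/2 + c) (- z + (h + 1/2)) = theta_char \<tau> (- (1/2 + c)) (z - (h + 1/2))"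
    using theta_char_minus[of \<tau> "1/2 + c" "z - (h + 1/2)"] by (simp add: algebra_simps)
  also have "\<dots> = theta_char \<tau> (1/2 + c) (z - (h + 1/2))"
    using theta_char_shift[of \<tau> "- (1/2 + c)" 1] theta_char_shift[of \<tau> "- (1/2 + c)" 2]
    by (auto simp: c_def half_period_slope_def split: if_splits)
  also have "\<dots> = theta_char \<tau> (1/2 + c) (z + (h + 1/2))"
    using theta_char_plus_of_int[of \<tau> "1/2 + c" "z - (h + 1/2)" 1] theta_char_plus_of_int[of \<tau> "1/2 + c" "z - (h + 1/2)" 2]
      exp_integer_2pi[of 1] exp_integer_2pi[of 2]
    by (auto simp: c_def half_period_slope_def h_def exp_add mult_ac add.commute split: if_splits)
  finally show ?thesis
    using *[of z] *[of "- z"] by simp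
qed

lemma phi_eq:
  "phi \<tau> \<alpha> z = exp (2 * pi * \<i> * z * half_period_slope \<alpha>) * theta \<tau> (half_period \<tau> \<alpha> + z) *
     deriv (theta \<tau>) 0 / (theta \<tau> z * theta \<tau> (half_period \<tau> \<alpha>))"
  by (simp add: phi_def Kronecker_phi_def deriv_half_period add.commute)

lemma phi_minus: "phi \<tau> \<alpha> (- z) = - phi \<tau> \<alpha> z"
  using theta_half_period_even[of z \<alpha> \<tau>] by (simp add: phi_eq theta_minus)

lemma theta_derivs:
  assumes "Im \<tau> > 0"
  shows "(theta \<tau> has_field_derivative deriv (theta \<tau>) z) (at z)"
    and "(deriv (theta \<tau>) has_field_derivative deriv (deriv (theta \<tau>)) z) (at z)"
  using theta_holomorphic[OF assms]
  by (auto intro!: holomorphic_derivI[of _ UNIV] holomorphic_deriv)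

lemma E2_eq:
  assumes "Im \<tau> > 0" "theta \<tau> z \<noteq> 0"
  shows "E2 \<tau> z = ((deriv (theta \<tau>) z)\<^sup>2 - theta \<tau> z * deriv (deriv (theta \<tau>)) z) / (theta \<tau> z)\<^sup>2"
proof -
  have "((\<lambda>u. deriv (theta \<tau>) u / theta \<tau> u) has_field_derivative
     (deriv (deriv (theta \<tau>)) z * theta \<tau> z - deriv (theta \<tau>) z * deriv (theta \<tau>) z) / (theta \<tau> z * theta \<tau> z)) (at z)"
    by (intro DERIV_divide theta_derivs assms)
  then show ?thesis
    unfolding E2_def by (subst DERIV_imp_deriv) (auto simp: power2_eq_square minus_divide_left mult.commute)
qed

text \<open>Theta form of the classical factorisation of a difference of two Weierstrass functions.
  The product formula and its second y-derivative at y = 0 put theta^2 and theta^2 E2 into the span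
  of the same functions \<open>A\<close> and \<open>B\<close>, with coefficients independent of the
  argument. The difference is then a two by two determinant, and no comparison of zeros and poles is
  needed.\<close>

lemma E2_diff:
  assumes \<tau>: "Im \<tau> > 0" and "theta \<tau> z \<noteq> 0" "theta \<tau> u \<noteq> 0"
  shows "E2 \<tau> z - E2 \<tau> u = - (deriv (theta \<tau>) 0)\<^sup>2 * theta \<tau> (z + u) * theta \<tau> (z - u) / ((theta \<tau> z)\<^sup>2 * (theta \<tau> u)\<^sup>2)"
proof -
  define A where "A = (\<lambda>x. theta_char (2 * \<tau>) 0 (2 * x))"
  define B where "B = (\<lambda>x. theta_char (2 * \<tau>) (1/2) (2 * x))"
  have hol: "(\<lambda>x. theta_char (2 * \<tau>) c (2 * x)) holomorphic_on UNIV" for c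
    using holomorphic_on_compose_gen[of "\<lambda>x. 2 * x" UNIV "theta_char (2 * \<tau>) c" UNIV]
      theta_char_holomorphic[of "2 * \<tau>"] \<tau> by (auto simp: o_def intro!: holomorphic_intros)
  have AB: "A holomorphic_on UNIV" "B holomorphic_on UNIV"
    unfolding A_def B_def by (rule hol)+
  have d: "(A has_field_derivative deriv A y) (at y)" "(B has_field_derivative deriv B y) (at y)"
     "(deriv A has_field_derivative deriv (deriv A) y) (at y)" "(deriv B has_field_derivative deriv (deriv B) y) (at y)" for y
    using AB by (auto intro!: holomorphic_derivI[of _ UNIV] holomorphic_deriv)
  let ?t = "theta \<tau>" and ?t' = "deriv (theta \<tau>)" and ?t'' = "deriv (deriv (theta \<tau>))"
  note t = theta_derivs[OF \<tau>]
  note chain = DERIV_chain2[OF t(1)] DERIV_chain2[OF t(2)]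
  have 0: "?t (x + y) * ?t (x - y) = A x * B y - B x * A y" for x y
    unfolding A_def B_def by (rule theta_times_theta[OF \<tau>])
  have 1: "?t' (x + y) * ?t (x - y) - ?t (x + y) * ?t' (x - y) = A x * deriv B y - B x * deriv A y" for x y
  proof (rule DERIV_unique)
    show "((\<lambda>y. A x * B y - B x * A y) has_field_derivative A x * deriv B y - B x * deriv A y) (at y)"
      by (auto intro!: derivative_eq_intros d)
    show "((\<lambda>y. A x * B y - B x * A y) has_field_derivative ?t' (x + y) * ?t (x - y) - ?t (x + y) * ?t' (x - y)) (at y)"
      unfolding 0[symmetric] by (auto intro!: derivative_eq_intros chain)
  qed
  have 2: "2 * (?t x * ?t'' x - (?t' x)\<^sup>2) = A x * deriv (deriv B) 0 - B x * deriv (deriv A) 0" for x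
  proof (rule DERIV_unique)
    show "((\<lambda>y. A x * deriv B y - B x * deriv A y) has_field_derivative A x * deriv (deriv B) 0 - B x * deriv (deriv A) 0) (at 0)"
      by (auto intro!: derivative_eq_intros d)
    show "((\<lambda>y. A x * deriv B y - B x * deriv A y) has_field_derivative 2 * (?t x * ?t'' x - (?t' x)\<^sup>2)) (at 0)"
      unfolding 1[symmetric] by (auto intro!: derivative_eq_intros chain simp: power2_eq_square)
  qed
  define a b a2 b2 where "a = A 0" "b = B 0" "a2 = deriv (deriv A) 0" "b2 = deriv (deriv B) 0"
  have sq: "(?t x)\<^sup>2 = A x * b - B x * a" for x
    using 0[of x 0] by (simp add: power2_eq_square a_b_a2_b2_def)
  have E: "2 * (?t x)\<^sup>2 * E2 \<tau> x = B x * a2 - A x * b2" if "?t x \<noteq> 0" for x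
  proof -
    have "(?t x)\<^sup>2 * E2 \<tau> x = (?t' x)\<^sup>2 - ?t x * ?t'' x"
      using that by (simp add: E2_eq[OF \<tau>])
    then show ?thesis using 2[of x] unfolding a_b_a2_b2_def by algebra
  qed
  \<comment> \<open>Because theta vanishes at 0, evaluating \<open>2\<close> there identifies the
    determinant of the coefficients with theta'(0)^2, up to the factor 2.\<close>
  have "?t 0 = 0" using theta_minus[of \<tau> 0] by simp
  then have k: "2 * (?t' 0)\<^sup>2 = b * a2 - a * b2"
    using 2[of 0] by (simp add: a_b_a2_b2_def algebra_simps)
  have "2 * ((?t z)\<^sup>2 * (?t u)\<^sup>2 * (E2 \<tau> z - E2 \<tau> u)) = (2 * (?t z)\<^sup>2 * E2 \<tau> z) * (?t u)\<^sup>2 - (2 * (?t u)\<^sup>2 * E2 \<tau> u) * (?t z)\<^sup>2"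
    by (simp add: algebra_simps)
  also have "\<dots> = - (2 * (?t' 0)\<^sup>2) * (A z * B u - B z * A u)"
    unfolding E[OF assms(2)] E[OF assms(3)] unfolding sq k by (simp add: algebra_simps)
  also have "\<dots> = 2 * (- (?t' 0)\<^sup>2 * ?t (z + u) * ?t (z - u))"
    unfolding 0[symmetric] by simp
  finally have "(?t z)\<^sup>2 * (?t u)\<^sup>2 * (E2 \<tau> z - E2 \<tau> u) = - (?t' 0)\<^sup>2 * ?t (z + u) * ?t (z - u)"
    by (simp add: mult_ac)
  then show ?thesis
    using assms(2,3) by (simp add: field_simps)
qed

text \<open>One of the two factors is rewritten by the evenness at the half period. The exponentials
  then cancel and theta(z + omega) theta(z - omega) appears as in \<open>E2_diff\<close>.\<close>

lemma phi_square:
  assumes "Im \<tau> > 0" "theta \<tau> z \<noteq> 0" "theta \<tau> (half_period \<tau> \<alpha>) \<noteq> 0"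
  shows "(phi \<tau> \<alpha> z)\<^sup>2 = E2 \<tau> z - E2 \<tau> (half_period \<tau> \<alpha>)"
proof -
  let ?w = "half_period \<tau> \<alpha>" and ?c = "half_period_slope \<alpha>"
  have "phi \<tau> \<alpha> z = - exp (- (2 * pi * \<i> * z * ?c)) * theta \<tau> (z - ?w) * deriv (theta \<tau>) 0 / (theta \<tau> z * theta \<tau> ?w)"
    using theta_half_period_even[of z \<alpha> \<tau>] theta_minus[of \<tau> "z - ?w"] by (simp add: phi_eq)
  then have "(phi \<tau> \<alpha> z)\<^sup>2 = (- exp (- (2 * pi * \<i> * z * ?c)) * theta \<tau> (z - ?w) * deriv (theta \<tau>) 0 / (theta \<tau> z * theta \<tau> ?w)) *
     (exp (2 * pi * \<i> * z * ?c) * theta \<tau> (?w + z) * deriv (theta \<tau>) 0 / (theta \<tau> z * theta \<tau> ?w))"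
    by (metis phi_eq power2_eq_square)
  also have "\<dots> = - (exp (- (2 * pi * \<i> * z * ?c)) * exp (2 * pi * \<i> * z * ?c)) * (deriv (theta \<tau>) 0)\<^sup>2 * theta \<tau> (z + ?w) * theta \<tau> (z - ?w) / ((theta \<tau> z)\<^sup>2 * (theta \<tau> ?w)\<^sup>2)"
    by (simp add: power2_eq_square field_simps add.commute)
  also have "exp (- (2 * pi * \<i> * z * ?c)) * exp (2 * pi * \<i> * z * ?c) = 1"
    by (simp add: exp_add[symmetric])
  finally show ?thesis using E2_diff[OF assms] by simp
qed

section \<open>Quadratic exchange relations\<close>

declare One_nat_def [simp del]

definition cyc :: "(nat \<Rightarrow> nat \<Rightarrow> nat \<Rightarrow> complex) \<Rightarrow> complex" where
  "cyc f = f 1 2 3 + f 2 3 1 + f 3 1 2"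

definition pauli_mat :: "(nat \<Rightarrow> complex) \<Rightarrow> (nat \<Rightarrow> complex) \<Rightarrow> cmat2" where
  "pauli_mat a S = scale_mat (S 0) (pauli 0) + (\<Sum>\<alpha>=1..3. scale_mat (S \<alpha> * a \<alpha>) (pauli \<alpha>))"

text \<open>A product of two such traces is the trace of U (x) U' times X (x) Y with sigma_\<alpha>
  (x) sigma_\<alpha> inserted to the right or left of each factor. Thus \<open>exch_minus\<close>
  contracts the commutator of U (x) U' with r(z - w), and \<open>exch_plus\<close> the terms with
  r(z + w), where the insertion sits on opposite sides of the two factors.\<close>

definition tr_right :: "nat \<Rightarrow> cmat2 \<Rightarrow> cmat2 \<Rightarrow> complex" where
  "tr_right \<alpha> U X = trace (U ** pauli \<alpha> ** X)"

definition tr_left :: "nat \<Rightarrow> cmat2 \<Rightarrow> cmat2 \<Rightarrow> complex" where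
  "tr_left \<alpha> U X = trace (pauli \<alpha> ** U ** X)"

text \<open>With \<open>a \<alpha> = \<phi>\<^sub>\<alpha>(z)\<close> and \<open>b \<alpha> = \<phi>\<^sub>\<alpha>(w)\<close>, the addition theorem turns the components
  \<open>\<phi>\<^sub>\<alpha>(z \<mp> w)\<close> of the r-matrix into \<open>(a \<alpha> b \<beta> b \<gamma> \<plusminus> b \<alpha> a \<beta> a \<gamma>) / ((b \<alpha>)\<^sup>2 - (a \<alpha>)\<^sup>2)\<close>, where the
  denominator does not depend on \<open>\<alpha>\<close>. It is cleared below, so that the addition theorem itself
  is never needed.\<close>

definition exch_minus where
  "exch_minus a b U X U' Y = cyc (\<lambda>\<alpha> \<beta> \<gamma>. (a \<alpha> * b \<beta> * b \<gamma> + b \<alpha> * a \<beta> * a \<gamma>) *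
     (tr_right \<alpha> U X * tr_right \<alpha> U' Y - tr_left \<alpha> U X * tr_left \<alpha> U' Y))"

definition exch_plus where
  "exch_plus a b U X U' Y = cyc (\<lambda>\<alpha> \<beta> \<gamma>. (a \<alpha> * b \<beta> * b \<gamma> - b \<alpha> * a \<beta> * a \<gamma>) *
     (tr_left \<alpha> U X * tr_right \<alpha> U' Y - tr_right \<alpha> U X * tr_left \<alpha> U' Y))"

definition reflection_form where
  "reflection_form a b U X U' Y = exch_minus a b U X U' Y + exch_plus a b U X U' Y"

text \<open>Gradient of \<open>trace (pauli_mat a S ** M)\<close> in the coordinates
  \<open>S\<close>. The constants \<nu> do not change it, so it serves the boundary matrices
  too.\<close>

definition grad :: "(nat \<Rightarrow> complex) \<Rightarrow> cmat2 \<Rightarrow> nat \<Rightarrow> complex" where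
  "grad a M p = (if p = 0 then trace M else a p * trace (pauli p ** M))"

text \<open>The bracket at one vertex, applied to two gradients \<open>X\<close> and
  \<open>Y\<close> and stripped of its prefactor, which is 4i at a boundary and 2i at a site. The
  values E2(omega_\<alpha>) are passed as \<open>e\<close>.\<close>

definition vertex_pb :: "(nat \<Rightarrow> complex) \<Rightarrow> (nat \<Rightarrow> complex) \<Rightarrow> (nat \<Rightarrow> complex) \<Rightarrow> (nat \<Rightarrow> complex) \<Rightarrow> (nat \<Rightarrow> complex) \<Rightarrow> complex" where
  "vertex_pb e \<nu> S X Y = cyc (\<lambda>\<alpha> \<beta> \<gamma>. S 0 * S \<gamma> * (X \<alpha> * Y \<beta> - X \<beta> * Y \<alpha>)
     + (S \<beta> * S \<gamma> * (e \<beta> - e \<gamma>) + S \<beta> * \<nu> \<gamma> - S \<gamma> * \<nu> \<beta>) * (X 0 * Y \<alpha> - X \<alpha> * Y 0))"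

lemma pauli_entries:
  "pauli 0 $ 1 $ 1 = 1" "pauli 0 $ 1 $ 2 = 0" "pauli 0 $ 2 $ 1 = 0" "pauli 0 $ 2 $ 2 = 1"
  "pauli 1 $ 1 $ 1 = 0" "pauli 1 $ 1 $ 2 = 1" "pauli 1 $ 2 $ 1 = 1" "pauli 1 $ 2 $ 2 = 0"
  "pauli 2 $ 1 $ 1 = 0" "pauli 2 $ 1 $ 2 = - \<i>" "pauli 2 $ 2 $ 1 = \<i>" "pauli 2 $ 2 $ 2 = 0"
  "pauli 3 $ 1 $ 1 = 1" "pauli 3 $ 1 $ 2 = 0" "pauli 3 $ 2 $ 1 = 0" "pauli 3 $ 2 $ 2 = -1"
  by (simp_all add: pauli_def mat_def)

lemma scale_mat_entry: "scale_mat c A $ i $ j = c * A $ i $ j"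
  by (simp add: scale_mat_def)

lemma sum13: "(\<Sum>\<alpha>=1..3. f \<alpha>) = f 1 + f 2 + f (3::nat)"
  proof -
  have "{1..3} = {1, 2, 3::nat}" by auto
  then show ?thesis by (simp add: add.assoc)
qed

lemma mat_eq_iff: "(A::cmat2) = B \<longleftrightarrow> A$1$1 = B$1$1 \<and> A$1$2 = B$1$2 \<and> A$2$1 = B$2$1 \<and> A$2$2 = B$2$2"
  by (simp add: vec_eq_iff forall_2 conj_assoc)

lemma pauli_mat_entries:
  "pauli_mat a S $ 1 $ 1 = S 0 + S 3 * a 3" "pauli_mat a S $ 1 $ 2 = S 1 * a 1 - \<i> * S 2 * a 2"
  "pauli_mat a S $ 2 $ 1 = S 1 * a 1 + \<i> * S 2 * a 2" "pauli_mat a S $ 2 $ 2 = S 0 - S 3 * a 3"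
  by (simp_all add: pauli_mat_def sum13 scale_mat_entry pauli_entries)

lemma pauli_coords:
  obtains m where "(M::cmat2) = pauli_mat (\<lambda>_. 1) m"
proof
  define m where "m = (\<lambda>a::nat. trace (pauli a ** M) / 2)"
  show "M = pauli_mat (\<lambda>_. 1) m"
    by (simp add: mat_eq_iff pauli_mat_entries m_def trace_def matrix_matrix_mult_def sum_2 pauli_entries field_simps)
qed

lemma tr_right_coords:
  "tr_right 1 (pauli_mat a S) (pauli_mat c M) = 2 * (S 0 * (M 1 * c 1) + S 1 * a 1 * M 0) - 2 * \<i> * (S 2 * a 2 * (M 3 * c 3) - S 3 * a 3 * (M 2 * c 2))"
  "tr_right 2 (pauli_mat a S) (pauli_mat c M) = 2 * (S 0 * (M 2 * c 2) + S 2 * a 2 * M 0) - 2 * \<i> * (S 3 * a 3 * (M 1 * c 1) - S 1 * a 1 * (M 3 * c 3))"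
  "tr_right 3 (pauli_mat a S) (pauli_mat c M) = 2 * (S 0 * (M 3 * c 3) + S 3 * a 3 * M 0) - 2 * \<i> * (S 1 * a 1 * (M 2 * c 2) - S 2 * a 2 * (M 1 * c 1))"
  by (simp_all add: tr_right_def trace_def matrix_matrix_mult_def sum_2 pauli_entries pauli_mat_entries algebra_simps)

lemma tr_left_coords:
  "tr_left 1 (pauli_mat a S) (pauli_mat c M) = 2 * (S 0 * (M 1 * c 1) + S 1 * a 1 * M 0) + 2 * \<i> * (S 2 * a 2 * (M 3 * c 3) - S 3 * a 3 * (M 2 * c 2))"
  "tr_left 2 (pauli_mat a S) (pauli_mat c M) = 2 * (S 0 * (M 2 * c 2) + S 2 * a 2 * M 0) + 2 * \<i> * (S 3 * a 3 * (M 1 * c 1) - S 1 * a 1 * (M 3 * c 3))"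
  "tr_left 3 (pauli_mat a S) (pauli_mat c M) = 2 * (S 0 * (M 3 * c 3) + S 3 * a 3 * M 0) + 2 * \<i> * (S 1 * a 1 * (M 2 * c 2) - S 2 * a 2 * (M 1 * c 1))"
  by (simp_all add: tr_left_def trace_def matrix_matrix_mult_def sum_2 pauli_entries pauli_mat_entries algebra_simps)

lemma trace_coords:
  "trace (pauli_mat c M) = 2 * M 0"
  "trace (pauli 1 ** pauli_mat c M) = 2 * (c 1 * M 1)"
  "trace (pauli 2 ** pauli_mat c M) = 2 * (c 2 * M 2)"
  "trace (pauli 3 ** pauli_mat c M) = 2 * (c 3 * M 3)"
  by (simp_all add: trace_def matrix_matrix_mult_def sum_2 pauli_entries pauli_mat_entries algebra_simps)

definition cross :: "(nat \<Rightarrow> complex) \<Rightarrow> (nat \<Rightarrow> complex) \<Rightarrow> nat \<Rightarrow> nat \<Rightarrow> complex" where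
  "cross k l \<beta> \<gamma> = k \<beta> * l \<gamma> - k \<gamma> * l \<beta>"

definition symm :: "(nat \<Rightarrow> complex) \<Rightarrow> (nat \<Rightarrow> complex) \<Rightarrow> nat \<Rightarrow> complex" where
  "symm k l \<alpha> = k 0 * l \<alpha> + k \<alpha> * l 0"

text \<open>Adding the two forms pairs a commutator with sigma_\<alpha> in one slot with an
  anticommutator in the other. In Pauli components these are a cross product and a symmetric
  product.\<close>

lemma refl_alt:
  "reflection_form a b U X U' Y = cyc (\<lambda>\<alpha> \<beta> \<gamma>.
     b \<alpha> * a \<beta> * a \<gamma> * (tr_right \<alpha> U X - tr_left \<alpha> U X) * (tr_right \<alpha> U' Y + tr_left \<alpha> U' Y)
   + a \<alpha> * b \<beta> * b \<gamma> * (tr_right \<alpha> U X + tr_left \<alpha> U X) * (tr_right \<alpha> U' Y - tr_left \<alpha> U' Y))"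
  by (simp add: reflection_form_def exch_minus_def exch_plus_def cyc_def algebra_simps)

text \<open>The bracket of \<open>L(z)\<close> with \<open>L(w)\<close> can be written with either r-matrix, because
  \<open>L(-w)\<^sup>-\<^sup>1\<close> is proportional to \<open>L(w)\<close>.\<close>
lemma exch_plus_eq_minus:
  "exch_plus a b (pauli_mat a S) M (pauli_mat b S) M' = exch_minus a b (pauli_mat a S) M (pauli_mat b S) M'"
proof -
  obtain m where m: "M = pauli_mat (\<lambda>_. 1) m" by (rule pauli_coords)
  obtain m' where m': "M' = pauli_mat (\<lambda>_. 1) m'" by (rule pauli_coords)
  show ?thesis
    unfolding exch_plus_def exch_minus_def cyc_def m m' tr_left_coords tr_right_coords
    by (simp add: algebra_simps)
qed

text \<open>The reflection form in terms of the rescaled components \<open>k \<alpha> = a \<alpha> u \<alpha>\<close>: only the squares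
  of the \<open>a \<alpha>\<close> are left, so no square root has to be nonzero.\<close>

definition refl_vec where
  "refl_vec b k l U' Y = cyc (\<lambda>\<alpha> \<beta> \<gamma>.
     b \<alpha> * cross k l \<beta> \<gamma> * (tr_right \<alpha> U' Y + tr_left \<alpha> U' Y)
   + b \<beta> * b \<gamma> * \<i> * symm k l \<alpha> * (tr_right \<alpha> U' Y - tr_left \<alpha> U' Y))"

text \<open>Component \<alpha> of the cross product comes with the factor
  \<open>a \<beta> * a \<gamma>\<close>, that of the symmetric product with
  \<open>a \<alpha>\<close>. These are exactly the factors that turn \<open>u\<close> and
  \<open>x\<close> into \<open>k\<close> and \<open>l\<close>.\<close>

lemma refl_eq_refl_vec:
  assumes "\<And>\<alpha>. \<alpha> \<in> {1..3} \<Longrightarrow> k \<alpha> = u \<alpha> * a \<alpha>" "\<And>\<alpha>. \<alpha> \<in> {1..3} \<Longrightarrow> l \<alpha> = x \<alpha> * a \<alpha>" "k 0 = u 0" "l 0 = x 0"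
  shows "reflection_form a b (pauli_mat (\<lambda>_. 1) u) (pauli_mat (\<lambda>_. 1) x) U' Y = - 4 * \<i> * refl_vec b k l U' Y"
  unfolding refl_alt refl_vec_def cyc_def tr_left_coords tr_right_coords cross_def symm_def
  using assms
  by (simp add: algebra_simps)


text \<open>Sites are the case \<nu> = 0. Since \<open>0 / 0 = 0\<close>, that case is correct even
  where \<open>a \<alpha>\<close> vanishes.\<close>

definition lax :: "(nat \<Rightarrow> complex) \<Rightarrow> (nat \<Rightarrow> complex) \<Rightarrow> (nat \<Rightarrow> complex) \<Rightarrow> cmat2" where
  "lax a \<nu> S = pauli_mat (\<lambda>_. 1) (\<lambda>\<alpha>. if \<alpha> = 0 then S 0 else S \<alpha> * a \<alpha> + \<nu> \<alpha> / a \<alpha>)"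

lemma lax_zero: "lax a (\<lambda>_. 0) S = pauli_mat a S"
  by (simp add: lax_def mat_eq_iff pauli_mat_entries)

text \<open>The components of \<open>lax a \<nu> S\<close> multiplied by \<open>a \<alpha>\<close>,
  with \<open>d \<alpha>\<close> standing for \<open>(a \<alpha>)\<^sup>2\<close>. They stay
  meaningful when \<open>d \<alpha> = 0\<close>.\<close>

definition scaled_vec :: "(nat \<Rightarrow> complex) \<Rightarrow> (nat \<Rightarrow> complex) \<Rightarrow> (nat \<Rightarrow> complex) \<Rightarrow> nat \<Rightarrow> complex" where
  "scaled_vec d \<nu> S \<alpha> = (if \<alpha> = 0 then S 0 else S \<alpha> * d \<alpha> + \<nu> \<alpha>)"

lemma grad_eq: "grad a (pauli_mat (\<lambda>_. 1) m) 0 = 2 * m 0" "grad a (pauli_mat (\<lambda>_. 1) m) 1 = 2 * (a 1 * m 1)"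
   "grad a (pauli_mat (\<lambda>_. 1) m) 2 = 2 * (a 2 * m 2)" "grad a (pauli_mat (\<lambda>_. 1) m) 3 = 2 * (a 3 * m 3)"
  by (simp_all add: grad_def trace_coords)

text \<open>Both slots contain the same \<open>S\<close>, and their rescaled components differ by
  \<open>D * S \<alpha>\<close> only. At D = 0 the expression vanishes by antisymmetry of the triple
  product; what remains is linear in \<open>D\<close> and is the vertex bracket.\<close>

lemma refl_vec_vertex_pb:
  assumes "\<And>\<alpha>. \<alpha> \<in> {1..3} \<Longrightarrow> b \<alpha> \<noteq> 0 \<or> \<nu> \<alpha> = 0"
    and "\<And>\<alpha>. \<alpha> \<in> {1..3} \<Longrightarrow> d \<alpha> = c - e \<alpha>"
    and "\<And>\<alpha>. \<alpha> \<in> {1..3} \<Longrightarrow> (b \<alpha>)\<^sup>2 = c + D - e \<alpha>"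
  shows "refl_vec b (scaled_vec d \<nu> S) g (lax b \<nu> S) M = - 2 * D * vertex_pb e \<nu> S g (grad b M)"
proof -
  obtain m where m: "M = pauli_mat (\<lambda>_. 1) m" by (rule pauli_coords)
  define u where "u = (\<lambda>\<alpha>. if \<alpha> = 0 then S 0 else S \<alpha> * b \<alpha> + \<nu> \<alpha> / b \<alpha>)"
  define k where "k = (\<lambda>\<alpha>. if \<alpha> = 0 then S 0 else S \<alpha> * (c + D - e \<alpha>) + \<nu> \<alpha>)"
  have u: "u 0 = k 0" "b 1 * u 1 = k 1" "b 2 * u 2 = k 2" "b 3 * u 3 = k 3"
  proof -
    have "b \<alpha> * u \<alpha> = k \<alpha>" if "\<alpha> \<in> {1..3}" for \<alpha>
    proof -
      have "b \<alpha> * u \<alpha> = S \<alpha> * (b \<alpha>)\<^sup>2 + \<nu> \<alpha>"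
        using assms(1)[OF that] that by (auto simp: u_def field_simps power2_eq_square)
      then show ?thesis using assms(3)[OF that] that by (simp add: k_def)
    qed
    then show "b 1 * u 1 = k 1" "b 2 * u 2 = k 2" "b 3 * u 3 = k 3" by simp_all
  qed (simp add: u_def k_def)
  have "refl_vec b (scaled_vec d \<nu> S) g (lax b \<nu> S) M = cyc (\<lambda>\<alpha> \<beta> \<gamma>.
      4 * cross (scaled_vec d \<nu> S) g \<beta> \<gamma> * (u 0 * (b \<alpha> * m \<alpha>) + (b \<alpha> * u \<alpha>) * m 0)
      + 4 * symm (scaled_vec d \<nu> S) g \<alpha> * ((b \<beta> * u \<beta>) * (b \<gamma> * m \<gamma>) - (b \<gamma> * u \<gamma>) * (b \<beta> * m \<beta>)))"
    unfolding refl_vec_def lax_def u_def[symmetric] m cyc_def tr_left_coords tr_right_coords 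
    by (simp add: algebra_simps)
  also have "\<dots> = - 2 * D * vertex_pb e \<nu> S g (grad b M)"
    unfolding m vertex_pb_def cyc_def grad_eq u
    by (simp add: assms(2) scaled_vec_def k_def cross_def symm_def algebra_simps)
  finally show ?thesis .
qed

lemma tr_cyc:
  "tr_right \<alpha> L (U ** L ** V) = tr_left \<alpha> U (L ** V ** L)"
  "tr_left \<alpha> L (U ** L ** V) = tr_left \<alpha> (L ** U ** L) V"
  "tr_right \<alpha> L (V ** L ** U) = tr_right \<alpha> (L ** U ** L) V"
  "tr_left \<alpha> L (V ** L ** U) = tr_right \<alpha> U (L ** V ** L)"
proof -
  have *: "trace (L ** (pauli \<alpha> ** (U ** (L ** V)))) = trace ((pauli \<alpha> ** (U ** (L ** V))) ** L)"
     "trace ((pauli \<alpha> ** (L ** (V ** L))) ** U) = trace (U ** (pauli \<alpha> ** (L ** (V ** L))))"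
     "trace ((L ** U) ** (L ** (pauli \<alpha> ** V))) = trace ((L ** (pauli \<alpha> ** V)) ** (L ** U))"
    by (rule trace_mul_sym)+
  show "tr_right \<alpha> L (U ** L ** V) = tr_left \<alpha> U (L ** V ** L)"
  "tr_left \<alpha> L (U ** L ** V) = tr_left \<alpha> (L ** U ** L) V"
  "tr_right \<alpha> L (V ** L ** U) = tr_right \<alpha> (L ** U ** L) V"
  "tr_left \<alpha> L (V ** L ** U) = tr_right \<alpha> U (L ** V ** L)"
    using * by (simp_all add: tr_right_def tr_left_def matrix_mul_assoc)
qed

lemma tr_add:
  "tr_right \<alpha> L (M + N) = tr_right \<alpha> L M + tr_right \<alpha> L N"
  "tr_left \<alpha> L (M + N) = tr_left \<alpha> L M + tr_left \<alpha> L N"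
  by (simp_all add: tr_right_def tr_left_def matrix_add_ldistrib trace_add)

lemma tr_swap: "tr_right \<alpha> X U = tr_left \<alpha> U X" "tr_left \<alpha> X U = tr_right \<alpha> U X"
  using trace_mul_sym[of U "pauli \<alpha> ** X"] trace_mul_sym[of X "pauli \<alpha> ** U"]
  by (simp_all add: tr_right_def tr_left_def matrix_mul_assoc)

text \<open>Reading the chain from its other end exchanges insertions on the left and on the right.
  This is how the reflection equation of a boundary matrix also serves the \<open>Plus\<close>
  end.\<close>

lemma reflection_form_swap: "reflection_form a b X U Y U' = - reflection_form a b U X U' Y"
  unfolding reflection_form_def exch_plus_def exch_minus_def cyc_def tr_swap[of _ X U] tr_swap[of _ Y U']
  by (simp add: algebra_simps)

text \<open>Each first-order variation of tr(V L U L) has two summands, one for each occurrence of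
  L. Of the four products, the two of equal type keep r(z - w), and the two mixed ones are rewritten
  with r(z + w). Cyclicity of the trace then moves every insertion next to L U L or next to U, and
  the terms regroup into two reflection forms.\<close>

lemma reflection_form_step:
  fixes U V U' V' :: cmat2 and a b S :: "nat \<Rightarrow> complex"
  defines "L \<equiv> pauli_mat a S" and "L' \<equiv> pauli_mat b S"
  shows "exch_minus a b L (U ** L ** V + V ** L ** U) L' (U' ** L' ** V' + V' ** L' ** U')
     = reflection_form a b (L ** U ** L) V (L' ** U' ** L') V' - reflection_form a b U (L ** V ** L) U' (L' ** V' ** L')"
proof -
  have add: "exch_minus a b L (M1 + M2) L' (M1' + M2') =
     exch_minus a b L M1 L' M1' + exch_minus a b L M2 L' M2' + exch_minus a b L M1 L' M2' + exch_minus a b L M2 L' M1'" 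
    for M1 M2 M1' M2'
    by (simp add: exch_minus_def cyc_def tr_add algebra_simps)
  have eq: "exch_minus a b L M L' M' = exch_plus a b L M L' M'" for M M'
    unfolding L_def L'_def by (rule exch_plus_eq_minus [symmetric])
  show ?thesis
    unfolding add eq[of "U ** L ** V" "V' ** L' ** U'"] eq[of "V ** L ** U" "U' ** L' ** V'"]
    unfolding reflection_form_def exch_minus_def exch_plus_def cyc_def
      tr_cyc[where U = U and L = L and V = V] tr_cyc[where U = U' and L = L' and V = V']
    by (simp add: algebra_simps)
qed

text \<open>The reflection equation of the boundary matrix, contracted with \<open>X\<close> and
  \<open>Y\<close>. The rescaled components \<open>l\<close> of \<open>X\<close> are half of
  \<open>grad a X\<close>, which links \<open>refl_vec\<close> to the bracket of gradients.\<close>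

lemma reflection_form_vertex_pb:
  assumes "\<And>\<alpha>. \<alpha> \<in> {1..3} \<Longrightarrow> a \<alpha> \<noteq> 0 \<or> \<nu> \<alpha> = 0"
    and "\<And>\<alpha>. \<alpha> \<in> {1..3} \<Longrightarrow> b \<alpha> \<noteq> 0 \<or> \<nu> \<alpha> = 0"
    and "\<And>\<alpha>. \<alpha> \<in> {1..3} \<Longrightarrow> (a \<alpha>)\<^sup>2 = c - e \<alpha>"
    and "\<And>\<alpha>. \<alpha> \<in> {1..3} \<Longrightarrow> (b \<alpha>)\<^sup>2 = c + D - e \<alpha>"
  shows "reflection_form a b (lax a \<nu> S) X (lax b \<nu> S) Y = 4 * \<i> * D * vertex_pb e \<nu> S (grad a X) (grad b Y)"
proof -
  obtain x where x: "X = pauli_mat (\<lambda>_. 1) x" by (rule pauli_coords)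
  define l where "l = (\<lambda>\<alpha>. if \<alpha> = 0 then x 0 else x \<alpha> * a \<alpha>)"
  have *: "S \<alpha> * (c - e \<alpha>) + \<nu> \<alpha> = (S \<alpha> * a \<alpha> + \<nu> \<alpha> / a \<alpha>) * a \<alpha>" if "\<alpha> \<in> {1..3}" for \<alpha>
    using assms(1)[OF that] unfolding assms(3)[OF that, symmetric]
    by (auto simp: power2_eq_square algebra_simps)
  have "reflection_form a b (lax a \<nu> S) X (lax b \<nu> S) Y = - 4 * \<i> * refl_vec b (scaled_vec (\<lambda>\<alpha>. c - e \<alpha>) \<nu> S) l (lax b \<nu> S) Y"
    unfolding x lax_def[of a] 
    by (rule refl_eq_refl_vec)
      (use * in \<open>auto simp: scaled_vec_def l_def\<close>)
  also have "\<dots> = 8 * \<i> * D * vertex_pb e \<nu> S l (grad b Y)"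
    by (subst refl_vec_vertex_pb[where c=c and D=D and e=e]) (use assms(2,4) in auto)
  finally have "reflection_form a b (lax a \<nu> S) X (lax b \<nu> S) Y = 8 * \<i> * D * vertex_pb e \<nu> S l (grad b Y)" .
  moreover have "vertex_pb e \<nu> S (grad a X) (grad b Y) = 2 * vertex_pb e \<nu> S l (grad b Y)"
    unfolding x vertex_pb_def cyc_def grad_eq by (simp add: l_def algebra_simps)
  ultimately show ?thesis by simp
qed

text \<open>For \<nu> = 0 the plus and minus forms coincide, so the reflection form is twice the
  exchange form. This matches the factor 2 between the boundary brackets and the site
  brackets.\<close>

lemma exch_minus_vertex_pb:
  assumes "\<And>\<alpha>. \<alpha> \<in> {1..3} \<Longrightarrow> (a \<alpha>)\<^sup>2 = c - e \<alpha>"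
    and "\<And>\<alpha>. \<alpha> \<in> {1..3} \<Longrightarrow> (b \<alpha>)\<^sup>2 = c + D - e \<alpha>"
  shows "exch_minus a b (pauli_mat a S) X (pauli_mat b S) Y = 2 * \<i> * D * vertex_pb e (\<lambda>_. 0) S (grad a X) (grad b Y)"
  using reflection_form_vertex_pb[of a "\<lambda>_. 0" b c e D S X Y] assms
  by (simp add: reflection_form_def exch_plus_eq_minus lax_zero)

lemma site_step:
  fixes U V U' V' :: cmat2 and a b S :: "nat \<Rightarrow> complex"
  assumes "\<And>\<alpha>. \<alpha> \<in> {1..3} \<Longrightarrow> (a \<alpha>)\<^sup>2 = c - e \<alpha>"
    and "\<And>\<alpha>. \<alpha> \<in> {1..3} \<Longrightarrow> (b \<alpha>)\<^sup>2 = c + D - e \<alpha>"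
  defines "L \<equiv> pauli_mat a S" and "L' \<equiv> pauli_mat b S"
  shows "2 * \<i> * D * vertex_pb e (\<lambda>_. 0) S (grad a (U ** L ** V + V ** L ** U)) (grad b (U' ** L' ** V' + V' ** L' ** U'))
     = reflection_form a b (L ** U ** L) V (L' ** U' ** L') V' - reflection_form a b U (L ** V ** L) U' (L' ** V' ** L')"
  unfolding L_def L'_def reflection_form_step[symmetric]
  by (rule exch_minus_vertex_pb[OF assms(1,2), symmetric])

section \<open>The transfer function\<close>

lemma scale_mat_simps:
  "scale_mat c A ** B = scale_mat c (A ** B)" "A ** scale_mat c B = scale_mat c (A ** B)"
  "trace (scale_mat c A) = c * trace A" "scale_mat 1 A = A" "scale_mat c (scale_mat d A) = scale_mat (c * d) A"
  by (simp_all add: mat_eq_iff scale_mat_entry matrix_matrix_mult_def sum_2 trace_def algebra_simps)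

lemma mat_add_rdistrib: "((A::cmat2) + B) ** (C::cmat2) = A ** C + B ** C"
  by (simp add: mat_eq_iff matrix_matrix_mult_def sum_2 algebra_simps)

definition coords :: "vertex \<Rightarrow> point \<Rightarrow> nat \<Rightarrow> complex" where
  "coords v x = (\<lambda>\<alpha>. x (v, \<alpha>))"

lemma Lax_eq: "Lax \<tau> n x z = pauli_mat (\<lambda>\<alpha>. phi \<tau> \<alpha> z) (coords (Site n) x)"
  by (simp add: Lax_def pauli_mat_def coords_def)

lemma Kmat_eq: "Kmat \<tau> \<nu> s x z = lax (\<lambda>\<alpha>. phi \<tau> \<alpha> z) (\<nu> s) (coords (Bdry s) x)"
  by (simp add: Kmat_def lax_def pauli_mat_def coords_def sum13)

primrec left_mat :: "(nat \<Rightarrow> complex) \<Rightarrow> (boundary \<Rightarrow> nat \<Rightarrow> complex) \<Rightarrow> nat \<Rightarrow> point \<Rightarrow> cmat2" where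
  "left_mat a \<nu> 0 x = lax a (\<nu> Minus) (coords (Bdry Minus) x)"
| "left_mat a \<nu> (Suc n) x = pauli_mat a (coords (Site (Suc n)) x) ** left_mat a \<nu> n x ** pauli_mat a (coords (Site (Suc n)) x)"

text \<open>V_(N - j): the recursion starts at the \<open>Plus\<close> vertex and moves inwards, so
  it has to count from the right.\<close>

primrec right_mat_aux :: "(nat \<Rightarrow> complex) \<Rightarrow> (boundary \<Rightarrow> nat \<Rightarrow> complex) \<Rightarrow> nat \<Rightarrow> nat \<Rightarrow> point \<Rightarrow> cmat2" where
  "right_mat_aux a \<nu> N 0 x = lax a (\<nu> Plus) (coords (Bdry Plus) x)"
| "right_mat_aux a \<nu> N (Suc j) x = pauli_mat a (coords (Site (N - j)) x) ** right_mat_aux a \<nu> N j x ** pauli_mat a (coords (Site (N - j)) x)"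

definition right_mat where "right_mat a \<nu> N n x = right_mat_aux a \<nu> N (N - n) x"

definition transfer_num :: "(nat \<Rightarrow> complex) \<Rightarrow> (boundary \<Rightarrow> nat \<Rightarrow> complex) \<Rightarrow> nat \<Rightarrow> point \<Rightarrow> complex" where
  "transfer_num a \<nu> N x = trace (right_mat a \<nu> N N x ** left_mat a \<nu> N x)"

definition site_det :: "(nat \<Rightarrow> complex) \<Rightarrow> nat \<Rightarrow> point \<Rightarrow> complex" where
  "site_det a n x = (x (Site n, 0))\<^sup>2 - (\<Sum>\<alpha>=1..3. (x (Site n, \<alpha>))\<^sup>2 * (a \<alpha>)\<^sup>2)"

lemma right_mat_self: "right_mat a \<nu> N N x = lax a (\<nu> Plus) (coords (Bdry Plus) x)"
  by (simp add: right_mat_def)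

lemma right_mat_step:
  assumes "n < N"
  shows "right_mat a \<nu> N n x = pauli_mat a (coords (Site (Suc n)) x) ** right_mat a \<nu> N (Suc n) x ** pauli_mat a (coords (Site (Suc n)) x)"
proof -
  have "N - n = Suc (N - Suc n)" "N - (N - Suc n) = Suc n" using assms by auto
  then show ?thesis by (simp add: right_mat_def)
qed

lemma transfer_num_eq:
  assumes "n \<le> N"
  shows "transfer_num a \<nu> N x = trace (right_mat a \<nu> N n x ** left_mat a \<nu> n x)"
  using assms
proof (induction "N - n" arbitrary: n)
  case 0
  then show ?case by (simp add: transfer_num_def)
next
  case (Suc k)
  let ?L = "pauli_mat a (coords (Site (Suc n)) x)"
  have "transfer_num a \<nu> N x = trace (right_mat a \<nu> N (Suc n) x ** ?L ** left_mat a \<nu> n x ** ?L)"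
    using Suc.hyps(1)[of "Suc n"] Suc.hyps(2) Suc.prems by (simp add: matrix_mul_assoc)
  also have "\<dots> = trace (?L ** (right_mat a \<nu> N (Suc n) x ** ?L ** left_mat a \<nu> n x))"
    by (rule trace_mul_sym)
  finally show ?case using Suc by (simp add: right_mat_step matrix_mul_assoc)
qed

lemma coords_upd_other: "v' \<noteq> v \<Longrightarrow> coords v (x((v', \<alpha>) := t)) = coords v x"
  by (auto simp: coords_def)

lemma coords_upd_same: "coords v (x((v, \<alpha>) := t)) = (coords v x)(\<alpha> := t)"
  by (auto simp: coords_def)

lemma left_mat_upd:
  assumes "\<And>m. m \<in> {1..n} \<Longrightarrow> v \<noteq> Site m" "v \<noteq> Bdry Minus"
  shows "left_mat a \<nu> n (x((v, \<alpha>) := t)) = left_mat a \<nu> n x"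
  using assms
proof (induction n)
  case 0
  then show ?case by (simp only: left_mat.simps coords_upd_other not_False_eq_True)
next
  case (Suc n)
  have "v \<noteq> Site (Suc n)" by (rule Suc.prems) auto
  moreover have "left_mat a \<nu> n (x((v, \<alpha>) := t)) = left_mat a \<nu> n x"
    by (rule Suc.IH) (use Suc.prems in auto)
  ultimately show ?case by (simp only: left_mat.simps coords_upd_other not_False_eq_True)
qed

lemma right_mat_upd:
  assumes "\<And>m. m \<in> {n<..N} \<Longrightarrow> v \<noteq> Site m" "v \<noteq> Bdry Plus" "n \<le> N"
  shows "right_mat a \<nu> N n (x((v, \<alpha>) := t)) = right_mat a \<nu> N n x"
  using assms
proof (induction "N - n" arbitrary: n)
  case 0
  then have "n = N" by simp
  then show ?case using 0 by (simp only: right_mat_self coords_upd_other not_False_eq_True)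
next
  case (Suc k)
  have "v \<noteq> Site (Suc n)" by (rule Suc.prems) (use Suc in auto)
  moreover have "right_mat a \<nu> N (Suc n) (x((v, \<alpha>) := t)) = right_mat a \<nu> N (Suc n) x"
    by (rule Suc.hyps) (use Suc in auto)
  moreover have "n < N" using Suc by simp
  ultimately show ?case by (simp only: right_mat_step coords_upd_other not_False_eq_True)
qed

lemma site_det_Lax:
  "det (Lax \<tau> n x (- z)) = site_det (\<lambda>\<alpha>. phi \<tau> \<alpha> (-z)) n x"
  by (simp add: Lax_eq det_2 pauli_mat_entries site_det_def sum13 coords_def power2_eq_square algebra_simps)

lemma matrix_inv_unique:
  fixes A B :: "'a::semiring_1^'n^'n"
  assumes "A ** B = mat 1" "B ** A = mat 1"
  shows "matrix_inv A = B"
proof -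
  have "A ** matrix_inv A = mat 1 \<and> matrix_inv A ** A = mat 1"
    unfolding matrix_inv_def by (rule someI[of _ B]) (use assms in simp)
  then show ?thesis
    by (metis assms(1) matrix_mul_assoc matrix_mul_lid matrix_mul_rid)
qed

lemma matrix_inv_Lax:
  assumes odd: "\<And>\<alpha>. phi \<tau> \<alpha> (- z) = - phi \<tau> \<alpha> z"
    and "site_det (\<lambda>\<alpha>. phi \<tau> \<alpha> z) n x \<noteq> 0"
  shows "matrix_inv (Lax \<tau> n x (- z)) = scale_mat (1 / site_det (\<lambda>\<alpha>. phi \<tau> \<alpha> z) n x) (Lax \<tau> n x z)"
proof -
  have "Lax \<tau> n x (- z) ** Lax \<tau> n x z = scale_mat (site_det (\<lambda>\<alpha>. phi \<tau> \<alpha> z) n x) (mat 1)"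
    "Lax \<tau> n x z ** Lax \<tau> n x (- z) = scale_mat (site_det (\<lambda>\<alpha>. phi \<tau> \<alpha> z) n x) (mat 1)"
    unfolding Lax_eq odd
    by (simp_all add: mat_eq_iff scale_mat_entry matrix_matrix_mult_def sum_2 pauli_mat_entries mat_def
      site_det_def coords_def sum13 power2_eq_square algebra_simps)
  then show ?thesis
    using assms(2) by (intro matrix_inv_unique) (simp_all add: scale_mat_simps)
qed

lemma invertible_Lax_iff:
  assumes odd: "\<And>\<alpha>. phi \<tau> \<alpha> (- z) = - phi \<tau> \<alpha> z"
  shows "invertible (Lax \<tau> n x (- z)) \<longleftrightarrow> site_det (\<lambda>\<alpha>. phi \<tau> \<alpha> z) n x \<noteq> 0"
  unfolding invertible_det_nz site_det_Lax unfolding odd by (simp add: site_det_def)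

lemma transfer_eq:
  assumes odd: "\<And>\<alpha>. phi \<tau> \<alpha> (- z) = - phi \<tau> \<alpha> z"
    and nz: "\<And>n. n \<in> {1..N} \<Longrightarrow> site_det (\<lambda>\<alpha>. phi \<tau> \<alpha> z) n x \<noteq> 0"
  shows "transfer \<tau> \<nu> N z x = transfer_num (\<lambda>\<alpha>. phi \<tau> \<alpha> z) \<nu> N x / (\<Prod>n=1..N. site_det (\<lambda>\<alpha>. phi \<tau> \<alpha> z) n x)"
proof -
  let ?a = "\<lambda>\<alpha>. phi \<tau> \<alpha> z"
  have "Lax_prod \<tau> n x z ** Kmat \<tau> \<nu> Minus x z ** Lax_inv_prod \<tau> n x z = scale_mat (1 / (\<Prod>m=1..n. site_det ?a m x)) (left_mat ?a \<nu> n x)"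
    if "n \<le> N" for n
    using that
  proof (induction n)
    case 0
    then show ?case by (simp add: scale_mat_simps Kmat_eq)
  next
    case (Suc n)
    then have nz': "site_det ?a (Suc n) x \<noteq> 0" by (intro nz) auto
    have "Lax_prod \<tau> (Suc n) x z ** Kmat \<tau> \<nu> Minus x z ** Lax_inv_prod \<tau> (Suc n) x z
       = Lax \<tau> (Suc n) x z ** (Lax_prod \<tau> n x z ** Kmat \<tau> \<nu> Minus x z ** Lax_inv_prod \<tau> n x z) ** matrix_inv (Lax \<tau> (Suc n) x (-z))"
      by (simp add: matrix_mul_assoc)
    also have "\<dots> = scale_mat (1 / (\<Prod>m=1..Suc n. site_det ?a m x)) (left_mat ?a \<nu> (Suc n) x)"
      using Suc.IH Suc.prems unfolding matrix_inv_Lax[OF odd nz']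
      by (simp add: scale_mat_simps Lax_eq mult.commute)
    finally show ?case .
  qed
  from this[of N] show ?thesis
    unfolding transfer_def matrix_mul_assoc[symmetric] 
    by (simp add: scale_mat_simps transfer_num_def right_mat_self Kmat_eq)
qed

section \<open>Partial derivatives of the transfer function\<close>

definition unit_mat :: "(nat \<Rightarrow> complex) \<Rightarrow> nat \<Rightarrow> cmat2" where
  "unit_mat a \<alpha> = (if \<alpha> = 0 then mat 1 else scale_mat (a \<alpha>) (pauli \<alpha>))"

lemma trace_unit_mat: "trace (unit_mat a \<alpha> ** M) = grad a M \<alpha>"
  by (simp add: unit_mat_def grad_def scale_mat_simps)

lemma le3_cases: "\<alpha> \<in> {0..3} \<Longrightarrow> \<alpha> = 0 \<or> \<alpha> = 1 \<or> \<alpha> = 2 \<or> \<alpha> = (3::nat)"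
  by auto

lemma pauli_mat_upd:
  assumes "\<alpha> \<in> {0..3}"
  shows "pauli_mat a (S(\<alpha> := t)) = pauli_mat a S + scale_mat (t - S \<alpha>) (unit_mat a \<alpha>)"
  using le3_cases[OF assms]
  by (auto simp: mat_eq_iff pauli_mat_entries unit_mat_def scale_mat_entry pauli_entries mat_def algebra_simps)

lemma lax_upd:
  assumes "\<alpha> \<in> {0..3}"
  shows "lax a \<nu> (S(\<alpha> := t)) = lax a \<nu> S + scale_mat (t - S \<alpha>) (unit_mat a \<alpha>)"
  using le3_cases[OF assms]
  by (auto simp: lax_def mat_eq_iff pauli_mat_entries unit_mat_def scale_mat_entry pauli_entries mat_def algebra_simps)

definition det_grad :: "(nat \<Rightarrow> complex) \<Rightarrow> (nat \<Rightarrow> complex) \<Rightarrow> nat \<Rightarrow> complex" where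
  "det_grad a S \<alpha> = (if \<alpha> = 0 then 2 * S 0 else - 2 * S \<alpha> * (a \<alpha>)\<^sup>2)"

lemma site_det_upd_other: "v \<noteq> Site n \<Longrightarrow> site_det a n (x((v, \<alpha>) := t)) = site_det a n x"
  by (simp add: site_det_def)

lemma site_det_deriv:
  assumes "\<alpha> \<in> {0..3}"
  shows "((\<lambda>t. site_det a n (x((Site n, \<alpha>) := t))) has_field_derivative det_grad a (coords (Site n) x) \<alpha>) (at (x (Site n, \<alpha>)))"
  using le3_cases[OF assms]
  by (auto simp: site_det_def sum13 det_grad_def coords_def intro!: derivative_eq_intros)

text \<open>The formula for \<open>transfer\<close> with the inverses eliminated holds only where
  all determinants are nonzero. Comparing partial derivatives requires it on a whole
  neighbourhood.\<close>

lemma eventually_site_det_nz: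
  assumes "\<And>n. n \<in> {1..N} \<Longrightarrow> site_det a n x \<noteq> 0" "\<alpha> \<in> {0..3}"
  shows "\<forall>\<^sub>F t in nhds (x (v, \<alpha>)). \<forall>n\<in>{1..N}. site_det a n (x((v, \<alpha>) := t)) \<noteq> 0"
proof -
  have "\<forall>\<^sub>F t in nhds (x (v, \<alpha>)). site_det a n (x((v, \<alpha>) := t)) \<noteq> 0" if n: "n \<in> {1..N}" for n
  proof (cases "v = Site n")
    case True
    have "isCont (\<lambda>t. site_det a n (x((v, \<alpha>) := t))) (x (v, \<alpha>))"
      unfolding True by (rule DERIV_isCont[OF site_det_deriv[OF assms(2)]])
    then have "((\<lambda>t. site_det a n (x((v, \<alpha>) := t))) \<longlongrightarrow> site_det a n x) (nhds (x (v, \<alpha>)))"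
      using isCont_tendsto_compose[OF _ filterlim_ident] by fastforce
    then show ?thesis
      using assms(1)[OF n] by (rule tendsto_imp_eventually_ne)
  next
    case False
    then show ?thesis using assms(1)[OF n] by (simp add: site_det_upd_other)
  qed
  then show ?thesis by (intro eventually_ball_finite) auto
qed

lemma partial_cong:
  assumes "\<forall>\<^sub>F t in nhds (x p). F (x(p := t)) = G (x(p := t))"
  shows "partial p F x = partial p G x"
  unfolding partial_def by (rule deriv_cong_ev[OF assms refl])


lemma has_field_derivative_trace_linear:
  assumes "\<And>t. M t = M0 + scale_mat (t - t0) E"
  shows "((\<lambda>t. trace (X ** M t)) has_field_derivative trace (E ** X)) (at t0)"
proof -
  have "trace (X ** M t) = trace (X ** M0) + (t - t0) * trace (E ** X)" for t
    by (simp add: assms matrix_add_ldistrib trace_add scale_mat_simps trace_mul_sym[of E])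
  then show ?thesis by (auto intro!: derivative_eq_intros)
qed

lemma has_field_derivative_trace_quadratic:
  assumes M: "\<And>t. M t = M0 + scale_mat (t - t0) E"
  shows "((\<lambda>t. trace (V ** (M t ** U ** M t))) has_field_derivative
     trace (E ** (U ** M0 ** V + V ** M0 ** U))) (at t0)"
proof -
  have *: "trace (V ** (M0 ** U ** E)) = trace (E ** (V ** M0 ** U))"
     "trace (V ** (E ** U ** M0)) = trace (E ** (U ** M0 ** V))"
    using trace_mul_sym[of "V ** M0 ** U" E] trace_mul_sym[of V "E ** U ** M0"]
    by (simp_all add: matrix_mul_assoc)
  have "trace (V ** (M t ** U ** M t)) = trace (V ** (M0 ** U ** M0))
     + (t - t0) * trace (E ** (U ** M0 ** V + V ** M0 ** U)) + (t - t0)\<^sup>2 * trace (V ** (E ** U ** E))" for t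
    unfolding M
    by (simp add: matrix_add_ldistrib mat_add_rdistrib trace_add scale_mat_simps * power2_eq_square algebra_simps)
  then show ?thesis by (auto intro!: derivative_eq_intros)
qed

section \<open>The bracket as a sum over vertices\<close>

definition half_period_E2 :: "complex \<Rightarrow> nat \<Rightarrow> complex" where
  "half_period_E2 \<tau> \<alpha> = E2 \<tau> (half_period \<tau> \<alpha>)"

lemma sum_le3: "(\<Sum>\<alpha>\<in>{0..3}. f \<alpha>) = f 0 + f 1 + f 2 + (f (3::nat) :: 'a :: comm_monoid_add)"
proof -
  have "{0..3} = {0, 1, 2, 3::nat}" by auto
  then show ?thesis by (simp add: add.assoc)
qed

lemma levi_civita_eval:
  "levi_civita 1 2 3 = 1" "levi_civita 2 3 1 = 1" "levi_civita 3 1 2 = 1"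
  "levi_civita 1 3 2 = -1" "levi_civita 3 2 1 = -1" "levi_civita 2 1 3 = -1"
  "levi_civita \<alpha> \<alpha> \<beta> = 0" "levi_civita \<alpha> \<beta> \<alpha> = 0" "levi_civita \<beta> \<alpha> \<alpha> = 0"
  by (auto simp: levi_civita_def)

lemma coord_bracket_Bdry:
  "(\<Sum>\<alpha>\<in>{0..3}. \<Sum>\<beta>\<in>{0..3}. X \<alpha> * Y \<beta> * coord_bracket \<tau> \<nu> (Bdry s, \<alpha>) (Bdry s, \<beta>) x)
    = 4 * \<i> * vertex_pb (half_period_E2 \<tau>) (\<nu> s) (coords (Bdry s) x) X Y"
  unfolding sum_le3 coord_bracket_def vertex_pb_def cyc_def
  by (simp add: levi_civita_eval sum13 coords_def half_period_E2_def algebra_simps)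

lemma coord_bracket_Site:
  "(\<Sum>\<alpha>\<in>{0..3}. \<Sum>\<beta>\<in>{0..3}. X \<alpha> * Y \<beta> * coord_bracket \<tau> \<nu> (Site n, \<alpha>) (Site n, \<beta>) x)
    = 2 * \<i> * vertex_pb (half_period_E2 \<tau>) (\<lambda>_. 0) (coords (Site n) x) X Y"
  unfolding sum_le3 coord_bracket_def vertex_pb_def cyc_def
  by (simp add: levi_civita_eval sum13 coords_def half_period_E2_def algebra_simps)

lemma range_Bdry: "range Bdry = {Bdry Minus, Bdry Plus}"
  using boundary.exhaust by auto

lemma sum_vertices:
  "sum f (vertices N) = f (Bdry Minus) + f (Bdry Plus) + (\<Sum>n=1..N. f (Site n))"
proof -
  have "sum f (Site ` {1..N}) = (\<Sum>n=1..N. f (Site n))"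
    by (subst sum.reindex) (auto simp: inj_on_def)
  then show ?thesis
    unfolding vertices_def range_Bdry by (subst sum.union_disjoint) (auto simp: add.assoc)
qed

lemma poisson_eq:
  "poisson \<tau> \<nu> N F G x =
     4 * \<i> * vertex_pb (half_period_E2 \<tau>) (\<nu> Minus) (coords (Bdry Minus) x) (\<lambda>\<alpha>. partial (Bdry Minus, \<alpha>) F x) (\<lambda>\<alpha>. partial (Bdry Minus, \<alpha>) G x)
   + 4 * \<i> * vertex_pb (half_period_E2 \<tau>) (\<nu> Plus) (coords (Bdry Plus) x) (\<lambda>\<alpha>. partial (Bdry Plus, \<alpha>) F x) (\<lambda>\<alpha>. partial (Bdry Plus, \<alpha>) G x)
   + (\<Sum>n=1..N. 2 * \<i> * vertex_pb (half_period_E2 \<tau>) (\<lambda>_. 0) (coords (Site n) x) (\<lambda>\<alpha>. partial (Site n, \<alpha>) F x) (\<lambda>\<alpha>. partial (Site n, \<alpha>) G x))"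
proof -
  have fin: "finite (vertices N)" by (simp add: vertices_def range_Bdry)
  have "poisson \<tau> \<nu> N F G x = (\<Sum>v\<in>vertices N. \<Sum>\<alpha>\<in>{0..3}. \<Sum>v'\<in>vertices N. \<Sum>\<beta>\<in>{0..3}.
       partial (v, \<alpha>) F x * partial (v', \<beta>) G x * coord_bracket \<tau> \<nu> (v, \<alpha>) (v', \<beta>) x)"
    unfolding poisson_def sum.cartesian_product' ..
  also have "\<dots> = (\<Sum>v\<in>vertices N. \<Sum>\<alpha>\<in>{0..3}. \<Sum>\<beta>\<in>{0..3}.
       partial (v, \<alpha>) F x * partial (v, \<beta>) G x * coord_bracket \<tau> \<nu> (v, \<alpha>) (v, \<beta>) x)"
  proof (intro sum.cong refl)
    fix v \<alpha> assume v: "v \<in> vertices N"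
    have "(\<Sum>v'\<in>vertices N. \<Sum>\<beta>\<in>{0..3}. partial (v, \<alpha>) F x * partial (v', \<beta>) G x * coord_bracket \<tau> \<nu> (v, \<alpha>) (v', \<beta>) x)
       = (\<Sum>v'\<in>vertices N. if v' = v then \<Sum>\<beta>\<in>{0..3}. partial (v, \<alpha>) F x * partial (v, \<beta>) G x * coord_bracket \<tau> \<nu> (v, \<alpha>) (v, \<beta>) x else 0)"
      by (intro sum.cong) (auto simp: coord_bracket_def)
    then show "(\<Sum>v'\<in>vertices N. \<Sum>\<beta>\<in>{0..3}. partial (v, \<alpha>) F x * partial (v', \<beta>) G x * coord_bracket \<tau> \<nu> (v, \<alpha>) (v', \<beta>) x)
       = (\<Sum>\<beta>\<in>{0..3}. partial (v, \<alpha>) F x * partial (v, \<beta>) G x * coord_bracket \<tau> \<nu> (v, \<alpha>) (v, \<beta>) x)"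
      using v fin by simp
  qed
  finally show ?thesis
    unfolding sum_vertices coord_bracket_Site coord_bracket_Bdry .
qed

lemma vertex_pb_cong:
  assumes "\<And>\<alpha>. \<alpha> \<in> {0..3} \<Longrightarrow> X \<alpha> = X' \<alpha>" "\<And>\<alpha>. \<alpha> \<in> {0..3} \<Longrightarrow> Y \<alpha> = Y' \<alpha>"
  shows "vertex_pb e \<nu> S X Y = vertex_pb e \<nu> S X' Y'"
  unfolding vertex_pb_def cyc_def using assms by simp

lemma vertex_pb_linear:
  "vertex_pb e \<nu> S (\<lambda>\<alpha>. c * X \<alpha> + d * X' \<alpha>) Y = c * vertex_pb e \<nu> S X Y + d * vertex_pb e \<nu> S X' Y"
  "vertex_pb e \<nu> S X (\<lambda>\<alpha>. c * Y \<alpha> + d * Y' \<alpha>) = c * vertex_pb e \<nu> S X Y + d * vertex_pb e \<nu> S X Y'"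
  by (simp_all add: vertex_pb_def cyc_def algebra_simps)

lemma vertex_pb_self: "vertex_pb e \<nu> S X X = 0"
  by (simp add: vertex_pb_def cyc_def)

text \<open>With these squares, det L is one Casimir function minus \<open>c\<close> times the
  other, namely S_0^2 + sum e_\<alpha> S_\<alpha>^2 - c sum S_\<alpha>^2. Its gradient therefore
  lies in the kernel of the bracket.\<close>

lemma vertex_pb_det_grad:
  assumes "\<And>\<alpha>. \<alpha> \<in> {1..3} \<Longrightarrow> (a \<alpha>)\<^sup>2 = c - e \<alpha>"
  shows "vertex_pb e (\<lambda>_. 0) S (det_grad a S) Y = 0" "vertex_pb e (\<lambda>_. 0) S X (det_grad a S) = 0"
  by (simp_all add: vertex_pb_def cyc_def det_grad_def assms algebra_simps)

text \<open>h(z) without matrix inverses, as a function of arbitrary numbers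
  \<open>a \<alpha>\<close> instead of \<open>z\<close>. This makes it possible to change their
  signs independently.\<close>

definition transfer_ratio :: "(nat \<Rightarrow> complex) \<Rightarrow> (boundary \<Rightarrow> nat \<Rightarrow> complex) \<Rightarrow> nat \<Rightarrow> point \<Rightarrow> complex" where
  "transfer_ratio a \<nu> N x = transfer_num a \<nu> N x / (\<Prod>n=1..N. site_det a n x)"

lemma partial_transfer:
  assumes odd: "\<And>\<alpha>. phi \<tau> \<alpha> (- z) = - phi \<tau> \<alpha> z"
    and nz: "\<And>n. n \<in> {1..N} \<Longrightarrow> site_det (\<lambda>\<alpha>. phi \<tau> \<alpha> z) n x \<noteq> 0"
    and "\<alpha> \<in> {0..3}"
  shows "partial (v, \<alpha>) (transfer \<tau> \<nu> N z) x = partial (v, \<alpha>) (transfer_ratio (\<lambda>\<alpha>. phi \<tau> \<alpha> z) \<nu> N) x"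
proof (rule partial_cong)
  have "\<forall>\<^sub>F t in nhds (x (v, \<alpha>)). \<forall>n\<in>{1..N}. site_det (\<lambda>\<alpha>. phi \<tau> \<alpha> z) n (x((v, \<alpha>) := t)) \<noteq> 0"
    by (rule eventually_site_det_nz[OF nz assms(3)])
  then show "\<forall>\<^sub>F t in nhds (x (v, \<alpha>)). transfer \<tau> \<nu> N z (x((v, \<alpha>) := t)) = transfer_ratio (\<lambda>\<alpha>. phi \<tau> \<alpha> z) \<nu> N (x((v, \<alpha>) := t))"
    by eventually_elim (auto simp: transfer_ratio_def intro!: transfer_eq odd)
qed

lemma transfer_ratio_deriv_Minus:
  assumes "\<alpha> \<in> {0..3}"
  shows "partial (Bdry Minus, \<alpha>) (transfer_ratio a \<nu> N) x =
    grad a (right_mat a \<nu> N 0 x) \<alpha> / (\<Prod>n=1..N. site_det a n x)"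
proof -
  let ?p = "(Bdry Minus, \<alpha>)"
  have "transfer_ratio a \<nu> N (x(?p := t)) = trace (right_mat a \<nu> N 0 x ** lax a (\<nu> Minus) ((coords (Bdry Minus) x)(\<alpha> := t))) / (\<Prod>n=1..N. site_det a n x)" for t
  proof -
    have "right_mat a \<nu> N 0 (x(?p := t)) = right_mat a \<nu> N 0 x" by (rule right_mat_upd) auto
    moreover have "site_det a n (x(?p := t)) = site_det a n x" for n by (rule site_det_upd_other) simp
    ultimately show ?thesis
      unfolding transfer_ratio_def transfer_num_eq[OF le0] by (simp only: left_mat.simps coords_upd_same)
  qed
  moreover have "((\<lambda>t. trace (right_mat a \<nu> N 0 x ** lax a (\<nu> Minus) ((coords (Bdry Minus) x)(\<alpha> := t))) / (\<Prod>n=1..N. site_det a n x))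
     has_field_derivative trace (unit_mat a \<alpha> ** right_mat a \<nu> N 0 x) / (\<Prod>n=1..N. site_det a n x)) (at (coords (Bdry Minus) x \<alpha>))"
    by (rule DERIV_cdivide[OF has_field_derivative_trace_linear[OF lax_upd[OF assms]]])
  ultimately show ?thesis
    unfolding partial_def trace_unit_mat by (simp add: DERIV_imp_deriv coords_def)
qed

lemma transfer_ratio_deriv_Plus:
  assumes "\<alpha> \<in> {0..3}"
  shows "partial (Bdry Plus, \<alpha>) (transfer_ratio a \<nu> N) x =
    grad a (left_mat a \<nu> N x) \<alpha> / (\<Prod>n=1..N. site_det a n x)"
proof -
  let ?p = "(Bdry Plus, \<alpha>)"
  have "transfer_ratio a \<nu> N (x(?p := t)) = trace (left_mat a \<nu> N x ** lax a (\<nu> Plus) ((coords (Bdry Plus) x)(\<alpha> := t))) / (\<Prod>n=1..N. site_det a n x)" for t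
  proof -
    have "left_mat a \<nu> N (x(?p := t)) = left_mat a \<nu> N x" by (rule left_mat_upd) auto
    moreover have "site_det a n (x(?p := t)) = site_det a n x" for n by (rule site_det_upd_other) simp
    ultimately show ?thesis
      unfolding transfer_ratio_def transfer_num_def right_mat_self trace_mul_sym[of _ "left_mat a \<nu> N _"] by (simp only: coords_upd_same)
  qed
  moreover have "((\<lambda>t. trace (left_mat a \<nu> N x ** lax a (\<nu> Plus) ((coords (Bdry Plus) x)(\<alpha> := t))) / (\<Prod>n=1..N. site_det a n x))
     has_field_derivative trace (unit_mat a \<alpha> ** left_mat a \<nu> N x) / (\<Prod>n=1..N. site_det a n x)) (at (coords (Bdry Plus) x \<alpha>))"
    by (rule DERIV_cdivide[OF has_field_derivative_trace_linear[OF lax_upd[OF assms]]])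
  ultimately show ?thesis
    unfolding partial_def trace_unit_mat by (simp add: DERIV_imp_deriv coords_def)
qed

text \<open>Derivative of tr(V L U L) with respect to L, written as the matrix whose product with a
  variation of L is traced.\<close>

definition site_cofactor where
  "site_cofactor a \<nu> N n x = left_mat a \<nu> (n - 1) x ** pauli_mat a (coords (Site n) x) ** right_mat a \<nu> N n x
     + right_mat a \<nu> N n x ** pauli_mat a (coords (Site n) x) ** left_mat a \<nu> (n - 1) x"

text \<open>The quotient rule, arranged as a multiple of the gradient of the numerator plus a
  multiple of the gradient of the determinant, because the bracket annihilates the second.\<close>

lemma transfer_ratio_deriv_Site:
  assumes \<alpha>: "\<alpha> \<in> {0..3}" and n: "n \<in> {1..N}"
    and nz: "\<And>n. n \<in> {1..N} \<Longrightarrow> site_det a n x \<noteq> 0"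
  shows "partial (Site n, \<alpha>) (transfer_ratio a \<nu> N) x =
    1 / (\<Prod>n=1..N. site_det a n x) * grad a (site_cofactor a \<nu> N n x) \<alpha>
    + - (transfer_num a \<nu> N x / ((\<Prod>n=1..N. site_det a n x) * site_det a n x)) * det_grad a (coords (Site n) x) \<alpha>"
proof -
  let ?p = "(Site n, \<alpha>)" and ?U = "left_mat a \<nu> (n - 1) x" and ?V = "right_mat a \<nu> N n x"
  let ?L = "\<lambda>t. pauli_mat a ((coords (Site n) x)(\<alpha> := t))"
  let ?t0 = "coords (Site n) x \<alpha>"
  define \<Delta>' where "\<Delta>' = (\<Prod>m\<in>{1..N} - {n}. site_det a m x)"
  have \<Delta>: "(\<Prod>n=1..N. site_det a n x) = site_det a n x * \<Delta>'"
    unfolding \<Delta>'_def using n by (intro prod.remove) auto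
  have nz': "site_det a n x \<noteq> 0" "\<Delta>' \<noteq> 0"
    using nz n by (auto simp: \<Delta>'_def)
  have transfer_num: "transfer_num a \<nu> N (x(?p := t)) = trace (?V ** (?L t ** ?U ** ?L t))" for t
  proof -
    have "right_mat a \<nu> N n (x(?p := t)) = ?V" by (rule right_mat_upd) (use n in auto)
    moreover have "left_mat a \<nu> (n - 1) (x(?p := t)) = ?U" by (rule left_mat_upd) (use n in auto)
    moreover obtain m where "n = Suc m" using n by (cases n) auto
    ultimately show ?thesis
      using n by (simp only: transfer_num_eq[of n N] left_mat.simps coords_upd_same diff_Suc_1 atLeastAtMost_iff)
  qed
  have transfer_ratio: "transfer_ratio a \<nu> N (x(?p := t)) = trace (?V ** (?L t ** ?U ** ?L t)) / (site_det a n (x(?p := t)) * \<Delta>')" for t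
  proof -
    have "(\<Prod>n=1..N. site_det a n (x(?p := t))) = site_det a n (x(?p := t)) * (\<Prod>m\<in>{1..N} - {n}. site_det a m (x(?p := t)))"
      using n by (intro prod.remove) auto
    also have "(\<Prod>m\<in>{1..N} - {n}. site_det a m (x(?p := t))) = \<Delta>'"
      unfolding \<Delta>'_def by (intro prod.cong refl site_det_upd_other) auto
    finally show ?thesis unfolding transfer_ratio_def transfer_num by (simp only:)
  qed
  have "((\<lambda>t. trace (?V ** (?L t ** ?U ** ?L t))) has_field_derivative
      trace (unit_mat a \<alpha> ** site_cofactor a \<nu> N n x)) (at ?t0)"
    unfolding site_cofactor_def by (rule has_field_derivative_trace_quadratic[OF pauli_mat_upd[OF \<alpha>], of _ a "coords (Site n) x", simplified])
  moreover have "((\<lambda>t. site_det a n (x(?p := t)) * \<Delta>') has_field_derivative det_grad a (coords (Site n) x) \<alpha> * \<Delta>') (at ?t0)"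
    using DERIV_cmult_right[OF site_det_deriv[OF \<alpha>, of a n x], of \<Delta>'] by (simp add: coords_def)
  ultimately have "((\<lambda>t. transfer_ratio a \<nu> N (x(?p := t))) has_field_derivative
      (grad a (site_cofactor a \<nu> N n x) \<alpha> * (site_det a n x * \<Delta>') - transfer_num a \<nu> N x * (det_grad a (coords (Site n) x) \<alpha> * \<Delta>'))
       / ((site_det a n x * \<Delta>') * (site_det a n x * \<Delta>'))) (at ?t0)"
    unfolding transfer_ratio transfer_num[symmetric] trace_unit_mat
    using nz' by (auto dest: DERIV_divide simp: coords_def)
  then have "partial ?p (transfer_ratio a \<nu> N) x = (grad a (site_cofactor a \<nu> N n x) \<alpha> * (site_det a n x * \<Delta>') - transfer_num a \<nu> N x * (det_grad a (coords (Site n) x) \<alpha> * \<Delta>'))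
       / ((site_det a n x * \<Delta>') * (site_det a n x * \<Delta>'))"
    unfolding partial_def by (simp add: DERIV_imp_deriv coords_def)
  moreover have "(g * (s * \<Delta>') - G * (d * \<Delta>')) / ((s * \<Delta>') * (s * \<Delta>')) = 1 / (s * \<Delta>') * g + - (G / ((s * \<Delta>') * s)) * d"
    if "s \<noteq> 0" for g s G d using nz'(2) that by (simp add: field_simps)
  ultimately show ?thesis
    unfolding \<Delta> using nz'(1) by (simp only: not_False_eq_True)
qed

lemma vertex_pb_Site_transfer_ratio:
  assumes sq: "\<And>\<alpha>. \<alpha> \<in> {1..3} \<Longrightarrow> (a \<alpha>)\<^sup>2 = c - e \<alpha>"
    and det: "\<And>n. n \<in> {1..N} \<Longrightarrow> site_det a n x \<noteq> 0" and n: "n \<in> {1..N}"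
  shows "vertex_pb e (\<lambda>_. 0) (coords (Site n) x) X (\<lambda>\<alpha>. partial (Site n, \<alpha>) (transfer_ratio a \<nu> N) x) =
      vertex_pb e (\<lambda>_. 0) (coords (Site n) x) X (grad a (site_cofactor a \<nu> N n x)) / (\<Prod>n=1..N. site_det a n x)" (is ?R)
    and "vertex_pb e (\<lambda>_. 0) (coords (Site n) x) (\<lambda>\<alpha>. partial (Site n, \<alpha>) (transfer_ratio a \<nu> N) x) X =
      vertex_pb e (\<lambda>_. 0) (coords (Site n) x) (grad a (site_cofactor a \<nu> N n x)) X / (\<Prod>n=1..N. site_det a n x)" (is ?L)
proof -
  let ?g = "\<lambda>\<alpha>. 1 / (\<Prod>n=1..N. site_det a n x) * grad a (site_cofactor a \<nu> N n x) \<alpha>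
    + - (transfer_num a \<nu> N x / ((\<Prod>n=1..N. site_det a n x) * site_det a n x)) * det_grad a (coords (Site n) x) \<alpha>"
  have "vertex_pb e (\<lambda>_. 0) (coords (Site n) x) X (\<lambda>\<alpha>. partial (Site n, \<alpha>) (transfer_ratio a \<nu> N) x) = vertex_pb e (\<lambda>_. 0) (coords (Site n) x) X ?g"
    "vertex_pb e (\<lambda>_. 0) (coords (Site n) x) (\<lambda>\<alpha>. partial (Site n, \<alpha>) (transfer_ratio a \<nu> N) x) X = vertex_pb e (\<lambda>_. 0) (coords (Site n) x) ?g X"
    by (intro vertex_pb_cong refl transfer_ratio_deriv_Site det n; assumption)+
  then show ?R ?L
    unfolding vertex_pb_linear using vertex_pb_det_grad[of a c e] sq by simp_all
qed

lemma vertex_pb_Minus_transfer_ratio: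
  "vertex_pb e \<nu>' S X (\<lambda>\<alpha>. partial (Bdry Minus, \<alpha>) (transfer_ratio a \<nu> N) x) =
    vertex_pb e \<nu>' S X (grad a (right_mat a \<nu> N 0 x)) / (\<Prod>n=1..N. site_det a n x)" (is ?R)
  "vertex_pb e \<nu>' S (\<lambda>\<alpha>. partial (Bdry Minus, \<alpha>) (transfer_ratio a \<nu> N) x) X =
    vertex_pb e \<nu>' S (grad a (right_mat a \<nu> N 0 x)) X / (\<Prod>n=1..N. site_det a n x)" (is ?L)
proof -
  \<comment> \<open>The summand \<open>0 * 0\<close> pads the gradient to the two-term shape of
    \<open>vertex_pb_linear\<close>.\<close>
  let ?g = "\<lambda>\<alpha>. 1 / (\<Prod>n=1..N. site_det a n x) * grad a (right_mat a \<nu> N 0 x) \<alpha> + 0 * 0"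
  have "vertex_pb e \<nu>' S X (\<lambda>\<alpha>. partial (Bdry Minus, \<alpha>) (transfer_ratio a \<nu> N) x) = vertex_pb e \<nu>' S X ?g"
    "vertex_pb e \<nu>' S (\<lambda>\<alpha>. partial (Bdry Minus, \<alpha>) (transfer_ratio a \<nu> N) x) X = vertex_pb e \<nu>' S ?g X"
    by (rule vertex_pb_cong; simp add: transfer_ratio_deriv_Minus)+
  then show ?R ?L unfolding vertex_pb_linear by simp_all
qed

lemma vertex_pb_Plus_transfer_ratio:
  "vertex_pb e \<nu>' S X (\<lambda>\<alpha>. partial (Bdry Plus, \<alpha>) (transfer_ratio a \<nu> N) x) =
    vertex_pb e \<nu>' S X (grad a (left_mat a \<nu> N x)) / (\<Prod>n=1..N. site_det a n x)" (is ?R)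
  "vertex_pb e \<nu>' S (\<lambda>\<alpha>. partial (Bdry Plus, \<alpha>) (transfer_ratio a \<nu> N) x) X =
    vertex_pb e \<nu>' S (grad a (left_mat a \<nu> N x)) X / (\<Prod>n=1..N. site_det a n x)" (is ?L)
proof -
  let ?g = "\<lambda>\<alpha>. 1 / (\<Prod>n=1..N. site_det a n x) * grad a (left_mat a \<nu> N x) \<alpha> + 0 * 0"
  have "vertex_pb e \<nu>' S X (\<lambda>\<alpha>. partial (Bdry Plus, \<alpha>) (transfer_ratio a \<nu> N) x) = vertex_pb e \<nu>' S X ?g"
    "vertex_pb e \<nu>' S (\<lambda>\<alpha>. partial (Bdry Plus, \<alpha>) (transfer_ratio a \<nu> N) x) X = vertex_pb e \<nu>' S ?g X"
    by (rule vertex_pb_cong; simp add: transfer_ratio_deriv_Plus)+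
  then show ?R ?L unfolding vertex_pb_linear by simp_all
qed

text \<open>All contributions are computed after multiplication by \<open>D\<close>. They share the
  denominator \<open>?\<Delta>\<close>, so the telescoping takes place in the numerators.\<close>

lemma poisson_transfer_ratio_zero:
  fixes a b :: "nat \<Rightarrow> complex" and c D :: complex
  assumes sq: "\<And>\<alpha>. \<alpha> \<in> {1..3} \<Longrightarrow> (a \<alpha>)\<^sup>2 = c - half_period_E2 \<tau> \<alpha>"
      "\<And>\<alpha>. \<alpha> \<in> {1..3} \<Longrightarrow> (b \<alpha>)\<^sup>2 = c + D - half_period_E2 \<tau> \<alpha>"
    and nz: "\<And>\<alpha>. \<alpha> \<in> {1..3} \<Longrightarrow> a \<alpha> \<noteq> 0" "\<And>\<alpha>. \<alpha> \<in> {1..3} \<Longrightarrow> b \<alpha> \<noteq> 0"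
    and det: "\<And>n. n \<in> {1..N} \<Longrightarrow> site_det a n x \<noteq> 0" "\<And>n. n \<in> {1..N} \<Longrightarrow> site_det b n x \<noteq> 0"
    and D: "D \<noteq> 0"
  shows "poisson \<tau> \<nu> N (transfer_ratio a \<nu> N) (transfer_ratio b \<nu> N) x = 0"
proof -
  let ?e = "half_period_E2 \<tau>"
  let ?\<Delta> = "(\<Prod>n=1..N. site_det a n x) * (\<Prod>n=1..N. site_det b n x)"
  define R where "R n = reflection_form a b (left_mat a \<nu> n x) (right_mat a \<nu> N n x) (left_mat b \<nu> n x) (right_mat b \<nu> N n x)" for n
  have site: "D * (2 * \<i> * vertex_pb ?e (\<lambda>_. 0) (coords (Site n) x) (\<lambda>\<alpha>. partial (Site n, \<alpha>) (transfer_ratio a \<nu> N) x) (\<lambda>\<alpha>. partial (Site n, \<alpha>) (transfer_ratio b \<nu> N) x))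
     = (R n - R (n - 1)) / ?\<Delta>" if n: "n \<in> {1..N}" for n
  proof -
    obtain m where m: "n = Suc m" using n by (cases n) auto
    have V: "right_mat a \<nu> N m x = pauli_mat a (coords (Site n) x) ** right_mat a \<nu> N n x ** pauli_mat a (coords (Site n) x)" for a
      unfolding m by (rule right_mat_step) (use m n in simp)
    have U: "left_mat a \<nu> n x = pauli_mat a (coords (Site n) x) ** left_mat a \<nu> m x ** pauli_mat a (coords (Site n) x)" for a
      unfolding m by simp
    have "2 * \<i> * D * vertex_pb ?e (\<lambda>_. 0) (coords (Site n) x) (grad a (site_cofactor a \<nu> N n x)) (grad b (site_cofactor b \<nu> N n x)) = R n - R (n - 1)"
      unfolding R_def site_cofactor_def m diff_Suc_1 unfolding m[symmetric] U V
      by (rule site_step[OF sq])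
    moreover have "vertex_pb ?e (\<lambda>_. 0) (coords (Site n) x) X (\<lambda>\<alpha>. partial (Site n, \<alpha>) (transfer_ratio b \<nu> N) x) =
        vertex_pb ?e (\<lambda>_. 0) (coords (Site n) x) X (grad b (site_cofactor b \<nu> N n x)) / (\<Prod>n=1..N. site_det b n x)" for X
      by (rule vertex_pb_Site_transfer_ratio(1)[OF sq(2) det(2) n])
    moreover have "vertex_pb ?e (\<lambda>_. 0) (coords (Site n) x) (\<lambda>\<alpha>. partial (Site n, \<alpha>) (transfer_ratio a \<nu> N) x) X =
        vertex_pb ?e (\<lambda>_. 0) (coords (Site n) x) (grad a (site_cofactor a \<nu> N n x)) X / (\<Prod>n=1..N. site_det a n x)" for X
      by (rule vertex_pb_Site_transfer_ratio(2)[OF sq(1) det(1) n])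
    ultimately show ?thesis
      by (simp add: mult_ac)
  qed
  have "D * (4 * \<i> * vertex_pb ?e (\<nu> Minus) (coords (Bdry Minus) x) (\<lambda>\<alpha>. partial (Bdry Minus, \<alpha>) (transfer_ratio a \<nu> N) x) (\<lambda>\<alpha>. partial (Bdry Minus, \<alpha>) (transfer_ratio b \<nu> N) x))
    = R 0 / ?\<Delta>"
  proof -
    have "R 0 = 4 * \<i> * D * vertex_pb ?e (\<nu> Minus) (coords (Bdry Minus) x) (grad a (right_mat a \<nu> N 0 x)) (grad b (right_mat b \<nu> N 0 x))"
      unfolding R_def left_mat.simps by (rule reflection_form_vertex_pb[OF _ _ sq]) (use nz in auto)
    then show ?thesis
      unfolding vertex_pb_Minus_transfer_ratio by (simp add: mult_ac)
  qed
  moreover have "D * (4 * \<i> * vertex_pb ?e (\<nu> Plus) (coords (Bdry Plus) x) (\<lambda>\<alpha>. partial (Bdry Plus, \<alpha>) (transfer_ratio a \<nu> N) x) (\<lambda>\<alpha>. partial (Bdry Plus, \<alpha>) (transfer_ratio b \<nu> N) x))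
    = - R N / ?\<Delta>"
  proof -
    have "- R N = 4 * \<i> * D * vertex_pb ?e (\<nu> Plus) (coords (Bdry Plus) x) (grad a (left_mat a \<nu> N x)) (grad b (left_mat b \<nu> N x))"
      unfolding R_def right_mat_self reflection_form_swap[symmetric]
      by (rule reflection_form_vertex_pb[OF _ _ sq]) (use nz in auto)
    then show ?thesis
      unfolding vertex_pb_Plus_transfer_ratio by (simp add: mult_ac)
  qed
  moreover have "D * (\<Sum>n=1..N. 2 * \<i> * vertex_pb ?e (\<lambda>_. 0) (coords (Site n) x) (\<lambda>\<alpha>. partial (Site n, \<alpha>) (transfer_ratio a \<nu> N) x) (\<lambda>\<alpha>. partial (Site n, \<alpha>) (transfer_ratio b \<nu> N) x))
     = (R N - R 0) / ?\<Delta>"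
  proof -
    have "(\<Sum>n=1..N. R n - R (n - 1)) = R N - R 0"
      by (induction N) auto
    moreover have "(\<Sum>n=1..N. D * (2 * \<i> * vertex_pb ?e (\<lambda>_. 0) (coords (Site n) x) (\<lambda>\<alpha>. partial (Site n, \<alpha>) (transfer_ratio a \<nu> N) x) (\<lambda>\<alpha>. partial (Site n, \<alpha>) (transfer_ratio b \<nu> N) x)))
        = (\<Sum>n=1..N. (R n - R (n - 1)) / ?\<Delta>)"
      by (intro sum.cong refl site)
    ultimately show ?thesis
      unfolding sum_distrib_left sum_divide_distrib[symmetric] by simp
  qed
  ultimately have "D * poisson \<tau> \<nu> N (transfer_ratio a \<nu> N) (transfer_ratio b \<nu> N) x = 0"
    unfolding poisson_eq distrib_left by (simp add: diff_divide_distrib)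
  then show ?thesis using D by simp
qed

section \<open>Invariance under sign changes of the square roots\<close>

definition adjugate :: "cmat2 \<Rightarrow> cmat2" where
  "adjugate M = scale_mat (trace M) (mat 1) - M"

lemma adjugate_mult: "adjugate (A ** B) = adjugate B ** adjugate A"
  by (simp only: mat_eq_iff) (simp add: adjugate_def scale_mat_entry matrix_matrix_mult_def sum_2 trace_def mat_def algebra_simps)

lemma trace_adjugate: "trace (adjugate M) = trace M"
  by (simp add: adjugate_def scale_mat_entry sum_2 trace_def mat_def)

lemma adjugate_mat_of: "adjugate (pauli_mat c S) = pauli_mat c (\<lambda>\<alpha>. if \<alpha> = 0 then S 0 else - S \<alpha>)"
  by (simp only: mat_eq_iff) (simp add: pauli_mat_entries adjugate_def scale_mat_entry sum_2 trace_def mat_def)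

lemma lax_uminus: "lax (\<lambda>\<alpha>. - a \<alpha>) \<nu> S = adjugate (lax a \<nu> S)"
  unfolding lax_def adjugate_mat_of by (rule arg_cong[where f = "pauli_mat (\<lambda>_. 1)"]) auto

lemma pauli_mult_self: "k \<in> {1..3} \<Longrightarrow> pauli k ** pauli k = mat 1"
  using le3_cases[of k]
  by (auto simp: mat_eq_iff matrix_matrix_mult_def sum_2 pauli_entries mat_def)

definition flip :: "nat \<Rightarrow> (nat \<Rightarrow> complex) \<Rightarrow> nat \<Rightarrow> complex" where
  "flip k a = (\<lambda>\<alpha>. if \<alpha> = k then a \<alpha> else - a \<alpha>)"

lemma lax_flip: "k \<in> {1..3} \<Longrightarrow> lax (flip k a) \<nu> S = pauli k ** lax a \<nu> S ** pauli k"
  using le3_cases[of k]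
  by (auto simp: mat_eq_iff matrix_matrix_mult_def sum_2 pauli_entries lax_def pauli_mat_entries flip_def algebra_simps)

lemma left_mat_Suc_lax: "left_mat a \<nu> (Suc n) x =
    lax a (\<lambda>_. 0) (coords (Site (Suc n)) x) ** left_mat a \<nu> n x ** lax a (\<lambda>_. 0) (coords (Site (Suc n)) x)"
  by (simp add: lax_zero)

text \<open>Changing all signs replaces each factor by its adjugate, which keeps traces and reverses
  products. The reversal is harmless because \<open>left_mat\<close> is a palindrome around the
  boundary matrix.\<close>

lemma transfer_num_uminus: "transfer_num (\<lambda>\<alpha>. - a \<alpha>) \<nu> N x = transfer_num a \<nu> N x"
proof -
  have left: "left_mat (\<lambda>\<alpha>. - a \<alpha>) \<nu> n x = adjugate (left_mat a \<nu> n x)" for n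
  proof (induction n)
    case 0
    show ?case unfolding left_mat.simps by (rule lax_uminus)
  next
    case (Suc n)
    show ?case unfolding left_mat_Suc_lax lax_uminus adjugate_mult Suc.IH by (simp only: matrix_mul_assoc)
  qed
  have "transfer_num (\<lambda>\<alpha>. - a \<alpha>) \<nu> N x = trace (left_mat a \<nu> N x ** lax a (\<nu> Plus) (coords (Bdry Plus) x))"
    unfolding transfer_num_def right_mat_self lax_uminus left adjugate_mult[symmetric] trace_adjugate ..
  also have "\<dots> = transfer_num a \<nu> N x"
    unfolding transfer_num_def right_mat_self by (rule trace_mul_sym)
  finally show ?thesis .
qed

text \<open>Changing two of the three signs conjugates every factor by the same Pauli matrix, which
  cancels between neighbouring factors and under the trace.\<close>

lemma transfer_num_flip:
  assumes "k \<in> {1..3}"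
  shows "transfer_num (flip k a) \<nu> N x = transfer_num a \<nu> N x"
proof -
  have cancel: "M ** pauli k ** pauli k = M" for M :: cmat2
    using pauli_mult_self[OF assms] by (simp add: matrix_mul_assoc[symmetric])
  have "left_mat (flip k a) \<nu> n x = pauli k ** left_mat a \<nu> n x ** pauli k" for n
  proof (induction n)
    case (Suc n)
    then show ?case unfolding left_mat_Suc_lax lax_flip[OF assms] by (simp add: matrix_mul_assoc cancel)
  qed (simp add: lax_flip[OF assms])
  then have "transfer_num (flip k a) \<nu> N x = trace ((pauli k ** right_mat a \<nu> N N x ** left_mat a \<nu> N x) ** pauli k)"
    unfolding transfer_num_def right_mat_self lax_flip[OF assms] by (simp add: matrix_mul_assoc cancel)
  also have "\<dots> = trace (pauli k ** (pauli k ** right_mat a \<nu> N N x ** left_mat a \<nu> N x))"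
    by (rule trace_mul_sym)
  also have "\<dots> = transfer_num a \<nu> N x"
    using pauli_mult_self[OF assms] by (simp add: transfer_num_def matrix_mul_assoc)
  finally show ?thesis .
qed

lemma transfer_num_cong:
  assumes "\<And>\<alpha>. \<alpha> \<in> {1..3} \<Longrightarrow> a \<alpha> = a' \<alpha>"
  shows "transfer_num a \<nu> N x = transfer_num a' \<nu> N x"
proof -
  have lax: "lax a \<nu> S = lax a' \<nu> S" for \<nu> S
    by (simp add: lax_def mat_eq_iff pauli_mat_entries assms)
  have "left_mat a \<nu> n x = left_mat a' \<nu> n x" for n
  proof (induction n)
    case (Suc n)
    then show ?case unfolding left_mat_Suc_lax lax by simp
  qed (simp add: lax)
  then show ?thesis unfolding transfer_num_def right_mat_self lax by simp
qed

text \<open>The total sign change and the three double sign changes generate all eight sign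
  patterns. The determinants contain only squares.\<close>

lemma transfer_ratio_sign:
  assumes "\<And>\<alpha>. \<alpha> \<in> {1..3} \<Longrightarrow> (b \<alpha>)\<^sup>2 = (a \<alpha>)\<^sup>2"
  shows "transfer_ratio b \<nu> N x = transfer_ratio a \<nu> N x"
proof -
  have eq: "b 1 = a 1 \<or> b 1 = - a 1" "b 2 = a 2 \<or> b 2 = - a 2" "b 3 = a 3 \<or> b 3 = - a 3"
    using assms by (simp_all add: power2_eq_iff)
  define n where "n = (\<lambda>c (\<alpha>::nat). - (c \<alpha>) :: complex)"
  have transfer_num_n: "transfer_num (n c) \<nu> N x = transfer_num c \<nu> N x" for c unfolding n_def by (rule transfer_num_uminus)
  have *: "transfer_num b \<nu> N x = transfer_num a \<nu> N x"
    if "b 1 = c 1" "b 2 = c 2" "b 3 = c 3" "transfer_num c \<nu> N x = transfer_num a \<nu> N x" for c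
  proof -
    have "transfer_num b \<nu> N x = transfer_num c \<nu> N x"
    proof (rule transfer_num_cong)
      fix \<alpha> :: nat assume "\<alpha> \<in> {1..3}"
      then have "\<alpha> = 1 \<or> \<alpha> = 2 \<or> \<alpha> = 3" by auto
      then show "b \<alpha> = c \<alpha>" using that by auto
    qed
    then show ?thesis using that by simp
  qed
  have flip: "transfer_num (flip k a) \<nu> N x = transfer_num a \<nu> N x" if "k \<in> {1, 2, 3}" for k
    by (rule transfer_num_flip) (use that in auto)
  have nflip: "transfer_num (n (flip k a)) \<nu> N x = transfer_num a \<nu> N x" if "k \<in> {1, 2, 3}" for k
    using flip[OF that] transfer_num_n by simp
  have "transfer_num b \<nu> N x = transfer_num a \<nu> N x"
    using eq
  proof (elim disjE)
    assume "b 1 = a 1" "b 2 = a 2" "b 3 = a 3"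
    then show ?thesis by (intro *[of a]) auto
  next
    assume "b 1 = a 1" "b 2 = a 2" "b 3 = - a 3"
    then show ?thesis by (intro *[OF _ _ _ nflip[of 3]]) (auto simp: n_def flip_def)
  next
    assume "b 1 = a 1" "b 2 = - a 2" "b 3 = a 3"
    then show ?thesis by (intro *[OF _ _ _ nflip[of 2]]) (auto simp: n_def flip_def)
  next
    assume "b 1 = a 1" "b 2 = - a 2" "b 3 = - a 3"
    then show ?thesis by (intro *[OF _ _ _ flip[of 1]]) (auto simp: n_def flip_def)
  next
    assume "b 1 = - a 1" "b 2 = a 2" "b 3 = a 3"
    then show ?thesis by (intro *[OF _ _ _ nflip[of 1]]) (auto simp: n_def flip_def)
  next
    assume "b 1 = - a 1" "b 2 = a 2" "b 3 = - a 3"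
    then show ?thesis by (intro *[OF _ _ _ flip[of 2]]) (auto simp: n_def flip_def)
  next
    assume "b 1 = - a 1" "b 2 = - a 2" "b 3 = a 3"
    then show ?thesis by (intro *[OF _ _ _ flip[of 3]]) (auto simp: n_def flip_def)
  next
    assume "b 1 = - a 1" "b 2 = - a 2" "b 3 = - a 3"
    then show ?thesis by (intro *[OF _ _ _ transfer_num_n]) (auto simp: n_def)
  qed
  then show ?thesis
    by (simp add: transfer_ratio_def site_det_def assms)
qed

lemma poisson_cong:
  assumes "\<And>v \<alpha>. \<alpha> \<in> {0..3} \<Longrightarrow> partial (v, \<alpha>) F x = partial (v, \<alpha>) F' x"
    "\<And>v \<alpha>. \<alpha> \<in> {0..3} \<Longrightarrow> partial (v, \<alpha>) G x = partial (v, \<alpha>) G' x"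
  shows "poisson \<tau> \<nu> N F G x = poisson \<tau> \<nu> N F' G' x"
  unfolding poisson_def by (intro sum.cong refl) (auto simp: assms)

lemma poisson_transfer_ratio:
  fixes a b :: "nat \<Rightarrow> complex" and c D :: complex
  assumes sq: "\<And>\<alpha>. \<alpha> \<in> {1..3} \<Longrightarrow> (a \<alpha>)\<^sup>2 = c - half_period_E2 \<tau> \<alpha>"
      "\<And>\<alpha>. \<alpha> \<in> {1..3} \<Longrightarrow> (b \<alpha>)\<^sup>2 = c + D - half_period_E2 \<tau> \<alpha>"
    and nz: "\<And>\<alpha>. \<alpha> \<in> {1..3} \<Longrightarrow> a \<alpha> \<noteq> 0" "\<And>\<alpha>. \<alpha> \<in> {1..3} \<Longrightarrow> b \<alpha> \<noteq> 0"
    and det: "\<And>n. n \<in> {1..N} \<Longrightarrow> site_det a n x \<noteq> 0" "\<And>n. n \<in> {1..N} \<Longrightarrow> site_det b n x \<noteq> 0"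
  shows "poisson \<tau> \<nu> N (transfer_ratio a \<nu> N) (transfer_ratio b \<nu> N) x = 0"
proof (cases "D = 0")
  case True
  \<comment> \<open>Here \<open>a\<close> and \<open>b\<close> have equal squares, so both arguments
    of the bracket are the same function and antisymmetry suffices.\<close>
  then have "transfer_ratio b \<nu> N = transfer_ratio a \<nu> N"
    using sq by (intro ext transfer_ratio_sign) simp
  then show ?thesis
    by (simp add: poisson_eq vertex_pb_self)
next
  case False
  from poisson_transfer_ratio_zero[OF sq nz det False] show ?thesis .
qed

section \<open>Singular Lax matrices\<close>

definition dot :: "(nat \<Rightarrow> complex) \<Rightarrow> (nat \<Rightarrow> complex) \<Rightarrow> complex" where
  "dot k S = k 0 * S 0 + (\<Sum>\<alpha>=1..3. k \<alpha> * S \<alpha>)"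

text \<open>Undoes the rescaling: for nonzero \<open>a \<alpha>\<close>, its product with
  \<open>pauli_mat a S\<close> has trace \<open>2 * dot k S\<close>, so \<open>dot\<close> is the
  root-free form of the traces that become the arguments of the logarithms.\<close>

definition unscaled_mat :: "(nat \<Rightarrow> complex) \<Rightarrow> (nat \<Rightarrow> complex) \<Rightarrow> cmat2" where
  "unscaled_mat a k = pauli_mat (\<lambda>_. 1) (\<lambda>\<alpha>. if \<alpha> = 0 then k 0 else k \<alpha> / a \<alpha>)"

text \<open>The first identity is Cayley-Hamilton for A L with one factor A removed. The second
  exchanges the roles of A and L and polarises in A, where det A polarises to tr(B adj A).\<close>

lemma adjugate_identities:
  "L ** A ** L = scale_mat (trace (A ** L)) L - scale_mat (det L) (adjugate A)"
  "A ** L ** B + B ** L ** A = scale_mat (trace (B ** L)) A + scale_mat (trace (A ** L)) B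
     - scale_mat (trace (B ** adjugate A)) (adjugate L)"
  by (simp_all only: mat_eq_iff)
    (simp_all add: adjugate_def scale_mat_entry matrix_matrix_mult_def sum_2 trace_def mat_def det_2 algebra_simps)

lemma reflection_form_scale:
  "reflection_form a b (scale_mat c U) X U' Y = c * reflection_form a b U X U' Y"
  "reflection_form a b U (scale_mat c X) U' Y = c * reflection_form a b U X U' Y"
  by (simp_all add: reflection_form_def exch_minus_def exch_plus_def cyc_def tr_right_def tr_left_def scale_mat_simps algebra_simps)

lemma trace_diff_scale: "trace (X ** (scale_mat c A + scale_mat d B - scale_mat f E)) =
    c * trace (X ** A) + d * trace (X ** B) - f * trace (X ** E)"
  by (simp add: trace_def matrix_matrix_mult_def sum_2 scale_mat_entry algebra_simps)

text \<open>Root-free form of \<open>site_step\<close> in which the matrices of the \<open>a\<close>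
  slot are the two neighbours \<open>unscaled_mat a k\<close> and \<open>unscaled_mat a l\<close>.
  Its vanishing is the local identity behind the telescoping of {H, h(w)}.\<close>

definition defect where
  "defect b e D c S k l U V =
     D * (dot l S * vertex_pb e (\<lambda>_. 0) S k (grad b (U ** pauli_mat b S ** V + V ** pauli_mat b S ** U))
        + dot k S * vertex_pb e (\<lambda>_. 0) S l (grad b (U ** pauli_mat b S ** V + V ** pauli_mat b S ** U)))
   + dot k S * refl_vec b (scaled_vec (\<lambda>\<alpha>. c - e \<alpha>) (\<lambda>_. 0) S) l (pauli_mat b S ** U ** pauli_mat b S) V
   - dot l S * refl_vec b k (scaled_vec (\<lambda>\<alpha>. c - e \<alpha>) (\<lambda>_. 0) S) U (pauli_mat b S ** V ** pauli_mat b S)"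

text \<open>The hypothesis on \<open>S\<close> says that L is singular at the roots
  \<open>a \<alpha>\<close>. Then L A L is a multiple of L, so \<open>site_step\<close> collapses to
  8i times the defect.\<close>

lemma defect_zero_generic:
  assumes sq: "\<And>\<alpha>. \<alpha> \<in> {1..3} \<Longrightarrow> (b \<alpha>)\<^sup>2 = c + D - e \<alpha>"
    and d: "\<And>\<alpha>. \<alpha> \<in> {1..3} \<Longrightarrow> c - e \<alpha> \<noteq> 0"
    and S: "(S 0)\<^sup>2 = (\<Sum>\<alpha>=1..3. (S \<alpha>)\<^sup>2 * (c - e \<alpha>))"
  shows "defect b e D c S k l U V = 0"
proof -
  define a where "a \<alpha> = csqrt (c - e \<alpha>)" for \<alpha>
  have a: "(a \<alpha>)\<^sup>2 = c - e \<alpha>" for \<alpha> by (simp add: a_def)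
  have a0: "a \<alpha> \<noteq> 0" if "\<alpha> \<in> {1..3}" for \<alpha>
    using d[OF that] by (simp add: a_def)
  let ?L = "pauli_mat a S" and ?L' = "pauli_mat b S" and ?A = "unscaled_mat a k" and ?B = "unscaled_mat a l"
  let ?s = "scaled_vec (\<lambda>\<alpha>. c - e \<alpha>) (\<lambda>_. 0) S"
  let ?g = "grad b (U ** ?L' ** V + V ** ?L' ** U)"
  have det: "det ?L = 0"
    using S by (simp add: det_2 pauli_mat_entries sum13 power2_eq_square[symmetric] a[symmetric])
      (simp add: power2_eq_square algebra_simps)
  have tr: "trace (unscaled_mat a k ** ?L) = 2 * dot k S" for k
    using a0 by (simp add: unscaled_mat_def trace_def matrix_matrix_mult_def sum_2 pauli_mat_entries dot_def sum13 algebra_simps)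
  have LML: "?L ** unscaled_mat a k ** ?L = scale_mat (2 * dot k S) ?L" for k
    unfolding adjugate_identities(1)[of ?L] det tr by (simp add: mat_eq_iff scale_mat_entry)
  have grad: "grad a (unscaled_mat a k) \<alpha> = 2 * k \<alpha>" if "\<alpha> \<in> {0..3}" for k \<alpha>
    using le3_cases[OF that] a0 by (auto simp: unscaled_mat_def grad_eq)
  \<comment> \<open>The adjugate term of the polarised identity is the gradient of det L, so it does
    not contribute to the bracket.\<close>
  have grad_adjugate: "grad a (adjugate ?L) \<alpha> = det_grad a S \<alpha>" if "\<alpha> \<in> {0..3}" for \<alpha>
    using le3_cases[OF that]
    by (auto simp: grad_def adjugate_def det_grad_def trace_def matrix_matrix_mult_def sum_2 pauli_mat_entries
      pauli_entries scale_mat_entry mat_def power2_eq_square algebra_simps)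
  define t where "t = trace (?B ** adjugate ?A)"
  have "vertex_pb e (\<lambda>_. 0) S (grad a (?A ** ?L ** ?B + ?B ** ?L ** ?A)) ?g =
     vertex_pb e (\<lambda>_. 0) S (\<lambda>\<alpha>. 1 * (4 * dot l S * k \<alpha> + 4 * dot k S * l \<alpha>) + - t * det_grad a S \<alpha>) ?g"
  proof (rule vertex_pb_cong[OF _ refl])
    fix \<alpha> :: nat assume \<alpha>: "\<alpha> \<in> {0..3}"
    show "grad a (?A ** ?L ** ?B + ?B ** ?L ** ?A) \<alpha> = 1 * (4 * dot l S * k \<alpha> + 4 * dot k S * l \<alpha>) + - t * det_grad a S \<alpha>"
      unfolding adjugate_identities(2)[of ?A] tr trace_unit_mat[symmetric] trace_diff_scale t_def[symmetric]
      unfolding trace_unit_mat grad[OF \<alpha>] grad_adjugate[OF \<alpha>] by simp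
  qed
  also have "\<dots> = 4 * (dot l S * vertex_pb e (\<lambda>_. 0) S k ?g + dot k S * vertex_pb e (\<lambda>_. 0) S l ?g)"
    unfolding vertex_pb_linear using vertex_pb_det_grad(1)[of a c e] a by (simp add: algebra_simps)
  finally have lhs: "vertex_pb e (\<lambda>_. 0) S (grad a (?A ** ?L ** ?B + ?B ** ?L ** ?A)) ?g =
     4 * (dot l S * vertex_pb e (\<lambda>_. 0) S k ?g + dot k S * vertex_pb e (\<lambda>_. 0) S l ?g)" .
  have L: "?L = unscaled_mat a ?s"
  proof -
    have "S \<alpha> * (c - e \<alpha>) / a \<alpha> = S \<alpha> * a \<alpha>" if "\<alpha> \<in> {1..3}" for \<alpha>
      using a0[OF that] unfolding a[symmetric] by (simp add: power2_eq_square)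
    then show ?thesis by (simp add: mat_eq_iff pauli_mat_entries unscaled_mat_def scaled_vec_def)
  qed
  have refl: "reflection_form a b (unscaled_mat a k) (unscaled_mat a l) U' Y = - 4 * \<i> * refl_vec b k l U' Y" for k l U' Y
    unfolding unscaled_mat_def by (rule refl_eq_refl_vec) (use a0 in auto)
  have "2 * \<i> * D * vertex_pb e (\<lambda>_. 0) S (grad a (?A ** ?L ** ?B + ?B ** ?L ** ?A)) ?g =
     reflection_form a b (?L ** ?A ** ?L) ?B (?L' ** U ** ?L') V - reflection_form a b ?A (?L ** ?B ** ?L) U (?L' ** V ** ?L')"
    by (rule site_step[OF a sq])
  also have "\<dots> =
    2 * dot k S * (- 4 * \<i> * refl_vec b ?s l (?L' ** U ** ?L') V) - 2 * dot l S * (- 4 * \<i> * refl_vec b k ?s U (?L' ** V ** ?L'))"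
    unfolding LML reflection_form_scale unfolding L refl by simp
  finally have "8 * \<i> * defect b e D c S k l U V = 0"
    unfolding lhs defect_def by (simp add: algebra_simps)
  then show ?thesis by simp
qed

section \<open>The degenerate case by continuity\<close>

lemma tendsto_matrix_mult:
  fixes f g :: "'a \<Rightarrow> cmat2"
  assumes "(f \<longlongrightarrow> A) F" "(g \<longlongrightarrow> B) F"
  shows "((\<lambda>s. f s ** g s) \<longlongrightarrow> A ** B) F"
  unfolding matrix_matrix_mult_def
  by (intro vec_tendstoI) (auto intro!: tendsto_intros assms)

lemma tendsto_trace:
  fixes f :: "'a \<Rightarrow> cmat2"
  assumes "(f \<longlongrightarrow> A) F"
  shows "((\<lambda>s. trace (f s)) \<longlongrightarrow> trace A) F"
  unfolding trace_def by (auto intro!: tendsto_intros assms)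

lemma tendsto_mat_of:
  assumes "\<And>\<alpha>. ((\<lambda>s. f s \<alpha>) \<longlongrightarrow> S \<alpha>) F"
  shows "((\<lambda>s. pauli_mat b (f s)) \<longlongrightarrow> pauli_mat b S) F"
proof (intro vec_tendstoI)
  fix i j :: 2
  show "((\<lambda>s. pauli_mat b (f s) $ i $ j) \<longlongrightarrow> pauli_mat b S $ i $ j) F"
    using exhaust_2[of i] exhaust_2[of j]
    by (auto simp: pauli_mat_entries intro!: tendsto_add tendsto_diff tendsto_mult tendsto_const assms)
qed

lemma tendsto_grad:
  assumes "(f \<longlongrightarrow> A) F"
  shows "((\<lambda>s. grad b (f s) \<alpha>) \<longlongrightarrow> grad b A \<alpha>) F"
  unfolding grad_def by (auto intro!: tendsto_intros tendsto_trace tendsto_matrix_mult assms)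

lemma tendsto_defect:
  assumes S: "\<And>\<alpha>. ((\<lambda>s. f s \<alpha>) \<longlongrightarrow> S \<alpha>) F" and D: "(g \<longlongrightarrow> D) F" and c: "(h \<longlongrightarrow> c) F"
  shows "((\<lambda>s. defect b e (g s) (h s) (f s) k l U V) \<longlongrightarrow> defect b e D c S k l U V) F"
proof -
  have sv: "((\<lambda>s. scaled_vec (\<lambda>\<alpha>. h s - e \<alpha>) (\<lambda>_. 0) (f s) \<alpha>) \<longlongrightarrow> scaled_vec (\<lambda>\<alpha>. c - e \<alpha>) (\<lambda>_. 0) S \<alpha>) F" for \<alpha>
    by (auto simp: scaled_vec_def intro!: tendsto_intros S c)
  show ?thesis
    unfolding defect_def dot_def vertex_pb_def cyc_def refl_vec_def cross_def symm_def tr_right_def tr_left_def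
    by (intro tendsto_intros S D sv tendsto_trace tendsto_matrix_mult tendsto_grad tendsto_mat_of)
qed

text \<open>If some \<open>c - e \<alpha>\<close> vanishes, the matrices of the generic case degenerate. The defect is
  polynomial, so its vanishing survives as a limit along a curve on the quadric of singular matrices.\<close>
lemma defect_zero:
  assumes sq: "\<And>\<alpha>. \<alpha> \<in> {1..3} \<Longrightarrow> (b \<alpha>)\<^sup>2 = c + D - e \<alpha>"
    and S: "(S 0)\<^sup>2 = (\<Sum>\<alpha>=1..3. (S \<alpha>)\<^sup>2 * (c - e \<alpha>))"
  shows "defect b e D c S k l U V = 0"
proof -
  define q where "q = (\<Sum>\<alpha>=1..3. (S \<alpha>)\<^sup>2)"
  \<comment> \<open>Replacing \<open>c\<close> by \<open>c + s\<^sup>2\<close> keeps the matrix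
    singular exactly when the square of the zeroth coordinate becomes (S 0)^2 + s^2 q. The two cases
    give a square root of this that tends to \<open>S 0\<close>: near 1 the principal root is
    continuous, and for \<open>S 0 = 0\<close> the root is linear in \<open>s\<close>.\<close>
  define S0 where "S0 s = (if S 0 = 0 then s * csqrt q else S 0 * csqrt (1 + s\<^sup>2 * q / (S 0)\<^sup>2))" for s
  have S0_sq: "(S0 s)\<^sup>2 = (S 0)\<^sup>2 + s\<^sup>2 * q" for s
    by (auto simp: S0_def power_mult_distrib field_simps)
  have S0_tendsto: "(S0 \<longlongrightarrow> S 0) (at 0)"
  proof (cases "S 0 = 0")
    case True
    have "((\<lambda>s. s * csqrt q) \<longlongrightarrow> 0 * csqrt q) (at 0)" by (intro tendsto_intros)
    then show ?thesis using True by (simp add: S0_def[abs_def])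
  next
    case False
    have "((\<lambda>s. 1 + s\<^sup>2 * q / (S 0)\<^sup>2) \<longlongrightarrow> 1 + 0\<^sup>2 * q / (S 0)\<^sup>2) (at 0)"
      by (intro tendsto_intros) (use False in simp)
    then have "((\<lambda>s. csqrt (1 + s\<^sup>2 * q / (S 0)\<^sup>2)) \<longlongrightarrow> csqrt 1) (at 0)"
      by (intro isCont_tendsto_compose[OF continuous_at_csqrt]) auto
    then have "((\<lambda>s. S 0 * csqrt (1 + s\<^sup>2 * q / (S 0)\<^sup>2)) \<longlongrightarrow> S 0 * csqrt 1) (at 0)"
      by (intro tendsto_intros)
    then show ?thesis using False by (simp add: S0_def[abs_def])
  qed
  let ?f = "\<lambda>s. S(0 := S0 s)"
  \<comment> \<open>Lowering \<open>D\<close> by \<open>s\<^sup>2\<close> keeps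
    \<open>c + D\<close>, so the same \<open>b\<close> satisfies the hypotheses along the whole
    curve.\<close>
  have "((\<lambda>s. defect b e (D - s\<^sup>2) (c + s\<^sup>2) (?f s) k l U V) \<longlongrightarrow> defect b e D c S k l U V) (at 0)"
  proof (rule tendsto_defect)
    show "((\<lambda>s. ?f s \<alpha>) \<longlongrightarrow> S \<alpha>) (at 0)" for \<alpha>
      using S0_tendsto by (cases "\<alpha> = 0") auto
    have "((\<lambda>s. D - s\<^sup>2) \<longlongrightarrow> D - 0\<^sup>2) (at 0)" "((\<lambda>s. c + s\<^sup>2) \<longlongrightarrow> c + 0\<^sup>2) (at (0::complex))"
      by (intro tendsto_intros)+
    then show "((\<lambda>s. D - s\<^sup>2) \<longlongrightarrow> D) (at 0)" "((\<lambda>s. c + s\<^sup>2) \<longlongrightarrow> c) (at (0::complex))" by simp_all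
  qed
  moreover have ev: "\<forall>\<^sub>F s in at 0. defect b e (D - s\<^sup>2) (c + s\<^sup>2) (?f s) k l U V = 0"
  proof -
    have "\<forall>\<^sub>F s in at 0. c + s\<^sup>2 - e \<alpha> \<noteq> 0" for \<alpha>
    proof (cases "c - e \<alpha> = 0")
      case True
      then have "c + s\<^sup>2 - e \<alpha> = s\<^sup>2" for s by (simp add: algebra_simps)
      then show ?thesis by (simp add: eventually_neq_at_within)
    next
      case False
      have "((\<lambda>s. c + s\<^sup>2 - e \<alpha>) \<longlongrightarrow> c + 0\<^sup>2 - e \<alpha>) (at (0::complex))" by (intro tendsto_intros)
      then show ?thesis by (rule tendsto_imp_eventually_ne) (use False in simp)
    qed
    then have "\<forall>\<^sub>F s in at 0. \<forall>\<alpha>\<in>{1..3}. c + s\<^sup>2 - e \<alpha> \<noteq> 0"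
      by (intro eventually_ball_finite) auto
    then show ?thesis
    proof eventually_elim
      case (elim s)
      show ?case
      proof (rule defect_zero_generic)
        show "(b \<alpha>)\<^sup>2 = c + s\<^sup>2 + (D - s\<^sup>2) - e \<alpha>" if "\<alpha> \<in> {1..3}" for \<alpha>
          using sq[OF that] by simp
        show "(?f s 0)\<^sup>2 = (\<Sum>\<alpha>=1..3. (?f s \<alpha>)\<^sup>2 * (c + s\<^sup>2 - e \<alpha>))"
          by (simp add: S0_sq S q_def sum13 algebra_simps)
      qed (use elim in auto)
    qed
  qed
  ultimately show ?thesis
    by (intro tendsto_unique[OF _ _ tendsto_eventually[OF ev]]) auto
qed

section \<open>The nearest-neighbour Hamiltonian\<close>

lemma ln_branch_has_field_derivative:
  assumes "ln_branch_at a l"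
  shows "(l has_field_derivative 1 / a) (at a)"
proof -
  obtain U where U: "open U" "a \<in> U" "l holomorphic_on U" "\<And>u. u \<in> U \<Longrightarrow> exp (l u) = u"
    using assms by (auto simp: ln_branch_at_def)
  have l: "(l has_field_derivative deriv l a) (at a)"
    by (rule holomorphic_derivI[OF U(3,1,2)])
  have "((\<lambda>u. exp (l u)) has_field_derivative exp (l a) * deriv l a) (at a)"
    by (rule DERIV_chain2[OF DERIV_exp l])
  then have "((\<lambda>u. u) has_field_derivative exp (l a) * deriv l a) (at a)"
    by (rule DERIV_cong_ev[THEN iffD1, rotated -1])
      (use U eventually_nhds_in_open[OF U(1,2)] in \<open>auto elim!: eventually_mono\<close>)
  then have "exp (l a) * deriv l a = 1"
    using DERIV_unique DERIV_ident by blast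
  then have "deriv l a = 1 / a" using U(2,4) by (simp add: field_simps) (metis mult_zero_left zero_neq_one nonzero_eq_divide_eq mult.commute)
  then show ?thesis using l by simp
qed

lemma dot_upd:
  assumes "\<alpha> \<in> {0..3}"
  shows "dot k (S(\<alpha> := t)) = dot k S + (t - S \<alpha>) * k \<alpha>"
  using le3_cases[OF assms] by (auto simp: dot_def sum13 algebra_simps)

lemma dot_scaled_vec_upd:
  assumes "\<alpha> \<in> {0..3}"
  shows "dot (scaled_vec d \<nu> (S(\<alpha> := t))) S' = dot (scaled_vec d \<nu> S) S' + (t - S \<alpha>) * scaled_vec d (\<lambda>_. 0) S' \<alpha>"
  using le3_cases[OF assms] by (auto simp: dot_def scaled_vec_def sum13 algebra_simps)

lemma dot_scaled_vec_commute: "dot (scaled_vec d (\<lambda>_. 0) S) S' = dot (scaled_vec d (\<lambda>_. 0) S') S"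
  by (simp add: dot_def scaled_vec_def sum13 algebra_simps)

lemma refl_vec_swap: "refl_vec b l k Y U = - refl_vec b k l U Y"
  unfolding refl_vec_def cyc_def cross_def symm_def tr_swap[of _ Y U] by (simp add: algebra_simps)

section \<open>The chain as a path of N + 2 vertices\<close>

context
  fixes C \<tau> :: complex and \<nu> :: "boundary \<Rightarrow> nat \<Rightarrow> complex" and N :: nat
begin

text \<open>The vertices are numbered along the chain, with \<open>Minus\<close> at 0 and
  \<open>Plus\<close> at N + 1. The vectors are the rescaled components at the parameter where E2 =
  C.\<close>

definition vertex_vec :: "nat \<Rightarrow> point \<Rightarrow> nat \<Rightarrow> complex" where
  "vertex_vec n x = (let d = \<lambda>\<alpha>. C - half_period_E2 \<tau> \<alpha> in
     if n = 0 then scaled_vec d (\<nu> Minus) (coords (Bdry Minus) x)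
     else if n \<le> N then scaled_vec d (\<lambda>_. 0) (coords (Site n) x)
     else scaled_vec d (\<nu> Plus) (coords (Bdry Plus) x))"

text \<open>The argument of the logarithm between vertices n and n + 1. It pairs a rescaled vector
  with plain coordinates, and the plain ones must belong to a site, because a boundary brings in
  \<nu> through its rescaled vector. Hence the last edge is written the other way round.\<close>

definition edge :: "nat \<Rightarrow> point \<Rightarrow> complex" where
  "edge n x = (if n < N then dot (vertex_vec n x) (coords (Site (Suc n)) x)
     else dot (vertex_vec (Suc n) x) (coords (Site n) x))"

lemma vertex_vec_eqs:
  "vertex_vec 0 x = scaled_vec (\<lambda>\<alpha>. C - half_period_E2 \<tau> \<alpha>) (\<nu> Minus) (coords (Bdry Minus) x)"
  "n \<in> {1..N} \<Longrightarrow> vertex_vec n x = scaled_vec (\<lambda>\<alpha>. C - half_period_E2 \<tau> \<alpha>) (\<lambda>_. 0) (coords (Site n) x)"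
  "vertex_vec (Suc N) x = scaled_vec (\<lambda>\<alpha>. C - half_period_E2 \<tau> \<alpha>) (\<nu> Plus) (coords (Bdry Plus) x)"
  by (auto simp: vertex_vec_def Let_def)

lemma edge_left: "n < N \<Longrightarrow> edge n x = dot (vertex_vec n x) (coords (Site (Suc n)) x)"
  by (simp add: edge_def)

lemma edge_right:
  assumes "n \<in> {1..N}"
  shows "edge n x = dot (vertex_vec (Suc n) x) (coords (Site n) x)"
proof (cases "n < N")
  case True
  then have "vertex_vec n x = scaled_vec (\<lambda>\<alpha>. C - half_period_E2 \<tau> \<alpha>) (\<lambda>_. 0) (coords (Site n) x)"
     "vertex_vec (Suc n) x = scaled_vec (\<lambda>\<alpha>. C - half_period_E2 \<tau> \<alpha>) (\<lambda>_. 0) (coords (Site (Suc n)) x)"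
    using assms by (intro vertex_vec_eqs; simp)+
  then show ?thesis unfolding edge_left[OF True] by (simp only: dot_scaled_vec_commute)
qed (simp add: edge_def)

lemma boundary_arg_edge:
  assumes "N \<ge> 1"
  shows "boundary_arg \<tau> \<nu> C Minus 1 x = edge 0 x" "boundary_arg \<tau> \<nu> C Plus N x = edge N x"
proof -
  show "boundary_arg \<tau> \<nu> C Minus 1 x = edge 0 x"
    using assms by (simp add: edge_left vertex_vec_eqs boundary_arg_def dot_def scaled_vec_def sum13 coords_def half_period_E2_def
       One_nat_def[symmetric] algebra_simps)
  show "boundary_arg \<tau> \<nu> C Plus N x = edge N x"
    using assms by (simp add: edge_right vertex_vec_eqs boundary_arg_def dot_def scaled_vec_def sum13 coords_def half_period_E2_def algebra_simps)
qed

lemma bulk_arg_edge: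
  assumes "n \<in> {1..<N}"
  shows "bulk_arg \<tau> C n x = edge n x"
  using assms unfolding bulk_arg_def Suc_eq_plus1[symmetric]
  by (simp add: edge_left vertex_vec_eqs dot_def scaled_vec_def sum13 coords_def half_period_E2_def algebra_simps)

lemma Hamiltonian_eq:
  assumes "N \<ge> 1"
  shows "Hamiltonian \<tau> \<nu> N C lm lp lb x = (\<Sum>n\<in>{0..N}. (if n = 0 then lm else if n = N then lp else lb n) (edge n x))"
proof -
  have "{0..N} = insert 0 (insert N {1..<N})" using assms by auto
  moreover have "(\<Sum>n\<in>{1..<N}. (if n = 0 then lm else if n = N then lp else lb n) (edge n x)) = (\<Sum>n\<in>{1..<N}. lb n (bulk_arg \<tau> C n x))"
    by (intro sum.cong) (auto simp: bulk_arg_edge)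
  ultimately show ?thesis
    using assms unfolding Hamiltonian_def boundary_arg_edge[OF assms] by simp
qed

text \<open>An edge is affine in the coordinates of each of its ends. Its gradient at one end is the
  rescaled vector of the other end.\<close>

fun edge_grad :: "nat \<Rightarrow> vertex \<Rightarrow> point \<Rightarrow> nat \<Rightarrow> complex" where
  "edge_grad n (Bdry Minus) x = (if n = 0 then vertex_vec 1 x else (\<lambda>_. 0))"
| "edge_grad n (Bdry Plus) x = (if n = N then vertex_vec N x else (\<lambda>_. 0))"
| "edge_grad n (Site m) x = (if Suc n = m then vertex_vec n x else if n = m then vertex_vec (Suc m) x else (\<lambda>_. 0))"

lemma vertex_vec_upd:
  assumes "v \<noteq> (if n = 0 then Bdry Minus else if n \<le> N then Site n else Bdry Plus)"
  shows "vertex_vec n (x((v, \<alpha>) := t)) = vertex_vec n x"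
  using assms unfolding vertex_vec_def Let_def
  by (cases "n = 0"; cases "n \<le> N") (simp_all only: coords_upd_other if_True if_False not_False_eq_True simp_thms)

lemma edge_upd:
  assumes \<alpha>: "\<alpha> \<in> {0..3}" and n: "n \<le> N" and N: "N \<ge> 1" and v: "v \<in> vertices N"
  shows "edge n (x((v, \<alpha>) := t)) = edge n x + (t - x (v, \<alpha>)) * edge_grad n v x \<alpha>"
proof -
  consider "v = Bdry Minus" | "v = Bdry Plus" | m where "v = Site m" "m \<in> {1..N}"
    using v unfolding vertices_def range_Bdry by auto
  then show ?thesis
  proof cases
    case 1
    show ?thesis
    proof (cases "n = 0")
      case True
      then show ?thesis
        using N unfolding 1 True edge_left[OF less_le_trans[OF zero_less_one N]] vertex_vec_eqs
        by (simp add: coords_upd_same coords_upd_other dot_scaled_vec_upd[OF \<alpha>] vertex_vec_eqs coords_def[of "Bdry Minus"] One_nat_def[symmetric])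
    next
      case False
      then have "n \<in> {1..N}" using n by auto
      then show ?thesis
        unfolding edge_right[OF \<open>n \<in> {1..N}\<close>] 1
        by (subst vertex_vec_upd) (use False n in \<open>auto simp: coords_upd_other\<close>)
    qed
  next
    case 2
    show ?thesis
    proof (cases "n = N")
      case True
      have "N \<in> {1..N}" using N by auto
      then show ?thesis
        unfolding 2 True edge_right[OF \<open>N \<in> {1..N}\<close>] vertex_vec_eqs(3)
        by (simp add: coords_upd_same coords_upd_other dot_scaled_vec_upd[OF \<alpha>] vertex_vec_eqs coords_def[of "Bdry Plus"])
    next
      case False
      then have "n < N" using n by simp
      then show ?thesis
        unfolding edge_left[OF \<open>n < N\<close>] 2
        by (subst vertex_vec_upd) (use False n in \<open>auto simp: coords_upd_other\<close>)
    qed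
  next
    case (3 m)
    consider "Suc n = m" | "n = m" | "Suc n \<noteq> m" "n \<noteq> m" by blast
    then show ?thesis
    proof cases
      case a: 1
      then have "n < N" using 3 by auto
      have "vertex_vec n (x((v, \<alpha>) := t)) = vertex_vec n x" by (rule vertex_vec_upd) (use a 3 in auto)
      then show ?thesis
        unfolding edge_left[OF \<open>n < N\<close>] using a 3
        by (simp add: coords_upd_same dot_upd[OF \<alpha>] coords_def[of "Site m"])
    next
      case b: 2
      then have "n \<in> {1..N}" using 3 by auto
      have "vertex_vec (Suc n) (x((v, \<alpha>) := t)) = vertex_vec (Suc n) x" by (rule vertex_vec_upd) (use b 3 in auto)
      then show ?thesis
        unfolding edge_right[OF \<open>n \<in> {1..N}\<close>] using b 3
        by (simp add: coords_upd_same dot_upd[OF \<alpha>] coords_def[of "Site m"])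
    next
      case c: 3
      show ?thesis
      proof (cases "n < N")
        case True
        have "vertex_vec n (x((v, \<alpha>) := t)) = vertex_vec n x" by (rule vertex_vec_upd) (use c 3 in auto)
        then show ?thesis
          unfolding edge_left[OF True] using c 3 by (auto simp: coords_upd_other)
      next
        case False
        then have "n \<in> {1..N}" using n N by auto
        have "vertex_vec (Suc n) (x((v, \<alpha>) := t)) = vertex_vec (Suc n) x" by (rule vertex_vec_upd) (use c 3 False in auto)
        then show ?thesis
          unfolding edge_right[OF \<open>n \<in> {1..N}\<close>] using c 3 by (auto simp: coords_upd_other)
      qed
    qed
  qed
qed

lemma partial_Hamiltonian:
  assumes N: "N \<ge> 1" and \<alpha>: "\<alpha> \<in> {0..3}" and v: "v \<in> vertices N"
    and l: "ln_branch_at (edge 0 x) lm" "ln_branch_at (edge N x) lp" "\<And>n. n \<in> {1..<N} \<Longrightarrow> ln_branch_at (edge n x) (lb n)"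
  shows "partial (v, \<alpha>) (Hamiltonian \<tau> \<nu> N C lm lp lb) x = (\<Sum>n\<in>{0..N}. edge_grad n v x \<alpha> / edge n x)"
proof -
  define l where "l n = (if n = 0 then lm else if n = N then lp else lb n)" for n
  have deriv_l: "(l n has_field_derivative 1 / edge n x) (at (edge n x))" if "n \<in> {0..N}" for n
    using that l by (auto simp: l_def intro!: ln_branch_has_field_derivative)
  have "((\<lambda>t. \<Sum>n\<in>{0..N}. l n (edge n x + (t - x (v, \<alpha>)) * edge_grad n v x \<alpha>)) has_field_derivative
      (\<Sum>n\<in>{0..N}. 1 / edge n x * edge_grad n v x \<alpha>)) (at (x (v, \<alpha>)))"
  proof (intro DERIV_sum DERIV_chain2[where f = "l _"])
    fix n assume n: "n \<in> {0..N}"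
    show "((\<lambda>t. edge n x + (t - x (v, \<alpha>)) * edge_grad n v x \<alpha>) has_field_derivative edge_grad n v x \<alpha>) (at (x (v, \<alpha>)))"
      by (auto intro!: derivative_eq_intros)
    show "(l n has_field_derivative 1 / edge n x) (at (edge n x + (x (v, \<alpha>) - x (v, \<alpha>)) * edge_grad n v x \<alpha>))"
      using deriv_l[OF n] by simp
  qed
  moreover have "Hamiltonian \<tau> \<nu> N C lm lp lb (x((v, \<alpha>) := t)) = (\<Sum>n\<in>{0..N}. l n (edge n x + (t - x (v, \<alpha>)) * edge_grad n v x \<alpha>))" for t
    unfolding Hamiltonian_eq[OF N] l_def[symmetric]
    by (intro sum.cong refl arg_cong[where f = "l _"] edge_upd \<alpha> N v) auto
  ultimately show ?thesis
    unfolding partial_def by (simp add: DERIV_imp_deriv)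
qed

lemma sum_edge_grad:
  assumes "N \<ge> 1"
  shows "(\<Sum>n\<in>{0..N}. edge_grad n (Bdry Minus) x \<alpha> / edge n x) = 1 / edge 0 x * vertex_vec 1 x \<alpha> + 0 * 0"
    and "(\<Sum>n\<in>{0..N}. edge_grad n (Bdry Plus) x \<alpha> / edge n x) = 1 / edge N x * vertex_vec N x \<alpha> + 0 * 0"
    and "m < N \<Longrightarrow> (\<Sum>n\<in>{0..N}. edge_grad n (Site (Suc m)) x \<alpha> / edge n x) =
       1 / edge m x * vertex_vec m x \<alpha> + 1 / edge (Suc m) x * vertex_vec (Suc (Suc m)) x \<alpha>"
proof -
  have "(\<Sum>n\<in>{0..N}. edge_grad n (Bdry Minus) x \<alpha> / edge n x) = (\<Sum>n\<in>{0..N}. if n = 0 then vertex_vec 1 x \<alpha> / edge 0 x else 0)"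
    by (intro sum.cong) auto
  then show "(\<Sum>n\<in>{0..N}. edge_grad n (Bdry Minus) x \<alpha> / edge n x) = 1 / edge 0 x * vertex_vec 1 x \<alpha> + 0 * 0"
    by simp
  have "(\<Sum>n\<in>{0..N}. edge_grad n (Bdry Plus) x \<alpha> / edge n x) = (\<Sum>n\<in>{0..N}. if n = N then vertex_vec N x \<alpha> / edge N x else 0)"
    by (intro sum.cong) auto
  then show "(\<Sum>n\<in>{0..N}. edge_grad n (Bdry Plus) x \<alpha> / edge n x) = 1 / edge N x * vertex_vec N x \<alpha> + 0 * 0"
    by simp
  assume m: "m < N"
  have "(\<Sum>n\<in>{0..N}. edge_grad n (Site (Suc m)) x \<alpha> / edge n x) =
     (\<Sum>n\<in>{0..N}. (if n = m then vertex_vec m x \<alpha> / edge m x else 0) + (if n = Suc m then vertex_vec (Suc (Suc m)) x \<alpha> / edge (Suc m) x else 0))"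
    by (intro sum.cong) auto
  then show "(\<Sum>n\<in>{0..N}. edge_grad n (Site (Suc m)) x \<alpha> / edge n x) =
       1 / edge m x * vertex_vec m x \<alpha> + 1 / edge (Suc m) x * vertex_vec (Suc (Suc m)) x \<alpha>"
    unfolding sum.distrib using m by simp
qed

lemma poisson_Hamiltonian_zero:
  assumes N: "N \<ge> 1"
    and sq: "\<And>\<alpha>. \<alpha> \<in> {1..3} \<Longrightarrow> (b \<alpha>)\<^sup>2 = C + D - half_period_E2 \<tau> \<alpha>"
    and nz: "\<And>\<alpha>. \<alpha> \<in> {1..3} \<Longrightarrow> b \<alpha> \<noteq> 0"
    and det: "\<And>n. n \<in> {1..N} \<Longrightarrow> site_det b n x \<noteq> 0"
    and D: "D \<noteq> 0"
    and rank: "\<And>n. n \<in> {1..N} \<Longrightarrow> (x (Site n, 0))\<^sup>2 = (\<Sum>\<alpha>=1..3. (x (Site n, \<alpha>))\<^sup>2 * (C - half_period_E2 \<tau> \<alpha>))"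
    and edge: "\<And>n. n \<in> {0..N} \<Longrightarrow> edge n x \<noteq> 0"
    and l: "ln_branch_at (edge 0 x) lm" "ln_branch_at (edge N x) lp" "\<And>n. n \<in> {1..<N} \<Longrightarrow> ln_branch_at (edge n x) (lb n)"
  shows "poisson \<tau> \<nu> N (Hamiltonian \<tau> \<nu> N C lm lp lb) (transfer_ratio b \<nu> N) x = 0"
proof -
  let ?e = "half_period_E2 \<tau>" and ?H = "Hamiltonian \<tau> \<nu> N C lm lp lb"
  let ?\<Delta> = "\<Prod>n=1..N. site_det b n x"
  \<comment> \<open>Counterpart of the telescoping quantity \<open>R n\<close>. With nonzero roots
    of C - e_\<alpha> in the \<open>a\<close> slot, U_n and V_n are multiples of the matrices at
    vertices n and n + 1, and R n divided by the trace becomes - 2i J n. The present form needs no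
    roots.\<close>
  define J where "J n = refl_vec b (vertex_vec n x) (vertex_vec (Suc n) x) (left_mat b \<nu> n x) (right_mat b \<nu> N n x) / edge n x" for n
  have V: "Bdry s \<in> vertices N" "n \<in> {1..N} \<Longrightarrow> Site n \<in> vertices N" for s n
    by (auto simp: vertices_def)
  have pH: "partial (v, \<alpha>) ?H x = (\<Sum>n\<in>{0..N}. edge_grad n v x \<alpha> / edge n x)"
    if "\<alpha> \<in> {0..3}" "v \<in> vertices N" for v \<alpha>
    by (rule partial_Hamiltonian[OF N that]) (fact l)+
  have site: "D * (2 * \<i> * vertex_pb ?e (\<lambda>_. 0) (coords (Site n) x) (\<lambda>\<alpha>. partial (Site n, \<alpha>) ?H x) (\<lambda>\<alpha>. partial (Site n, \<alpha>) (transfer_ratio b \<nu> N) x))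
     = - (2 * \<i>) * (J n - J (n - 1)) / ?\<Delta>" if n: "n \<in> {1..N}" for n
  proof -
    obtain m where m: "n = Suc m" using n by (cases n) auto
    have mN: "m < N" using n m by simp
    let ?S = "coords (Site n) x" and ?g = "grad b (site_cofactor b \<nu> N n x)"
    have R: "right_mat b \<nu> N m x = pauli_mat b ?S ** right_mat b \<nu> N n x ** pauli_mat b ?S"
      unfolding m by (rule right_mat_step[OF mN])
    have L: "left_mat b \<nu> n x = pauli_mat b ?S ** left_mat b \<nu> m x ** pauli_mat b ?S"
      unfolding m by simp
    have k: "dot (vertex_vec m x) ?S = edge m x" "dot (vertex_vec (Suc n) x) ?S = edge n x"
      using edge_left[OF mN, of x] edge_right[OF n, of x] by (simp_all add: m)
    have ne: "edge m x \<noteq> 0" "edge n x \<noteq> 0"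
      using mN n by (auto intro!: edge)
    \<comment> \<open>The site is taken together with its two neighbours as \<open>k\<close> and
      \<open>l\<close>. Division by the two adjacent edges turns the identity into a difference of
      \<open>J\<close>.\<close>
    have "defect b ?e D C ?S (vertex_vec m x) (vertex_vec (Suc n) x) (left_mat b \<nu> m x) (right_mat b \<nu> N n x) = 0"
      by (rule defect_zero[OF sq]) (use rank[OF n] in \<open>auto simp: coords_def\<close>)
    then have "D * (edge n x * vertex_pb ?e (\<lambda>_. 0) ?S (vertex_vec m x) ?g + edge m x * vertex_pb ?e (\<lambda>_. 0) ?S (vertex_vec (Suc n) x) ?g)
       + edge m x * (J n * edge n x) - edge n x * (J m * edge m x) = 0"
      using ne unfolding defect_def k J_def R[symmetric] L[symmetric] vertex_vec_eqs(2)[OF n, symmetric]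
      by (simp add: site_cofactor_def m)
    then have eq: "D * (1 / edge m x * vertex_pb ?e (\<lambda>_. 0) ?S (vertex_vec m x) ?g + 1 / edge n x * vertex_pb ?e (\<lambda>_. 0) ?S (vertex_vec (Suc n) x) ?g) = - (J n - J m)"
      using ne by (simp add: field_simps)
    define w where "w = 1 / edge m x * vertex_pb ?e (\<lambda>_. 0) ?S (vertex_vec m x) ?g + 1 / edge n x * vertex_pb ?e (\<lambda>_. 0) ?S (vertex_vec (Suc n) x) ?g"
    have "vertex_pb ?e (\<lambda>_. 0) ?S (\<lambda>\<alpha>. partial (Site n, \<alpha>) ?H x) (\<lambda>\<alpha>. partial (Site n, \<alpha>) (transfer_ratio b \<nu> N) x) =
      vertex_pb ?e (\<lambda>_. 0) ?S (\<lambda>\<alpha>. partial (Site n, \<alpha>) ?H x) ?g / ?\<Delta>"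
      by (rule vertex_pb_Site_transfer_ratio(1)[OF sq det n])
    also have "vertex_pb ?e (\<lambda>_. 0) ?S (\<lambda>\<alpha>. partial (Site n, \<alpha>) ?H x) ?g =
        vertex_pb ?e (\<lambda>_. 0) ?S (\<lambda>\<alpha>. 1 / edge m x * vertex_vec m x \<alpha> + 1 / edge n x * vertex_vec (Suc n) x \<alpha>) ?g"
    proof (rule vertex_pb_cong[OF _ refl])
      show "partial (Site n, \<alpha>) ?H x = 1 / edge m x * vertex_vec m x \<alpha> + 1 / edge n x * vertex_vec (Suc n) x \<alpha>" if "\<alpha> \<in> {0..3}" for \<alpha>
        by (rule trans[OF pH[OF that V(2)[OF n]] sum_edge_grad(3)[OF N mN, folded m]])
    qed
    finally have vertex_pb: "vertex_pb ?e (\<lambda>_. 0) ?S (\<lambda>\<alpha>. partial (Site n, \<alpha>) ?H x) (\<lambda>\<alpha>. partial (Site n, \<alpha>) (transfer_ratio b \<nu> N) x) =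
        w / ?\<Delta>"
      unfolding vertex_pb_linear w_def .
    have *: "D * (2 * \<i> * (w / ?\<Delta>)) = 2 * \<i> * (D * w) / ?\<Delta>" by simp
    show ?thesis
      unfolding vertex_pb * eq[folded w_def] unfolding m diff_Suc_1
      by (simp only: mult_minus_left mult_minus_right)
  qed
  have minus: "D * (4 * \<i> * vertex_pb ?e (\<nu> Minus) (coords (Bdry Minus) x) (\<lambda>\<alpha>. partial (Bdry Minus, \<alpha>) ?H x) (\<lambda>\<alpha>. partial (Bdry Minus, \<alpha>) (transfer_ratio b \<nu> N) x))
    = - (2 * \<i>) * J 0 / ?\<Delta>"
  proof -
    have e: "edge 0 x \<noteq> 0" by (rule edge) simp
    let ?S = "coords (Bdry Minus) x" and ?g = "grad b (right_mat b \<nu> N 0 x)"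
    have "refl_vec b (vertex_vec 0 x) (vertex_vec (Suc 0) x) (lax b (\<nu> Minus) ?S) (right_mat b \<nu> N 0 x) = - 2 * D * vertex_pb ?e (\<nu> Minus) ?S (vertex_vec (Suc 0) x) ?g"
      unfolding vertex_vec_eqs(1) by (rule refl_vec_vertex_pb[where c = C]) (use nz sq in auto)
    then have J: "J 0 * edge 0 x = - 2 * D * vertex_pb ?e (\<nu> Minus) ?S (vertex_vec 1 x) ?g"
      using edge[of 0] by (simp add: J_def One_nat_def)
    have "vertex_pb ?e (\<nu> Minus) ?S (\<lambda>\<alpha>. partial (Bdry Minus, \<alpha>) ?H x) ?g =
        vertex_pb ?e (\<nu> Minus) ?S (\<lambda>\<alpha>. 1 / edge 0 x * vertex_vec 1 x \<alpha> + 0 * 0) ?g"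
    proof (rule vertex_pb_cong[OF _ refl])
      show "partial (Bdry Minus, \<alpha>) ?H x = 1 / edge 0 x * vertex_vec 1 x \<alpha> + 0 * 0" if "\<alpha> \<in> {0..3}" for \<alpha>
        by (rule trans[OF pH[OF that V(1)] sum_edge_grad(1)[OF N]])
    qed
    then have "D * (4 * \<i> * vertex_pb ?e (\<nu> Minus) ?S (\<lambda>\<alpha>. partial (Bdry Minus, \<alpha>) ?H x) ?g) * edge 0 x = - (2 * \<i>) * (J 0 * edge 0 x)"
      unfolding J vertex_pb_linear using e by simp
    then have *: "D * (4 * \<i> * vertex_pb ?e (\<nu> Minus) ?S (\<lambda>\<alpha>. partial (Bdry Minus, \<alpha>) ?H x) ?g) = - (2 * \<i>) * J 0"
      unfolding mult.assoc[of "- (2 * \<i>)" "J 0" "edge 0 x", symmetric] by (simp only: mult_right_cancel[OF e])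
    show ?thesis
      unfolding vertex_pb_Minus_transfer_ratio *[symmetric] by simp
  qed
  have plus: "D * (4 * \<i> * vertex_pb ?e (\<nu> Plus) (coords (Bdry Plus) x) (\<lambda>\<alpha>. partial (Bdry Plus, \<alpha>) ?H x) (\<lambda>\<alpha>. partial (Bdry Plus, \<alpha>) (transfer_ratio b \<nu> N) x))
    = 2 * \<i> * J N / ?\<Delta>"
  proof -
    have e: "edge N x \<noteq> 0" by (rule edge) simp
    let ?S = "coords (Bdry Plus) x" and ?g = "grad b (left_mat b \<nu> N x)"
    \<comment> \<open>Seen from \<open>Plus\<close>, the two vectors and the two matrices come in
      reversed order. The resulting sign change makes this end cancel the last term of the
      telescoping sum.\<close>
    have "refl_vec b (vertex_vec (Suc N) x) (vertex_vec N x) (lax b (\<nu> Plus) ?S) (left_mat b \<nu> N x) = - 2 * D * vertex_pb ?e (\<nu> Plus) ?S (vertex_vec N x) ?g"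
      unfolding vertex_vec_eqs(3) by (rule refl_vec_vertex_pb[where c = C]) (use nz sq in auto)
    then have J: "J N * edge N x = 2 * D * vertex_pb ?e (\<nu> Plus) ?S (vertex_vec N x) ?g"
      using edge[of N] by (simp add: J_def right_mat_self refl_vec_swap[of b "vertex_vec (Suc N) x"])
    have "vertex_pb ?e (\<nu> Plus) ?S (\<lambda>\<alpha>. partial (Bdry Plus, \<alpha>) ?H x) ?g =
        vertex_pb ?e (\<nu> Plus) ?S (\<lambda>\<alpha>. 1 / edge N x * vertex_vec N x \<alpha> + 0 * 0) ?g"
    proof (rule vertex_pb_cong[OF _ refl])
      show "partial (Bdry Plus, \<alpha>) ?H x = 1 / edge N x * vertex_vec N x \<alpha> + 0 * 0" if "\<alpha> \<in> {0..3}" for \<alpha>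
        by (rule trans[OF pH[OF that V(1)] sum_edge_grad(2)[OF N]])
    qed
    then have "D * (4 * \<i> * vertex_pb ?e (\<nu> Plus) ?S (\<lambda>\<alpha>. partial (Bdry Plus, \<alpha>) ?H x) ?g) * edge N x = 2 * \<i> * (J N * edge N x)"
      unfolding J vertex_pb_linear using e by simp
    then have *: "D * (4 * \<i> * vertex_pb ?e (\<nu> Plus) ?S (\<lambda>\<alpha>. partial (Bdry Plus, \<alpha>) ?H x) ?g) = 2 * \<i> * J N"
      unfolding mult.assoc[of "2 * \<i>" "J N" "edge N x", symmetric] by (simp only: mult_right_cancel[OF e])
    show ?thesis
      unfolding vertex_pb_Plus_transfer_ratio *[symmetric] by simp
  qed
  have sum: "D * (\<Sum>n=1..N. 2 * \<i> * vertex_pb ?e (\<lambda>_. 0) (coords (Site n) x) (\<lambda>\<alpha>. partial (Site n, \<alpha>) ?H x) (\<lambda>\<alpha>. partial (Site n, \<alpha>) (transfer_ratio b \<nu> N) x))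
     = - (2 * \<i>) * (J N - J 0) / ?\<Delta>"
  proof -
    have "(\<Sum>n=1..N. J n - J (n - 1)) = J N - J 0"
      by (induction N) auto
    moreover have "(\<Sum>n=1..N. D * (2 * \<i> * vertex_pb ?e (\<lambda>_. 0) (coords (Site n) x) (\<lambda>\<alpha>. partial (Site n, \<alpha>) ?H x) (\<lambda>\<alpha>. partial (Site n, \<alpha>) (transfer_ratio b \<nu> N) x)))
        = (\<Sum>n=1..N. - (2 * \<i>) * (J n - J (n - 1)) / ?\<Delta>)"
      by (intro sum.cong refl site)
    moreover have "(\<Sum>n=1..N. - (2 * \<i>) * (J n - J (n - 1)) / ?\<Delta>) = - (2 * \<i>) * (\<Sum>n=1..N. J n - J (n - 1)) / ?\<Delta>"
      by (simp only: sum_distrib_left sum_divide_distrib)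
    ultimately show ?thesis
      by (simp only: sum_distrib_left)
  qed
  have "D * poisson \<tau> \<nu> N ?H (transfer_ratio b \<nu> N) x = 0"
    unfolding poisson_eq distrib_left minus plus sum add_divide_distrib[symmetric] by (simp add: algebra_simps)
  then show ?thesis using D by simp
qed

end


section \<open>Return to h(z) and to the level set\<close>

lemma transfer_defined_imp:
  assumes "Im \<tau> > 0" "transfer_defined \<tau> N z x"
  shows "\<And>\<alpha>. \<alpha> \<in> {1..3} \<Longrightarrow> phi \<tau> \<alpha> z \<noteq> 0"
    and "\<And>\<alpha>. \<alpha> \<in> {1..3} \<Longrightarrow> (phi \<tau> \<alpha> z)\<^sup>2 = E2 \<tau> z - half_period_E2 \<tau> \<alpha>"
    and "\<And>n. n \<in> {1..N} \<Longrightarrow> site_det (\<lambda>\<alpha>. phi \<tau> \<alpha> z) n x \<noteq> 0"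
proof -
  show phi: "phi \<tau> \<alpha> z \<noteq> 0" if "\<alpha> \<in> {1..3}" for \<alpha>
    using assms(2) that by (simp add: transfer_defined_def)
  show "(phi \<tau> \<alpha> z)\<^sup>2 = E2 \<tau> z - half_period_E2 \<tau> \<alpha>" if "\<alpha> \<in> {1..3}" for \<alpha>
  proof -
    \<comment> \<open>Division by zero yields 0, so a zero of theta at the half period would force
      \<open>phi\<close> to vanish.\<close>
    have "theta \<tau> (half_period \<tau> \<alpha>) \<noteq> 0" using phi[OF that] by (auto simp: phi_eq)
    then show ?thesis
      using assms unfolding half_period_E2_def by (intro phi_square) (auto simp: transfer_defined_def)
  qed
  show "site_det (\<lambda>\<alpha>. phi \<tau> \<alpha> z) n x \<noteq> 0" if "n \<in> {1..N}" for n
    using assms(2) that unfolding transfer_defined_def invertible_Lax_iff[OF phi_minus] by blast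
qed

lemma partial_transfer_defined:
  assumes "Im \<tau> > 0" "transfer_defined \<tau> N z x" "\<alpha> \<in> {0..3}"
  shows "partial (v, \<alpha>) (transfer \<tau> \<nu> N z) x = partial (v, \<alpha>) (transfer_ratio (\<lambda>\<alpha>. phi \<tau> \<alpha> z) \<nu> N) x"
  by (rule partial_transfer[OF phi_minus transfer_defined_imp(3)[OF assms(1,2)] assms(3)])

lemma poisson_transfer_transfer:
  assumes \<tau>: "Im \<tau> > 0" and z: "transfer_defined \<tau> N z x" and w: "transfer_defined \<tau> N w x"
  shows "poisson \<tau> \<nu> N (transfer \<tau> \<nu> N z) (transfer \<tau> \<nu> N w) x = 0"
proof -
  have "poisson \<tau> \<nu> N (transfer \<tau> \<nu> N z) (transfer \<tau> \<nu> N w) x =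
    poisson \<tau> \<nu> N (transfer_ratio (\<lambda>\<alpha>. phi \<tau> \<alpha> z) \<nu> N) (transfer_ratio (\<lambda>\<alpha>. phi \<tau> \<alpha> w) \<nu> N) x"
    by (intro poisson_cong partial_transfer_defined \<tau> z w)
  also have "\<dots> = 0"
  proof (rule poisson_transfer_ratio[where c = "E2 \<tau> z" and D = "E2 \<tau> w - E2 \<tau> z"])
    show "(phi \<tau> \<alpha> w)\<^sup>2 = E2 \<tau> z + (E2 \<tau> w - E2 \<tau> z) - half_period_E2 \<tau> \<alpha>" if "\<alpha> \<in> {1..3}" for \<alpha>
      using transfer_defined_imp(2)[OF \<tau> w that] by simp
  qed (use transfer_defined_imp[OF \<tau> z] transfer_defined_imp[OF \<tau> w] in auto)
  finally show ?thesis .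
qed

lemma poisson_Hamiltonian_transfer:
  assumes \<tau>: "Im \<tau> > 0" and N: "N \<ge> 1" and level: "on_level_set \<tau> N C x" and w: "transfer_defined \<tau> N w x"
    and m: "boundary_arg \<tau> \<nu> C Minus 1 x \<noteq> 0" "ln_branch_at (boundary_arg \<tau> \<nu> C Minus 1 x) lm"
    and p: "boundary_arg \<tau> \<nu> C Plus N x \<noteq> 0" "ln_branch_at (boundary_arg \<tau> \<nu> C Plus N x) lp"
    and b: "\<And>n. n \<in> {1..<N} \<Longrightarrow> bulk_arg \<tau> C n x \<noteq> 0" "\<And>n. n \<in> {1..<N} \<Longrightarrow> ln_branch_at (bulk_arg \<tau> C n x) (lb n)"
  shows "poisson \<tau> \<nu> N (Hamiltonian \<tau> \<nu> N C lm lp lb) (transfer \<tau> \<nu> N w) x = 0"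
proof -
  let ?e = "half_period_E2 \<tau>"
  \<comment> \<open>The level set condition, cleared of its denominator, says that the site
    determinant vanishes when the squares of the \<open>a \<alpha>\<close> are C -
    e_\<alpha>.\<close>
  have rank: "(x (Site n, 0))\<^sup>2 = (\<Sum>\<alpha>=1..3. (x (Site n, \<alpha>))\<^sup>2 * (C - ?e \<alpha>))"
    and ne: "(\<Sum>\<alpha>=1..3. (x (Site n, \<alpha>))\<^sup>2) \<noteq> 0" if "n \<in> {1..N}" for n
  proof -
    show ne: "(\<Sum>\<alpha>=1..3. (x (Site n, \<alpha>))\<^sup>2) \<noteq> 0"
      using level that unfolding on_level_set_def by blast
    have "((x (Site n, 0))\<^sup>2 + (\<Sum>\<alpha>=1..3. (x (Site n, \<alpha>))\<^sup>2 * ?e \<alpha>)) / (\<Sum>\<alpha>=1..3. (x (Site n, \<alpha>))\<^sup>2) = C"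
      using level that unfolding on_level_set_def half_period_E2_def by blast
    then have 1: "(x (Site n, 0))\<^sup>2 + (\<Sum>\<alpha>=1..3. (x (Site n, \<alpha>))\<^sup>2 * ?e \<alpha>) = C * (\<Sum>\<alpha>=1..3. (x (Site n, \<alpha>))\<^sup>2)"
      using ne by (subst (asm) nonzero_divide_eq_eq) (simp_all only: mult.commute not_False_eq_True)
    have 2: "(\<Sum>\<alpha>=1..3. (x (Site n, \<alpha>))\<^sup>2 * (C - ?e \<alpha>)) =
        C * (\<Sum>\<alpha>=1..3. (x (Site n, \<alpha>))\<^sup>2) - (\<Sum>\<alpha>=1..3. (x (Site n, \<alpha>))\<^sup>2 * ?e \<alpha>)"
      by (simp add: sum13 algebra_simps)
    show "(x (Site n, 0))\<^sup>2 = (\<Sum>\<alpha>=1..3. (x (Site n, \<alpha>))\<^sup>2 * (C - ?e \<alpha>))"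
      unfolding 2 1[symmetric] by simp
  qed
  \<comment> \<open>If E2(w) were C, the first site matrix would be singular at w, contrary to the
    invertibility contained in \<open>transfer_defined\<close>.\<close>
  have D: "E2 \<tau> w - C \<noteq> 0"
  proof
    assume "E2 \<tau> w - C = 0"
    then have "site_det (\<lambda>\<alpha>. phi \<tau> \<alpha> w) 1 x = 0"
      unfolding site_det_def using rank[of 1] N transfer_defined_imp(2)[OF \<tau> w] by simp
    then show False using transfer_defined_imp(3)[OF \<tau> w, of 1] N by simp
  qed
  note edge = boundary_arg_edge[OF N, of \<tau> \<nu> C x] 
  have "poisson \<tau> \<nu> N (Hamiltonian \<tau> \<nu> N C lm lp lb) (transfer \<tau> \<nu> N w) x =
    poisson \<tau> \<nu> N (Hamiltonian \<tau> \<nu> N C lm lp lb) (transfer_ratio (\<lambda>\<alpha>. phi \<tau> \<alpha> w) \<nu> N) x"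
    by (intro poisson_cong refl partial_transfer_defined \<tau> w)
  also have "\<dots> = 0"
  proof (rule poisson_Hamiltonian_zero[OF N _ _ _ D])
    show "(phi \<tau> \<alpha> w)\<^sup>2 = C + (E2 \<tau> w - C) - ?e \<alpha>" if "\<alpha> \<in> {1..3}" for \<alpha>
      using transfer_defined_imp(2)[OF \<tau> w that] by simp
    show "edge C \<tau> \<nu> N n x \<noteq> 0" if n: "n \<in> {0..N}" for n
    proof -
      consider "n = 0" | "n = N" | "n \<in> {1..<N}" using n by force
      then show ?thesis
      proof cases
        case 3
        show ?thesis using b(1)[OF 3] unfolding bulk_arg_edge[OF 3, where \<nu> = \<nu>] .
      next
        case 1
        then show ?thesis using m(1) unfolding edge by simp
      next
        case 2
        then show ?thesis using p(1) unfolding edge by simp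
      qed
    qed
    show "ln_branch_at (edge C \<tau> \<nu> N n x) (lb n)" if "n \<in> {1..<N}" for n
      using b(2)[OF that] unfolding bulk_arg_edge[OF that, where \<nu> = \<nu>] .
    show "phi \<tau> \<alpha> w \<noteq> 0" if "\<alpha> \<in> {1..3}" for \<alpha>
      by (rule transfer_defined_imp(1)[OF \<tau> w that])
    show "site_det (\<lambda>\<alpha>. phi \<tau> \<alpha> w) n x \<noteq> 0" if "n \<in> {1..N}" for n
      by (rule transfer_defined_imp(3)[OF \<tau> w that])
    show "ln_branch_at (edge C \<tau> \<nu> N 0 x) lm" "ln_branch_at (edge C \<tau> \<nu> N N x) lp"
      using m(2) p(2) unfolding edge .
  qed (rule rank)
  finally show ?thesis .
qed

theorem proposition8p3:
  fixes \<tau> :: complex and N :: nat and \<nu> :: "boundary \<Rightarrow> nat \<Rightarrow> complex"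
  assumes "Im \<tau> > 0" and "N \<ge> 1"
  shows "(\<forall>z w x. transfer_defined \<tau> N z x \<and> transfer_defined \<tau> N w x \<longrightarrow>
            poisson \<tau> \<nu> N (transfer \<tau> \<nu> N z) (transfer \<tau> \<nu> N w) x = 0) \<and>
         (\<forall>C w x lm lp lb.
            on_level_set \<tau> N C x \<and> transfer_defined \<tau> N w x \<and>
            boundary_arg \<tau> \<nu> C Minus 1 x \<noteq> 0 \<and> ln_branch_at (boundary_arg \<tau> \<nu> C Minus 1 x) lm \<and>
            boundary_arg \<tau> \<nu> C Plus N x \<noteq> 0 \<and> ln_branch_at (boundary_arg \<tau> \<nu> C Plus N x) lp \<and>
            (\<forall>n\<in>{1..<N}. bulk_arg \<tau> C n x \<noteq> 0 \<and> ln_branch_at (bulk_arg \<tau> C n x) (lb n)) \<longrightarrow>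
            poisson \<tau> \<nu> N (Hamiltonian \<tau> \<nu> N C lm lp lb) (transfer \<tau> \<nu> N w) x = 0)"
  using poisson_transfer_transfer[OF assms(1)] poisson_Hamiltonian_transfer[OF assms] by blast

end
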